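(* Let $f:\mathbb{R}\to[0,\infty)$ be a smooth function vanishing at infinity, such that the first and second derivatives of $|f'|$ exist, and suppose there is a constant $\alpha>0$ such that for all $x\in\mathbb{R}$ $$|f(x)|\le \frac{\alpha}{1+x^2},\quad |f'(x)|\le \frac{\alpha}{1+x^2},\quad |f''(x)|\le \frac{\alpha}{1+x^2},\quad |f'''(x)|\le \frac{\alpha}{1+x^2}.$$ Assume moreover that for all $x\in\mathbb{R}$ $$|f'(x)|\le \frac{2\sqrt{3}}{\sqrt{4\pi^2+3}}\sqrt{f(x)(2+f(x))},$$ and that there is at least one point $x\in\mathbb{R}$ at which this inequality is strict. Then the discrete spectrum of the (non-magnetic) Dirichlet Laplacian $H_{\Omega_f}(0)$ below the threshold of its essential spectrum is non-empty.
   Context: For a non-negative smooth function $f:\mathbb{R}\to[0,\infty)$ vanishing at infinity, define the waveguide $$\Omega_f=\{(x,y)\in\mathbb{R}^2:\ 0<y<\pi+\pi f(x)\}.$$ $H_{\Omega_f}(0)$ denotes the Dirichlet Laplacian on $\Omega_f$, i.e. the unique non-negative self-adjoint operator on $L^2(\Omega_f)$ associated with the closed quadratic form $q_{\Omega_f}^{0}[\psi]=\|\nabla\psi\|^2_{L^2(\Omega_f)}$, $\psi\in\mathcal{H}_0^1(\Omega_f)$. The threshold of the essential spectrum is its infimum; if the first and second derivatives of $|f'|$ exist and there is a constant $\alpha>0$ such that $|f(x)|$, $|f'(x)|$, $|f''(x)|$ and $|f'''(x)|$ are all bounded by $\frac{\alpha}{1+x^2}$ for all $x\in\mathbb{R}$,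 the essential spectrum of $H_{\Omega_f}(0)$ is $[1,\infty)$, so the threshold equals $1$. The discrete spectrum is the set of isolated eigenvalues of finite multiplicity. *)

theory Defs
  imports "HOL-Analysis.Analysis"
begin

subsection \<open>Smooth functions\<close>

primrec C_k :: "nat \<Rightarrow> ('a::euclidean_space \<Rightarrow> 'b::real_normed_vector) \<Rightarrow> bool" where
  "C_k 0 f \<longleftrightarrow> continuous_on UNIV f"
| "C_k (Suc k) f \<longleftrightarrow>
     f differentiable_on UNIV \<and> (\<forall>e\<in>Basis. C_k k (\<lambda>x. frechet_derivative f (at x) e))"

definition smooth :: "('a::euclidean_space \<Rightarrow> 'b::real_normed_vector) \<Rightarrow> bool" where
  "smooth f \<longleftrightarrow> (\<forall>k. C_k k f)"


subsection \<open>Lebesgue and Sobolev spaces on a domain\<close>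

text \<open>
  Elements of \<open>L\<^sup>2(\<Omega>)\<close> are represented by functions on the whole space: the values outside
  \<open>\<Omega>\<close> are irrelevant, and functions agreeing almost everywhere on \<open>\<Omega>\<close> represent the same element.
\<close>

definition L2_space :: "'a::euclidean_space set \<Rightarrow> ('a \<Rightarrow> complex) set" where
  "L2_space \<Omega> = {u \<in> borel_measurable (lebesgue_on \<Omega>).
                    integrable (lebesgue_on \<Omega>) (\<lambda>x. (norm (u x))\<^sup>2)}"

definition L2_inner :: "'a::euclidean_space set \<Rightarrow> ('a \<Rightarrow> complex) \<Rightarrow> ('a \<Rightarrow> complex) \<Rightarrow> complex" where
  "L2_inner \<Omega> u v = (LINT x|lebesgue_on \<Omega>. u x * cnj (v x))"

definition L2_norm :: "'a::euclidean_space set \<Rightarrow> ('a \<Rightarrow> complex) \<Rightarrow> real" where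
  "L2_norm \<Omega> u = sqrt (LINT x|lebesgue_on \<Omega>. (norm (u x))\<^sup>2)"

definition test_functions :: "'a::euclidean_space set \<Rightarrow> ('a \<Rightarrow> complex) set" where
  "test_functions \<Omega> =
     {\<phi>. smooth \<phi> \<and> compact (closure {x. \<phi> x \<noteq> 0}) \<and> closure {x. \<phi> x \<noteq> 0} \<subseteq> \<Omega>}"

definition has_weak_partial ::
    "'a::euclidean_space set \<Rightarrow> 'a \<Rightarrow> ('a \<Rightarrow> complex) \<Rightarrow> ('a \<Rightarrow> complex) \<Rightarrow> bool" where
  "has_weak_partial \<Omega> e u g \<longleftrightarrow> g \<in> L2_space \<Omega> \<and>
     (\<forall>\<phi>\<in>test_functions \<Omega>.
        (LINT x|lebesgue_on \<Omega>. u x * frechet_derivative \<phi> (at x) e) =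
        - (LINT x|lebesgue_on \<Omega>. g x * \<phi> x))"

text \<open>For open \<open>\<Omega>\<close> a weak derivative is unique up to null sets, so the choice is immaterial below.\<close>

definition weak_partial :: "'a::euclidean_space set \<Rightarrow> 'a \<Rightarrow> ('a \<Rightarrow> complex) \<Rightarrow> 'a \<Rightarrow> complex" where
  "weak_partial \<Omega> e u = (SOME g. has_weak_partial \<Omega> e u g)"

definition H1_space :: "'a::euclidean_space set \<Rightarrow> ('a \<Rightarrow> complex) set" where
  "H1_space \<Omega> = {u \<in> L2_space \<Omega>. \<forall>e\<in>Basis. \<exists>g. has_weak_partial \<Omega> e u g}"

definition H1_norm :: "'a::euclidean_space set \<Rightarrow> ('a \<Rightarrow> complex) \<Rightarrow> real" where
  "H1_norm \<Omega> u =
     sqrt ((L2_norm \<Omega> u)\<^sup>2 + (\<Sum>e\<in>Basis. (L2_norm \<Omega> (weak_partial \<Omega> e u))\<^sup>2))"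

definition H10_space :: "'a::euclidean_space set \<Rightarrow> ('a \<Rightarrow> complex) set" where
  "H10_space \<Omega> = {u \<in> H1_space \<Omega>. \<exists>\<phi>::nat \<Rightarrow> 'a \<Rightarrow> complex.
     (\<forall>n. \<phi> n \<in> test_functions \<Omega>) \<and>
     (\<lambda>n. H1_norm \<Omega> (\<lambda>x. \<phi> n x - u x)) \<longlonglongrightarrow> 0}"


subsection \<open>The Dirichlet Laplacian\<close>

text \<open>An operator in \<open>L\<^sup>2(\<Omega>)\<close> is given by its graph, saturated under almost-everywhere equality.\<close>

type_synonym 'a L2_operator = "(('a \<Rightarrow> complex) \<times> ('a \<Rightarrow> complex)) set"

text \<open>
  The operator associated with a sesquilinear form \<open>q\<close> with form domain \<open>D\<close>
  (first representation theorem).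
\<close>

definition form_operator ::
    "'a::euclidean_space set \<Rightarrow> ('a \<Rightarrow> complex) set \<Rightarrow>
     (('a \<Rightarrow> complex) \<Rightarrow> ('a \<Rightarrow> complex) \<Rightarrow> complex) \<Rightarrow> 'a L2_operator" where
  "form_operator \<Omega> D q =
     {(u, w). u \<in> D \<and> w \<in> L2_space \<Omega> \<and> (\<forall>v\<in>D. q u v = L2_inner \<Omega> w v)}"

definition dirichlet_form ::
    "'a::euclidean_space set \<Rightarrow> ('a \<Rightarrow> complex) \<Rightarrow> ('a \<Rightarrow> complex) \<Rightarrow> complex" where
  "dirichlet_form \<Omega> u v =
     (\<Sum>e\<in>Basis. L2_inner \<Omega> (weak_partial \<Omega> e u) (weak_partial \<Omega> e v))"

definition dirichlet_laplacian :: "'a::euclidean_space set \<Rightarrow> 'a L2_operator" where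
  "dirichlet_laplacian \<Omega> = form_operator \<Omega> (H10_space \<Omega>) (dirichlet_form \<Omega>)"


subsection \<open>Spectra\<close>

text \<open>
  \<open>z\<close> is in the resolvent set iff \<open>A - z\<close> maps the domain of \<open>A\<close> onto \<open>L\<^sup>2(\<Omega>)\<close> and is injective
  with bounded inverse; the last two properties are the a priori estimate.
\<close>

definition resolvent_set :: "'a::euclidean_space set \<Rightarrow> 'a L2_operator \<Rightarrow> complex set" where
  "resolvent_set \<Omega> A = {z.
     (\<forall>w\<in>L2_space \<Omega>. \<exists>(u, v)\<in>A. AE x in lebesgue_on \<Omega>. v x - z * u x = w x) \<and>
     (\<exists>C. \<forall>(u, v)\<in>A. L2_norm \<Omega> u \<le> C * L2_norm \<Omega> (\<lambda>x. v x - z * u x))}"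

definition spectrum :: "'a::euclidean_space set \<Rightarrow> 'a L2_operator \<Rightarrow> complex set" where
  "spectrum \<Omega> A = - resolvent_set \<Omega> A"

definition eigenspace ::
    "'a::euclidean_space set \<Rightarrow> 'a L2_operator \<Rightarrow> complex \<Rightarrow> ('a \<Rightarrow> complex) set" where
  "eigenspace \<Omega> A z = {u. \<exists>v. (u, v) \<in> A \<and> (AE x in lebesgue_on \<Omega>. v x = z * u x)}"

definition is_eigenvalue :: "'a::euclidean_space set \<Rightarrow> 'a L2_operator \<Rightarrow> complex \<Rightarrow> bool" where
  "is_eigenvalue \<Omega> A z \<longleftrightarrow>
     (\<exists>u\<in>eigenspace \<Omega> A z. \<not> (AE x in lebesgue_on \<Omega>. u x = 0))"

definition finite_multiplicity :: "'a::euclidean_space set \<Rightarrow> 'a L2_operator \<Rightarrow> complex \<Rightarrow> bool" where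
  "finite_multiplicity \<Omega> A z \<longleftrightarrow>
     (\<exists>B. finite B \<and> B \<subseteq> eigenspace \<Omega> A z \<and>
        (\<forall>u\<in>eigenspace \<Omega> A z. \<exists>c. AE x in lebesgue_on \<Omega>. u x = (\<Sum>b\<in>B. c b * b x)))"

definition discrete_spectrum :: "'a::euclidean_space set \<Rightarrow> 'a L2_operator \<Rightarrow> complex set" where
  "discrete_spectrum \<Omega> A =
     {z. z isolated_in spectrum \<Omega> A \<and> is_eigenvalue \<Omega> A z \<and> finite_multiplicity \<Omega> A z}"

definition essential_spectrum :: "'a::euclidean_space set \<Rightarrow> 'a L2_operator \<Rightarrow> complex set" where
  "essential_spectrum \<Omega> A = spectrum \<Omega> A - discrete_spectrum \<Omega> A"

text \<open>
  Meant for self-adjoint \<open>A\<close>, whose spectrum is real. The infimum is taken in the extended reals, so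
  that it is meaningful without knowing beforehand that the set is nonempty and bounded below.
\<close>

definition essential_threshold :: "'a::euclidean_space set \<Rightarrow> 'a L2_operator \<Rightarrow> ereal" where
  "essential_threshold \<Omega> A = (INF l\<in>{l::real. complex_of_real l \<in> essential_spectrum \<Omega> A}. ereal l)"


subsection \<open>The waveguide\<close>

definition waveguide :: "(real \<Rightarrow> real) \<Rightarrow> (real \<times> real) set" where
  "waveguide f = {(x, y). 0 < y \<and> y < pi + pi * f x}"

end

theory Submission
  imports Defs "HOL-Library.Function_Algebras" "HOL-Real_Asymp.Real_Asymp"
begin

text \<open>
  Write \<open>h = 1 + f\<close>. On the cross section of width \<open>\<pi> h(x)\<close> the one-dimensional Poincare inequality
  gives \<open>\<parallel>\<nabla>u\<parallel>\<^sup>2 \<ge> \<integral> h\<^sup>-\<^sup>2 \<bar>u\<bar>\<^sup>2\<close>, and \<open>h\<^sup>-\<^sup>2\<close> is close to \<open>1\<close> for large \<open>\<bar>x\<bar>\<close>; on the remaining bounded part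
  the Poincare inequality on small squares controls \<open>u\<close> by its gradient and finitely many mean
  values. Hence for every \<open>\<mu> < 1\<close> the inequality \<open>\<mu> \<parallel>u\<parallel>\<^sup>2 \<le> \<parallel>\<nabla>u\<parallel>\<^sup>2\<close> holds up to finitely many bounded
  functionals of \<open>u\<close>. If the infimum \<open>E\<close> of the Rayleigh quotient is below \<open>\<mu>\<close>, then sequences
  of almost minimisers are precompact, so \<open>E\<close> is an eigenvalue of finite multiplicity, and there is
  a gap above it; thus \<open>E\<close> is discrete and lies strictly below the essential spectrum, whose exact
  location is not needed.

  That \<open>E < 1\<close> follows from the trial function \<open>g(x) h(x)\<^sup>-\<^sup>1\<^sup>/\<^sup>2 sin(y / h(x))\<close>: after integration in \<open>y\<close>
  its energy minus its squared norm is \<open>\<pi>/2\<close> times \<open>\<integral> g'\<^sup>2 + \<integral> V g\<^sup>2\<close> with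
  \<open>V = h\<^sup>-\<^sup>2 + c (h'/h)\<^sup>2 - 1\<close> and \<open>c = (4 \<pi>\<^sup>2 + 3) / 12\<close>. The slope condition says precisely that
  \<open>V \<le> 0\<close>, with strict inequality somewhere, and then a slowly varying cutoff \<open>g\<close> makes the sum negative.
\<close>

subsection \<open>Forms with a finite-rank compactness defect\<close>

text \<open>Functions represent their almost-everywhere classes, so every norm here is only a
  seminorm. The abstract part therefore works with semi-inner products on a carrier set and
  identifies vectors whose difference has \<open>nsq\<close> zero. Resolvents are built by hand:
  minimising a coercive functional handles real shifts, and complex points near the eigenvalue are
  reached by a contraction on the complement of the ground states.

  The value \<mu> is chosen strictly between the Rayleigh quotient of the trial function and 1. It
  may be arbitrarily close to 1 because the Poincare inequality on squares of side d costs only d^2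
  times the energy, at the price of more mean values.

  The obstacle on the trial side is that the sine has no compact support inside the cross section.
  It is replaced by smooth profiles whose energies converge; the limiting inequality is strict, so a
  late profile satisfies it too. The constant c is the cost of stretching the sine along x: (2 / pi)
  times the integral of (sin t / 2 + t cos t)^2 over [0, pi].\<close>

locale semi_inner = vector_space scale
  for scale :: "complex \<Rightarrow> 'v::ab_group_add \<Rightarrow> 'v" (infixr "\<cdot>" 75) +
  fixes S :: "'v set" and ip :: "'v \<Rightarrow> 'v \<Rightarrow> complex"
  assumes subspace_carrier: "subspace S"
    and ip_add_left: "\<And>u v w. \<lbrakk>u \<in> S; v \<in> S; w \<in> S\<rbrakk> \<Longrightarrow> ip (u + v) w = ip u w + ip v w"
    and ip_scale_left: "\<And>c u v. \<lbrakk>u \<in> S; v \<in> S\<rbrakk> \<Longrightarrow> ip (c \<cdot> u) v = c * ip u v"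
    and ip_cnj: "\<And>u v. \<lbrakk>u \<in> S; v \<in> S\<rbrakk> \<Longrightarrow> ip v u = cnj (ip u v)"
    and ip_ge0: "\<And>u. u \<in> S \<Longrightarrow> 0 \<le> Re (ip u u)"
begin

definition nsq :: "'v \<Rightarrow> real" where "nsq u = Re (ip u u)"

definition nrm :: "'v \<Rightarrow> real" where "nrm u = sqrt (nsq u)"

lemma closed_ops [simp, intro]:
  "0 \<in> S" "u \<in> S \<Longrightarrow> v \<in> S \<Longrightarrow> u + v \<in> S" "u \<in> S \<Longrightarrow> v \<in> S \<Longrightarrow> u - v \<in> S"
  "u \<in> S \<Longrightarrow> c \<cdot> u \<in> S" "u \<in> S \<Longrightarrow> - u \<in> S"
  using subspace_carrier by (auto simp: subspace_0 subspace_add subspace_diff subspace_scale subspace_neg)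

lemma ip_add_right: "\<lbrakk>u \<in> S; v \<in> S; w \<in> S\<rbrakk> \<Longrightarrow> ip u (v + w) = ip u v + ip u w"
  by (subst (1 2 3) ip_cnj) (auto simp: ip_add_left)

lemma ip_scale_right: "\<lbrakk>u \<in> S; v \<in> S\<rbrakk> \<Longrightarrow> ip u (c \<cdot> v) = cnj c * ip u v"
  by (subst (1 2) ip_cnj) (auto simp: ip_scale_left)

lemma ip_zero [simp]: "u \<in> S \<Longrightarrow> ip 0 u = 0" "u \<in> S \<Longrightarrow> ip u 0 = 0"
  using ip_scale_left[of u u 0] ip_scale_right[of u u 0] by auto

lemma ip_minus_left: "\<lbrakk>u \<in> S; v \<in> S\<rbrakk> \<Longrightarrow> ip (- u) v = - ip u v"
  using ip_scale_left[of u v "-1"] by simp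

lemma ip_minus_right: "\<lbrakk>u \<in> S; v \<in> S\<rbrakk> \<Longrightarrow> ip u (- v) = - ip u v"
  using ip_scale_right[of u v "-1"] by simp

lemma ip_diff_left: "\<lbrakk>u \<in> S; v \<in> S; w \<in> S\<rbrakk> \<Longrightarrow> ip (u - v) w = ip u w - ip v w"
  using ip_add_left[of u "- v" w] by (simp add: ip_minus_left)

lemma ip_diff_right: "\<lbrakk>u \<in> S; v \<in> S; w \<in> S\<rbrakk> \<Longrightarrow> ip u (v - w) = ip u v - ip u w"
  using ip_add_right[of u v "- w"] by (simp add: ip_minus_right)

lemmas ip_simps = ip_add_left ip_add_right ip_diff_left ip_diff_right ip_minus_left ip_minus_right
  ip_scale_left ip_scale_right

lemma ip_sum_left: "\<lbrakk>\<And>i. i \<in> I \<Longrightarrow> f i \<in> S; w \<in> S\<rbrakk> \<Longrightarrow> ip (\<Sum>i\<in>I. f i) w = (\<Sum>i\<in>I. ip (f i) w)"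
  by (induction I rule: infinite_finite_induct)
     (auto simp: ip_add_left subspace_sum[OF subspace_carrier])

lemma ip_self: "u \<in> S \<Longrightarrow> ip u u = of_real (nsq u)"
  using ip_cnj[of u u] by (auto simp: nsq_def complex_eq_iff)

lemma nsq_ge0 [simp]: "u \<in> S \<Longrightarrow> 0 \<le> nsq u"
  by (simp add: nsq_def ip_ge0)

lemma nsq_pos: "u \<in> S \<Longrightarrow> nsq u \<noteq> 0 \<Longrightarrow> 0 < nsq u"
  by (simp add: order_less_le)

lemma nrm_ge0 [simp]: "u \<in> S \<Longrightarrow> 0 \<le> nrm u"
  by (simp add: nrm_def)

lemma nrm_sq: "u \<in> S \<Longrightarrow> (nrm u)\<^sup>2 = nsq u"
  by (simp add: nrm_def)

lemma nrm_eq0_iff: "u \<in> S \<Longrightarrow> nrm u = 0 \<longleftrightarrow> nsq u = 0"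
  by (simp add: nrm_def)

lemma nsq_scale:
  assumes "u \<in> S"
  shows "nsq (c \<cdot> u) = (cmod c)\<^sup>2 * nsq u"
proof -
  have "ip (c \<cdot> u) (c \<cdot> u) = (c * cnj c) * ip u u"
    using assms by (simp add: ip_scale_left ip_scale_right)
  also have "\<dots> = of_real ((cmod c)\<^sup>2 * nsq u)"
    using assms by (simp add: ip_self flip: complex_norm_square)
  finally show ?thesis unfolding nsq_def using Re_complex_of_real by simp
qed

lemma nrm_scale: "u \<in> S \<Longrightarrow> nrm (c \<cdot> u) = cmod c * nrm u"
  by (simp add: nrm_def nsq_scale real_sqrt_mult)

lemma nsq_add: "u \<in> S \<Longrightarrow> v \<in> S \<Longrightarrow> nsq (u + v) = nsq u + nsq v + 2 * Re (ip u v)"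
  using ip_cnj[of u v] by (simp add: nsq_def ip_simps)

lemma nsq_diff: "u \<in> S \<Longrightarrow> v \<in> S \<Longrightarrow> nsq (u - v) = nsq u + nsq v - 2 * Re (ip u v)"
  using ip_cnj[of u v] by (simp add: nsq_def ip_simps)

lemma nsq_minus [simp]: "u \<in> S \<Longrightarrow> nsq (- u) = nsq u"
  by (simp add: nsq_def ip_simps)

lemma nrm_minus_commute: "u \<in> S \<Longrightarrow> v \<in> S \<Longrightarrow> nrm (u - v) = nrm (v - u)"
  using nsq_minus[of "u - v"] by (simp add: nrm_def)

lemma parallelogram: "u \<in> S \<Longrightarrow> v \<in> S \<Longrightarrow> nsq (u + v) + nsq (u - v) = 2 * nsq u + 2 * nsq v"
  by (simp add: nsq_add nsq_diff)

lemma nsq_diff_le: "u \<in> S \<Longrightarrow> v \<in> S \<Longrightarrow> nsq (u - v) \<le> 2 * nsq u + 2 * nsq v"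
  using parallelogram[of u v] nsq_ge0[OF closed_ops(2)[of u v]] by linarith

text \<open>Nonnegativity of \<open>nsq\<close> at u - t d v for real t, where d =
  \<open>ip u v\<close>. The form may be degenerate, so a v with \<open>nsq v = 0\<close> is a
  separate case, in which the bound is affine in t.\<close>

lemma cauchy_schwarz_sq:
  assumes "u \<in> S" "v \<in> S"
  shows "(cmod (ip u v))\<^sup>2 \<le> nsq u * nsq v"
proof -
  define d where "d = ip u v"
  have *: "0 \<le> nsq u + t\<^sup>2 * (cmod d)\<^sup>2 * nsq v - 2 * t * (cmod d)\<^sup>2" for t :: real
  proof -
    have "0 \<le> nsq (u - (of_real t * d) \<cdot> v)" using assms by simp
    also have "\<dots> = nsq u + (t * cmod d)\<^sup>2 * nsq v - 2 * Re (cnj (of_real t * d) * d)"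
      using assms by (simp add: nsq_diff nsq_scale ip_simps d_def norm_mult power_mult_distrib)
    also have "cnj (of_real t * d) * d = of_real (t * (cmod d)\<^sup>2)"
      using complex_norm_square[of d] by (simp add: mult.commute mult.left_commute)
    finally show ?thesis by (simp add: power_mult_distrib)
  qed
  show ?thesis
  proof (cases "nsq v = 0")
    case True
    have "cmod d = 0"
    proof (rule ccontr)
      assume "cmod d \<noteq> 0"
      \<comment> \<open>With \<open>nsq v = 0\<close> only nsq u - 2 t |d|^2 is left of the bound,
        and this t makes it -1.\<close>
      then show False
        using *[of "(nsq u + 1) / (2 * (cmod d)\<^sup>2)"] assms True by (simp add: field_simps)
    qed
    then show ?thesis using True by (simp add: d_def)
  next
    case False
    then have pos: "nsq v > 0" using assms nsq_ge0[of v] by linarith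
    have "0 \<le> nsq u - (cmod d)\<^sup>2 / nsq v"
      using *[of "1 / nsq v"] pos by (simp add: field_simps power2_eq_square)
    then show ?thesis using pos by (simp add: field_simps d_def)
  qed
qed

lemma cauchy_schwarz: "u \<in> S \<Longrightarrow> v \<in> S \<Longrightarrow> cmod (ip u v) \<le> nrm u * nrm v"
  using cauchy_schwarz_sq[of u v] real_le_rsqrt by (simp add: nrm_def flip: real_sqrt_mult)

lemma nrm_triangle:
  assumes "u \<in> S" "v \<in> S"
  shows "nrm (u + v) \<le> nrm u + nrm v"
proof (rule power2_le_imp_le)
  have "Re (ip u v) \<le> nrm u * nrm v"
    using cauchy_schwarz[OF assms] complex_Re_le_cmod[of "ip u v"] by linarith
  then show "(nrm (u + v))\<^sup>2 \<le> (nrm u + nrm v)\<^sup>2"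
    using assms by (simp add: nrm_sq nsq_add power2_sum)
qed (use assms in simp)

lemma nrm_triangle3:
  "u \<in> S \<Longrightarrow> v \<in> S \<Longrightarrow> w \<in> S \<Longrightarrow> nrm (u - w) \<le> nrm (u - v) + nrm (v - w)"
  using nrm_triangle[of "u - v" "v - w"] by simp

lemma nrm_triangle_rev:
  "u \<in> S \<Longrightarrow> v \<in> S \<Longrightarrow> \<bar>nrm u - nrm v\<bar> \<le> nrm (u - v)"
  using nrm_triangle[of "u - v" v] nrm_triangle[of "v - u" u] nrm_minus_commute[of u v] by auto

lemma ip_tendsto_left:
  assumes X: "\<And>n. X n \<in> S" "u \<in> S" "v \<in> S" and l: "(\<lambda>n. nrm (X n - u)) \<longlonglongrightarrow> 0"
  shows "(\<lambda>n. ip (X n) v) \<longlonglongrightarrow> ip u v"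
proof (rule LIM_zero_cancel, rule tendsto_0_le[where K = "nrm v"])
  show "(\<lambda>n. nrm (X n - u)) \<longlonglongrightarrow> 0" by fact
  show "\<forall>\<^sub>F n in sequentially. cmod (ip (X n) v - ip u v) \<le> norm (nrm (X n - u)) * nrm v"
    using cauchy_schwarz[of "X _ - u" v] X by (intro always_eventually allI) (simp add: ip_simps)
qed

lemma nrm_tendsto:
  assumes X: "\<And>n. X n \<in> S" "u \<in> S" and l: "(\<lambda>n. nrm (X n - u)) \<longlonglongrightarrow> 0"
  shows "(\<lambda>n. nrm (X n)) \<longlonglongrightarrow> nrm u"
proof (rule LIM_zero_cancel, rule tendsto_0_le[where K = 1])
  show "(\<lambda>n. nrm (X n - u)) \<longlonglongrightarrow> 0" by fact
  show "\<forall>\<^sub>F n in sequentially. norm (nrm (X n) - nrm u) \<le> norm (nrm (X n - u)) * 1"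
    using nrm_triangle_rev X by (intro always_eventually allI) simp
qed

lemma nsq_tendsto:
  assumes X: "\<And>n. X n \<in> S" "u \<in> S" and l: "(\<lambda>n. nrm (X n - u)) \<longlonglongrightarrow> 0"
  shows "(\<lambda>n. nsq (X n)) \<longlonglongrightarrow> nsq u"
  using tendsto_power[OF nrm_tendsto[OF assms], of 2] X by (simp add: nrm_sq)

end

section \<open>Closed forms and the solution of weak equations by minimisation\<close>

lemma simultaneous_convergent_subseq:
  fixes X :: "'i \<Rightarrow> nat \<Rightarrow> complex"
  assumes "finite I" and "\<And>i. i \<in> I \<Longrightarrow> bounded (range (X i))"
  shows "\<exists>r::nat \<Rightarrow> nat. strict_mono r \<and> (\<forall>i\<in>I. convergent (X i \<circ> r))"
  using assms
proof (induction I)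
  case empty
  show ?case by (rule exI[of _ id]) (auto simp: strict_mono_def)
next
  case (insert j I)
  then obtain r where r: "strict_mono r" "\<And>i. i \<in> I \<Longrightarrow> convergent (X i \<circ> r)" by (metis insertI2)
  have "bounded (range (X j \<circ> r))"
    using insert.prems[of j] by (auto intro: bounded_subset)
  then obtain l r' where r': "strict_mono r'" "((X j \<circ> r) \<circ> r') \<longlonglongrightarrow> l"
    using bounded_imp_convergent_subsequence by blast
  have "convergent (X i \<circ> (r \<circ> r'))" if "i \<in> insert j I" for i
  proof (cases "i = j")
    case True
    then show ?thesis using r' by (auto simp: convergent_def comp_assoc)
  next
    case False
    then show ?thesis using r r' that convergent_subseq_convergent[of "X i \<circ> r" r']
      by (auto simp: comp_assoc)
  qed
  then show ?case using r r' strict_mono_o by blast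
qed

text \<open>For small t of sign opposite to d the linear term would outweigh the quadratic one. This
  is how minimality turns into the weak equation in \<open>riesz\<close>.\<close>

lemma real_quadratic_nonneg_imp_zero:
  fixes B d :: real
  assumes "\<And>t. 0 \<le> t\<^sup>2 * B + 2 * t * d"
  shows "d = 0"
proof (rule ccontr)
  assume d: "d \<noteq> 0"
  define M where "M = \<bar>B\<bar> + 1"
  have M: "M > 0" "B < M" by (auto simp: M_def)
  have "0 \<le> (-d/M)\<^sup>2 * B + 2 * (-d/M) * d" by (rule assms)
  also have "\<dots> = (d\<^sup>2 / M) * (B / M - 2)" using M by (simp add: field_simps power2_eq_square)
  also have "\<dots> < 0" using M d by (intro mult_pos_neg) (auto simp: field_simps)
  finally show False by simp
qed

text \<open>\<open>H_complete\<close> is completeness of the Hilbert space.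
  \<open>V_complete\<close> is closedness of the form: a sequence that is Cauchy in both seminorms
  has a common limit in V. Limits are determined only up to null vectors, so just their existence is
  stated.\<close>

locale closed_form = H: semi_inner scale H ip + V: semi_inner scale V a
  for scale :: "complex \<Rightarrow> 'v::ab_group_add \<Rightarrow> 'v" (infixr "\<cdot>" 75)
    and H V ip a +
  assumes V_subset: "V \<subseteq> H"
    and H_complete: "\<And>X :: nat \<Rightarrow> 'v. \<lbrakk>\<And>n. X n \<in> H;
        \<And>e. e > 0 \<Longrightarrow> \<exists>N. \<forall>m\<ge>N. \<forall>n\<ge>N. H.nrm (X m - X n) < e\<rbrakk>
        \<Longrightarrow> \<exists>u\<in>H. (\<lambda>n. H.nrm (X n - u)) \<longlonglongrightarrow> 0"
    and V_complete: "\<And>X :: nat \<Rightarrow> 'v. \<lbrakk>\<And>n. X n \<in> V;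
        \<And>e. e > 0 \<Longrightarrow> \<exists>N. \<forall>m\<ge>N. \<forall>n\<ge>N. H.nrm (X m - X n) < e;
        \<And>e. e > 0 \<Longrightarrow> \<exists>N. \<forall>m\<ge>N. \<forall>n\<ge>N. V.nrm (X m - X n) < e\<rbrakk>
        \<Longrightarrow> \<exists>u\<in>V. (\<lambda>n. H.nrm (X n - u)) \<longlonglongrightarrow> 0 \<and> (\<lambda>n. V.nrm (X n - u)) \<longlonglongrightarrow> 0"
begin

lemma VH [simp, intro]: "u \<in> V \<Longrightarrow> u \<in> H"
  using V_subset by blast

definition associated :: "('v \<times> 'v) set" where
  "associated = {(u, w). u \<in> V \<and> w \<in> H \<and> (\<forall>v\<in>V. a u v = ip w v)}"

text \<open>Closedness relative to V in the seminorm of H alone. It covers both subspaces to which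
  \<open>riesz\<close> is applied, V itself and the complement of the ground states.\<close>

definition closed_in_form :: "'v set \<Rightarrow> bool" where
  "closed_in_form G \<longleftrightarrow> H.subspace G \<and> G \<subseteq> V \<and>
     (\<forall>X u. (\<forall>n::nat. X n \<in> G) \<longrightarrow> u \<in> V \<longrightarrow> (\<lambda>n. H.nrm (X n - u)) \<longlonglongrightarrow> 0 \<longrightarrow> u \<in> G)"

text \<open>The seminorm of H is controlled through \<kappa>; adding l times it back to the shifted
  form then controls the seminorm of V. The minimising sequences of \<open>riesz\<close> and the
  sequences approaching the infimum E both come with bounds of this shape, one error term per
  index.\<close>

lemma V_convergentI:
  fixes X :: "nat \<Rightarrow> 'v" and l :: real
  assumes X: "\<And>n. X n \<in> V" and \<kappa>: "\<kappa> > 0"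
    and coer: "\<And>m n. \<kappa> * H.nsq (X m - X n) \<le> e m + e n"
    and shift: "\<And>m n. V.nsq (X m - X n) - l * H.nsq (X m - X n) \<le> e m + e n"
    and e: "e \<longlonglongrightarrow> (0::real)"
  shows "\<exists>u\<in>V. (\<lambda>n. H.nrm (X n - u)) \<longlonglongrightarrow> 0 \<and> (\<lambda>n. V.nrm (X n - u)) \<longlonglongrightarrow> 0"
proof (rule V_complete[OF X])
  have small: "\<exists>N. \<forall>m\<ge>N. \<forall>n\<ge>N. e m + e n < d" if d: "d > 0" for d :: real
  proof -
    have "\<forall>\<^sub>F n in sequentially. e n < d / 2" using e d by (intro order_tendstoD) auto
    then obtain N where "\<And>n. n \<ge> N \<Longrightarrow> e n < d / 2" by (auto simp: eventually_sequentially)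
    then have "\<forall>m\<ge>N. \<forall>n\<ge>N. e m + e n < d" by (metis add_strict_mono field_sum_of_halves)
    then show ?thesis by blast
  qed
  have H: "\<exists>N. \<forall>m\<ge>N. \<forall>n\<ge>N. H.nsq (X m - X n) < d" if d: "d > 0" for d
  proof -
    obtain N where N: "\<And>m n. m \<ge> N \<Longrightarrow> n \<ge> N \<Longrightarrow> e m + e n < \<kappa> * d"
      using small[of "\<kappa> * d"] \<kappa> d by auto
    have "H.nsq (X m - X n) < d" if "m \<ge> N" "n \<ge> N" for m n
      using order.strict_trans1[OF coer N[OF that]] \<kappa> by simp
    then show ?thesis by blast
  qed
  show "\<exists>N. \<forall>m\<ge>N. \<forall>n\<ge>N. H.nrm (X m - X n) < d" if d: "d > 0" for d
  proof -
    obtain N where N: "\<And>m n. m \<ge> N \<Longrightarrow> n \<ge> N \<Longrightarrow> H.nsq (X m - X n) < d\<^sup>2"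
      using H[of "d\<^sup>2"] d by auto
    have "H.nrm (X m - X n) < d" if "m \<ge> N" "n \<ge> N" for m n
      using N[OF that] d by (auto simp: H.nrm_def intro: real_less_lsqrt)
    then show ?thesis by blast
  qed
  show "\<exists>N. \<forall>m\<ge>N. \<forall>n\<ge>N. V.nrm (X m - X n) < d" if d: "d > 0" for d
  proof -
    \<comment> \<open>The shift l may have any sign; L is a positive majorant by which one can
      divide.\<close>
    define L where "L = \<bar>l\<bar> + 1"
    have L: "L > 0" "l \<le> L" by (auto simp: L_def)
    obtain N1 where N1: "\<And>m n. m \<ge> N1 \<Longrightarrow> n \<ge> N1 \<Longrightarrow> e m + e n < d\<^sup>2 / 2"
      using small[of "d\<^sup>2 / 2"] d by auto
    obtain N2 where N2: "\<And>m n. m \<ge> N2 \<Longrightarrow> n \<ge> N2 \<Longrightarrow> H.nsq (X m - X n) < d\<^sup>2 / (2 * L)"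
      using H[of "d\<^sup>2 / (2 * L)"] d L by auto
    have "V.nrm (X m - X n) < d" if "m \<ge> max N1 N2" "n \<ge> max N1 N2" for m n
    proof -
      have "V.nsq (X m - X n) \<le> e m + e n + l * H.nsq (X m - X n)" using shift[of m n] by simp
      also have "\<dots> \<le> e m + e n + L * H.nsq (X m - X n)"
        using L X by (intro add_left_mono mult_right_mono) auto
      also have "\<dots> < d\<^sup>2 / 2 + L * (d\<^sup>2 / (2 * L))"
        using N1[of m n] N2[of m n] that L by (intro add_strict_mono mult_strict_left_mono) auto
      also have "\<dots> = d\<^sup>2" using L by simp
      finally show ?thesis using d by (auto simp: V.nrm_def intro: real_less_lsqrt)
    qed
    then show ?thesis by blast
  qed
qed

text \<open>Direct method: a minimiser of J(u) = b(u) - 2 Re <w, u> over G solves the weak equation.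
  Coercivity of the shifted form b bounds J from below, and the parallelogram identity makes a
  minimising sequence Cauchy.\<close>

lemma riesz:
  assumes G: "closed_in_form G" and \<kappa>: "\<kappa> > 0"
    and coer: "\<And>u. u \<in> G \<Longrightarrow> \<kappa> * H.nsq u \<le> V.nsq u - l * H.nsq u"
    and w: "w \<in> H"
  shows "\<exists>u\<in>G. \<forall>v\<in>G. a u v - of_real l * ip u v = ip w v"
proof -
  have sub: "H.subspace G" and GV [simp, intro]: "\<And>u. u \<in> G \<Longrightarrow> u \<in> V"
    and cl: "\<And>X u. (\<And>n::nat. X n \<in> G) \<Longrightarrow> u \<in> V \<Longrightarrow> (\<lambda>n. H.nrm (X n - u)) \<longlonglongrightarrow> 0 \<Longrightarrow> u \<in> G"
    using G by (auto simp: closed_in_form_def)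
  have G_ops [simp, intro]: "0 \<in> G" "\<And>u v. u \<in> G \<Longrightarrow> v \<in> G \<Longrightarrow> u + v \<in> G"
     "\<And>c u. u \<in> G \<Longrightarrow> c \<cdot> u \<in> G"
    using sub by (auto simp: H.subspace_0 H.subspace_add H.subspace_scale)
  define b where "b u = V.nsq u - l * H.nsq u" for u
  define J where "J u = b u - 2 * Re (ip w u)" for u
  have J_lower: "- H.nsq w / \<kappa> \<le> J u" if "u \<in> G" for u
  proof -
    \<comment> \<open>Completing the square around w / \<kappa> absorbs the linear term of
      J.\<close>
    have "0 \<le> \<kappa> * H.nsq (u - of_real (1 / \<kappa>) \<cdot> w)" using \<kappa> w that by simp
    also have "\<dots> = \<kappa> * H.nsq u + H.nsq w / \<kappa> - 2 * Re (ip w u)"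
      using \<kappa> w that H.ip_cnj[of u w]
      by (simp add: H.nsq_diff H.nsq_scale H.ip_simps norm_divide field_simps power2_eq_square)
    finally show ?thesis using coer[OF that] by (simp add: J_def b_def)
  qed
  define m where "m = Inf (J ` G)"
  have bdd: "bdd_below (J ` G)" using J_lower by (intro bdd_belowI2[where m = "- H.nsq w / \<kappa>"]) auto
  have m_le: "m \<le> J u" if "u \<in> G" for u
    unfolding m_def using bdd that by (auto intro: cInf_lower)
  have "\<exists>u\<in>G. J u < m + 1 / Suc n" for n
    using cInf_lessD[of "J ` G" "m + 1 / Suc n"] unfolding m_def
    using G_ops(1) bdd by (auto simp del: G_ops)
  then obtain X where XG: "\<And>n. X n \<in> G" and XJ: "\<And>n. J (X n) < m + 1 / Suc n" by metis
  define e where "e n = 2 * (J (X n) - m)" for n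
  have e0: "e \<longlonglongrightarrow> 0"
  proof (rule real_tendsto_sandwich)
    show "\<forall>\<^sub>F n in sequentially. 0 \<le> e n" using m_le XG by (simp add: e_def)
    show "\<forall>\<^sub>F n in sequentially. e n \<le> 2 * (1 / Suc n)"
    proof (intro always_eventually allI)
      show "e n \<le> 2 * (1 / Suc n)" for n using XJ[of n] unfolding e_def by argo
    qed
    show "(\<lambda>n. 2 * (1 / real (Suc n))) \<longlonglongrightarrow> 0"
      using tendsto_mult_right_zero[OF LIMSEQ_Suc[OF lim_1_over_n]] by simp
  qed simp
  have b_diff: "b (u - v) \<le> 2 * (J u - m) + 2 * (J v - m)" if "u \<in> G" "v \<in> G" for u v
  proof -
    have p: "b (u + v) + b (u - v) = 2 * b u + 2 * b v"
    proof -
      have "l * H.nsq (u + v) + l * H.nsq (u - v) = 2 * (l * H.nsq u) + 2 * (l * H.nsq v)"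
        using arg_cong[OF H.parallelogram[of u v], of "\<lambda>x. l * x"] that by (simp add: algebra_simps)
      then show ?thesis using V.parallelogram[of u v] that unfolding b_def by simp
    qed
    \<comment> \<open>At the midpoint s the value of J is at least m; with the parallelogram
      identity this bounds b (u - v) by the excesses of J u and J v over m.\<close>
    define s where "s = of_real (1/2) \<cdot> (u + v)"
    have s: "s \<in> G" using that by (auto simp: s_def)
    have "b s = b (u + v) / 4"
      using that by (simp add: s_def b_def V.nsq_scale H.nsq_scale power2_eq_square)
    moreover have "Re (ip w s) = (Re (ip w u) + Re (ip w v)) / 2"
      using that w by (simp add: s_def H.ip_simps)
    ultimately have "J s = b (u + v) / 4 - (Re (ip w u) + Re (ip w v))" by (simp add: J_def)
    then show ?thesis using p m_le[OF s] unfolding J_def by argo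
  qed
  have Gdiff [simp, intro]: "u - v \<in> G" if "u \<in> G" "v \<in> G" for u v
    using sub that by (rule H.subspace_diff)
  have "\<exists>u\<in>V. (\<lambda>n. H.nrm (X n - u)) \<longlonglongrightarrow> 0 \<and> (\<lambda>n. V.nrm (X n - u)) \<longlonglongrightarrow> 0"
  proof (rule V_convergentI[OF _ \<kappa> _ _ e0])
    fix m n
    show "V.nsq (X m - X n) - l * H.nsq (X m - X n) \<le> e m + e n"
      using b_diff[OF XG XG, of m n] by (simp add: b_def e_def)
    then show "\<kappa> * H.nsq (X m - X n) \<le> e m + e n"
      using coer[of "X m - X n"] XG by force
  qed (use XG in auto)
  then obtain u where u: "u \<in> V" "(\<lambda>n. H.nrm (X n - u)) \<longlonglongrightarrow> 0" "(\<lambda>n. V.nrm (X n - u)) \<longlonglongrightarrow> 0"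
    by blast
  have uG: "u \<in> G" using cl XG u by blast
  have "(\<lambda>n. cnj (ip (X n) w)) \<longlonglongrightarrow> cnj (ip u w)"
    using XG u w by (intro tendsto_cnj H.ip_tendsto_left) auto
  moreover have "cnj (ip (X n) w) = ip w (X n)" "cnj (ip u w) = ip w u" for n
    using XG u w H.ip_cnj[of "X n" w] H.ip_cnj[of u w] by auto
  ultimately have "(\<lambda>n. ip w (X n)) \<longlonglongrightarrow> ip w u" by simp
  then have "(\<lambda>n. J (X n)) \<longlonglongrightarrow> J u"
    unfolding J_def b_def using XG u
    by (intro tendsto_intros V.nsq_tendsto H.nsq_tendsto tendsto_Re) auto
  moreover have "(\<lambda>n. J (X n)) \<longlonglongrightarrow> m"
  proof (rule LIM_zero_cancel, rule tendsto_0_le[OF e0, where K = 1])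
    show "\<forall>\<^sub>F n in sequentially. norm (J (X n) - m) \<le> norm (e n) * 1"
      using m_le XG by (intro always_eventually allI) (simp add: e_def)
  qed
  ultimately have Ju: "J u = m" by (rule LIMSEQ_unique)
  have re0: "Re (a u v - of_real l * ip u v - ip w v) = 0" if v: "v \<in> G" for v
  proof (rule real_quadratic_nonneg_imp_zero[where B = "b v"])
    fix t :: real
    have "J (u + of_real t \<cdot> v) = J u + (t\<^sup>2 * b v + 2 * t * Re (a u v - of_real l * ip u v - ip w v))"
      using uG v w by (simp add: J_def b_def V.nsq_add H.nsq_add V.nsq_scale H.nsq_scale
          V.ip_simps H.ip_simps algebra_simps)
    moreover have "J u \<le> J (u + of_real t \<cdot> v)" unfolding Ju using uG v by (intro m_le) auto
    ultimately show "0 \<le> t\<^sup>2 * b v + 2 * t * Re (a u v - of_real l * ip u v - ip w v)" by simp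
  qed
  have "a u v - of_real l * ip u v = ip w v" if v: "v \<in> G" for v
  proof -
    \<comment> \<open>Real multiples of v give only the real part of the equation; the direction i v
      supplies the imaginary part.\<close>
    have "Re (a u (\<i> \<cdot> v) - of_real l * ip u (\<i> \<cdot> v) - ip w (\<i> \<cdot> v)) = 0"
      using v by (intro re0) auto
    then have "Im (a u v - of_real l * ip u v - ip w v) = 0"
      using v uG w by (simp add: V.ip_simps H.ip_simps)
    then show ?thesis using re0[OF v] by (simp add: complex_eq_iff)
  qed
  then show ?thesis using uG by blast
qed

end

text \<open>\<open>compactness\<close> says that the form is at least \<mu> up to a perturbation of
  finite rank, so that below \<mu> only eigenvalues of finite multiplicity can occur;
  \<open>trial\<close> says that the Rayleigh quotient does fall below \<mu>.\<close>

locale compactly_perturbed_form = closed_form scale H V ip a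
  for scale :: "complex \<Rightarrow> 'v::ab_group_add \<Rightarrow> 'v" (infixr "\<cdot>" 75)
    and H V ip a +
  fixes I :: "'i set" and L :: "'i \<Rightarrow> 'v \<Rightarrow> complex" and K C \<mu> :: real
  assumes finite_I: "finite I"
    and L_diff: "\<And>i u v. \<lbrakk>i \<in> I; u \<in> V; v \<in> V\<rbrakk> \<Longrightarrow> L i (u - v) = L i u - L i v"
    and L_bound: "\<And>i u. \<lbrakk>i \<in> I; u \<in> V\<rbrakk> \<Longrightarrow> cmod (L i u) \<le> K * H.nrm u"
    and compactness: "\<And>u. u \<in> V \<Longrightarrow> \<mu> * H.nsq u \<le> V.nsq u + C * (\<Sum>i\<in>I. (cmod (L i u))\<^sup>2)"
    and trial: "\<exists>u\<in>V. V.nsq u < \<mu> * H.nsq u"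
begin

definition E :: real where
  "E = Inf {V.nsq u |u. u \<in> V \<and> H.nsq u = 1}"

lemma normalize:
  assumes "u \<in> V" "H.nsq u \<noteq> 0"
  obtains v where "v \<in> V" "H.nsq v = 1" "V.nsq v = V.nsq u / H.nsq u"
    "v = of_real (1 / H.nrm u) \<cdot> u"
proof
  let ?v = "of_real (1 / H.nrm u) \<cdot> u"
  have "(cmod (of_real (1 / H.nrm u)))\<^sup>2 = 1 / H.nsq u"
    unfolding norm_of_real using assms by (simp add: power_divide H.nrm_sq)
  then show "H.nsq ?v = 1" "V.nsq ?v = V.nsq u / H.nsq u"
    using assms by (simp_all add: H.nsq_scale V.nsq_scale del: of_real_divide)
qed (use assms in auto)

lemma E_le: "u \<in> V \<Longrightarrow> E * H.nsq u \<le> V.nsq u"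
proof (cases "H.nsq u = 0")
  case False
  assume u: "u \<in> V"
  then obtain v where v: "v \<in> V" "H.nsq v = 1" "V.nsq v = V.nsq u / H.nsq u"
    using normalize False by metis
  have "E \<le> V.nsq v"
    unfolding E_def using v(1,2) by (intro cInf_lower bdd_belowI[of _ 0]) auto
  moreover have "H.nsq u > 0" using False u by (auto intro: H.nsq_pos)
  ultimately show ?thesis using v by (simp add: field_simps)
qed auto

lemma trial_unit: "\<exists>u\<in>V. H.nsq u = 1 \<and> V.nsq u < \<mu>"
proof -
  obtain u where u: "u \<in> V" "V.nsq u < \<mu> * H.nsq u" using trial by blast
  have nz: "H.nsq u \<noteq> 0" using u V.nsq_ge0[OF u(1)] by (metis mult_zero_right not_le)
  then have "H.nsq u > 0" using u(1) by (auto intro: H.nsq_pos)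
  then have "V.nsq u / H.nsq u < \<mu>" using u by (simp add: field_simps)
  then show ?thesis using normalize[OF u(1) nz] by metis
qed

lemma E_less: "E < \<mu>"
proof -
  obtain u where "u \<in> V" "H.nsq u = 1" "V.nsq u < \<mu>" using trial_unit by blast
  then show ?thesis using E_le[of u] by simp
qed

text \<open>Shifted by its infimum the form is still positive semidefinite, so it is a second
  semi-inner product on V. Its null vectors turn out to be the eigenvectors for E together with the
  null vectors of H (\<open>F_iff\<close>).\<close>

definition gap_form :: "'v \<Rightarrow> 'v \<Rightarrow> complex" where
  "gap_form u v = a u v - of_real E * ip u v"

sublocale B: semi_inner scale V gap_form
proof (unfold_locales, unfold gap_form_def)
  fix u v w c
  show "H.subspace V" by (rule V.subspace_carrier)
  show "a (u + v) w - of_real E * ip (u + v) w =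
      a u w - of_real E * ip u w + (a v w - of_real E * ip v w)" if "u \<in> V" "v \<in> V" "w \<in> V"
    using that by (simp add: V.ip_simps H.ip_simps algebra_simps)
  show "a (c \<cdot> u) v - of_real E * ip (c \<cdot> u) v = c * (a u v - of_real E * ip u v)"
    if "u \<in> V" "v \<in> V"
    using that by (simp add: V.ip_simps H.ip_simps algebra_simps)
  show "a v u - of_real E * ip v u = cnj (a u v - of_real E * ip u v)" if "u \<in> V" "v \<in> V"
    using that V.ip_cnj[of u v] H.ip_cnj[of u v] by simp
  show "0 \<le> Re (a u u - of_real E * ip u u)" if "u \<in> V"
    using that E_le[of u] by (simp add: V.nsq_def H.nsq_def)
qed

lemma B_nsq: "B.nsq u = V.nsq u - E * H.nsq u"
  by (simp add: B.nsq_def V.nsq_def H.nsq_def gap_form_def)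

text \<open>
  Normalised sequences along which the form approaches its infimum are precompact: once the
  finitely many functionals converge, the inequality \<open>compactness\<close> makes them Cauchy.
\<close>

lemma infimum_sequence_convergent:
  fixes X :: "nat \<Rightarrow> 'v"
  assumes X: "\<And>n. X n \<in> V" "\<And>n. H.nsq (X n) = 1" and b: "(\<lambda>n. B.nsq (X n)) \<longlonglongrightarrow> 0"
  shows "\<exists>r u. strict_mono (r :: nat \<Rightarrow> nat) \<and> u \<in> V \<and> (\<lambda>n. H.nrm (X (r n) - u)) \<longlonglongrightarrow> 0 \<and>
            H.nsq u = 1 \<and> B.nsq u = 0"
proof -
  have bd: "bounded (range (\<lambda>n. L i (X n)))" if "i \<in> I" for i
  proof (rule boundedI)
    show "norm x \<le> K" if "x \<in> range (\<lambda>n. L i (X n))" for x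
      using that L_bound[OF \<open>i \<in> I\<close> X(1)] by (auto simp: H.nrm_def X(2))
  qed
  obtain r where r: "strict_mono (r :: nat \<Rightarrow> nat)"
    and conv: "\<forall>i\<in>I. convergent ((\<lambda>n. L i (X n)) \<circ> r)"
    using simultaneous_convergent_subseq[OF finite_I, of "\<lambda>i n. L i (X n)"] bd by blast
  then obtain l where l: "\<And>i. i \<in> I \<Longrightarrow> (\<lambda>n. L i (X (r n))) \<longlonglongrightarrow> l i"
    unfolding convergent_def o_def by metis
  define C' where "C' = \<bar>C\<bar>"
  \<comment> \<open>Error per index: the excess of the form over its infimum plus the distance of
    the functionals from their limits. The factors 2 come from estimating the square of a
    difference.\<close>
  define e where "e n = 2 * B.nsq (X (r n)) + 2 * C' * (\<Sum>i\<in>I. (cmod (L i (X (r n)) - l i))\<^sup>2)" for n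
  have "e \<longlonglongrightarrow> 2 * 0 + 2 * C' * (\<Sum>i\<in>I. (cmod (l i - l i))\<^sup>2)"
    unfolding e_def using LIMSEQ_subseq_LIMSEQ[OF b r]
    by (intro tendsto_intros l) (auto simp: o_def)
  then have e0: "e \<longlonglongrightarrow> 0" by simp
  have Bd: "B.nsq (X (r m) - X (r n)) \<le> 2 * B.nsq (X (r m)) + 2 * B.nsq (X (r n))" for m n
    using B.nsq_diff_le X(1) by blast
  have C'0: "0 \<le> C'" "C \<le> C'" by (auto simp: C'_def)
  have e_ge: "2 * B.nsq (X (r n)) \<le> e n" for n
    unfolding e_def using C'0 by (simp add: sum_nonneg)
  have "\<exists>u\<in>V. (\<lambda>n. H.nrm (X (r n) - u)) \<longlonglongrightarrow> 0 \<and> (\<lambda>n. V.nrm (X (r n) - u)) \<longlonglongrightarrow> 0"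
  proof (rule V_convergentI[where \<kappa> = "\<mu> - E" and l = E, OF _ _ _ _ e0])
    show "0 < \<mu> - E" using E_less by simp
    fix m n
    show "V.nsq (X (r m) - X (r n)) - E * H.nsq (X (r m) - X (r n)) \<le> e m + e n"
      using Bd[of m n] e_ge[of m] e_ge[of n] by (simp add: B_nsq)
    have Ls: "(cmod (L i (X (r m) - X (r n))))\<^sup>2 \<le>
        2 * (cmod (L i (X (r m)) - l i))\<^sup>2 + 2 * (cmod (L i (X (r n)) - l i))\<^sup>2" if "i \<in> I" for i
    proof -
      define p q where "p = cmod (L i (X (r m)) - l i)" and "q = cmod (L i (X (r n)) - l i)"
      have "cmod (L i (X (r m) - X (r n))) \<le> p + q"
        using norm_triangle_ineq4[of "L i (X (r m)) - l i" "L i (X (r n)) - l i"] that X(1)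
        by (simp add: L_diff p_def q_def)
      then have "(cmod (L i (X (r m) - X (r n))))\<^sup>2 \<le> (p + q)\<^sup>2" by (intro power_mono) auto
      also have "\<dots> \<le> 2 * p\<^sup>2 + 2 * q\<^sup>2" using sum_squares_bound[of p q] by (simp add: power2_sum)
      finally show ?thesis by (simp add: p_def q_def)
    qed
    have "C * (\<Sum>i\<in>I. (cmod (L i (X (r m) - X (r n))))\<^sup>2) \<le>
        C' * (\<Sum>i\<in>I. (cmod (L i (X (r m) - X (r n))))\<^sup>2)"
      using C'0 by (intro mult_right_mono) (auto intro: sum_nonneg)
    also have "\<dots> \<le> C' * (\<Sum>i\<in>I. 2 * (cmod (L i (X (r m)) - l i))\<^sup>2 + 2 * (cmod (L i (X (r n)) - l i))\<^sup>2)"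
      using C'0 Ls by (intro mult_left_mono sum_mono) auto
    finally have *: "C * (\<Sum>i\<in>I. (cmod (L i (X (r m) - X (r n))))\<^sup>2) \<le>
        2 * C' * (\<Sum>i\<in>I. (cmod (L i (X (r m)) - l i))\<^sup>2) + 2 * C' * (\<Sum>i\<in>I. (cmod (L i (X (r n)) - l i))\<^sup>2)"
      by (simp add: sum.distrib algebra_simps flip: sum_distrib_left)
    \<comment> \<open>In this decomposition \<open>compactness\<close> bounds the first two terms by
      the functionals alone, and the last is the excess over the infimum; both are small. This is
      where E < \<mu> is spent.\<close>
    have "(\<mu> - E) * H.nsq (X (r m) - X (r n)) =
        \<mu> * H.nsq (X (r m) - X (r n)) - V.nsq (X (r m) - X (r n)) + B.nsq (X (r m) - X (r n))"
      by (simp add: B_nsq algebra_simps)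
    also have "\<dots> \<le> e m + e n"
      using compactness[of "X (r m) - X (r n)"] X(1) * Bd[of m n] by (simp add: e_def)
    finally show "(\<mu> - E) * H.nsq (X (r m) - X (r n)) \<le> e m + e n" .
  qed (use X in auto)
  then obtain u where u: "u \<in> V" "(\<lambda>n. H.nrm (X (r n) - u)) \<longlonglongrightarrow> 0" "(\<lambda>n. V.nrm (X (r n) - u)) \<longlonglongrightarrow> 0"
    by blast
  have H: "(\<lambda>n. H.nsq (X (r n))) \<longlonglongrightarrow> H.nsq u" using u X by (intro H.nsq_tendsto) auto
  then have u1: "H.nsq u = 1" using X(2) by (simp add: LIMSEQ_const_iff)
  have "(\<lambda>n. V.nsq (X (r n)) - E * H.nsq (X (r n))) \<longlonglongrightarrow> V.nsq u - E * H.nsq u"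
    using u X H by (intro tendsto_intros V.nsq_tendsto) auto
  then have "(\<lambda>n. B.nsq (X (r n))) \<longlonglongrightarrow> B.nsq u" by (simp add: B_nsq)
  moreover have "(\<lambda>n. B.nsq (X (r n))) \<longlonglongrightarrow> 0"
    using LIMSEQ_subseq_LIMSEQ[OF b r] by (simp add: o_def)
  ultimately have "B.nsq u = 0" by (rule LIMSEQ_unique)
  then show ?thesis using r u u1 by blast
qed

definition ground_states :: "'v set" where "ground_states = {u \<in> V. \<forall>v\<in>V. a u v = of_real E * ip u v}"

text \<open>Cauchy-Schwarz for \<open>gap_form\<close>: a vector of zero energy pairs to zero with
  all of V, which is the eigenvalue equation.\<close>

lemma F_iff: "u \<in> ground_states \<longleftrightarrow> u \<in> V \<and> B.nsq u = 0"
proof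
  assume "u \<in> ground_states"
  then show "u \<in> V \<and> B.nsq u = 0" by (auto simp: ground_states_def B.nsq_def gap_form_def)
next
  assume u: "u \<in> V \<and> B.nsq u = 0"
  have "a u v - of_real E * ip u v = 0" if "v \<in> V" for v
    using B.cauchy_schwarz_sq[of u v] u that by (simp add: gap_form_def)
  then show "u \<in> ground_states" using u by (auto simp: ground_states_def)
qed

lemma subspace_F: "H.subspace ground_states"
  unfolding ground_states_def
  by (rule H.subspaceI) (auto simp: V.ip_simps H.ip_simps algebra_simps)

lemma F_V [simp, intro]: "u \<in> ground_states \<Longrightarrow> u \<in> V"
  by (simp add: ground_states_def)

lemma F_ops [simp, intro]:
  "0 \<in> ground_states" "u \<in> ground_states \<Longrightarrow> v \<in> ground_states \<Longrightarrow> u + v \<in> ground_states" "u \<in> ground_states \<Longrightarrow> v \<in> ground_states \<Longrightarrow> u - v \<in> ground_states" "u \<in> ground_states \<Longrightarrow> c \<cdot> u \<in> ground_states"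
  using subspace_F by (auto simp: H.subspace_0 H.subspace_add H.subspace_diff H.subspace_scale)

lemma E_attained: "\<exists>u\<in>ground_states. H.nsq u = 1"
proof -
  have "\<exists>u\<in>V. H.nsq u = 1 \<and> V.nsq u < E + 1 / Suc n" for n
  proof -
    have "{V.nsq u |u. u \<in> V \<and> H.nsq u = 1} \<noteq> {}" using trial_unit by blast
    from cInf_lessD[OF this, of "E + 1 / Suc n"] show ?thesis
      unfolding E_def[symmetric] by auto
  qed
  then obtain X where X: "\<And>n. X n \<in> V" "\<And>n. H.nsq (X n) = 1" "\<And>n. V.nsq (X n) < E + 1 / Suc n"
    by metis
  have "(\<lambda>n. B.nsq (X n)) \<longlonglongrightarrow> 0"
  proof (rule real_tendsto_sandwich)
    show "\<forall>\<^sub>F n in sequentially. 0 \<le> B.nsq (X n)" using X(1) by simp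
    show "\<forall>\<^sub>F n in sequentially. B.nsq (X n) \<le> 1 / Suc n"
    proof (intro always_eventually allI)
      show "B.nsq (X n) \<le> 1 / Suc n" for n using X(2)[of n] X(3)[of n] unfolding B_nsq by simp
    qed
    show "(\<lambda>n. 1 / real (Suc n)) \<longlonglongrightarrow> 0" by (rule LIMSEQ_Suc[OF lim_1_over_n])
  qed simp
  from infimum_sequence_convergent[OF X(1,2) this] show ?thesis by (auto simp: F_iff)
qed

definition orthonormal_upto :: "nat \<Rightarrow> (nat \<Rightarrow> 'v) \<Rightarrow> bool" where
  "orthonormal_upto n e \<longleftrightarrow>
     (\<forall>i<n. e i \<in> ground_states \<and> H.nsq (e i) = 1) \<and> (\<forall>i<n. \<forall>j<n. i \<noteq> j \<longrightarrow> ip (e i) (e j) = 0)"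

definition proj :: "nat \<Rightarrow> (nat \<Rightarrow> 'v) \<Rightarrow> 'v \<Rightarrow> 'v" where
  "proj n e u = (\<Sum>i<n. ip u (e i) \<cdot> e i)"

lemma proj_F: "orthonormal_upto n e \<Longrightarrow> proj n e u \<in> ground_states"
  unfolding proj_def orthonormal_upto_def by (intro H.subspace_sum[OF subspace_F]) auto

lemma ip_proj:
  assumes "orthonormal_upto n e" "u \<in> H" "j < n"
  shows "ip (proj n e u) (e j) = ip u (e j)"
proof -
  have e: "\<And>i. i < n \<Longrightarrow> e i \<in> H" "\<And>i. i < n \<Longrightarrow> i \<noteq> j \<Longrightarrow> ip (e i) (e j) = 0" "ip (e j) (e j) = 1"
    using assms by (auto simp: orthonormal_upto_def H.ip_self)
  have "ip (proj n e u) (e j) = (\<Sum>i<n. ip u (e i) * ip (e i) (e j))"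
    unfolding proj_def using e assms by (subst H.ip_sum_left) (auto simp: H.ip_scale_left)
  also have "\<dots> = (\<Sum>i<n. if i = j then ip u (e j) else 0)"
    using e by (intro sum.cong) auto
  finally show ?thesis using assms by simp
qed

text \<open>Otherwise Gram-Schmidt never stops and yields an infinite orthonormal sequence of ground
  states. Since \<open>B.nsq\<close> vanishes on all of them, a subsequence would converge, although
  distinct members have squared distance 2.\<close>

lemma finite_orthonormal_basis:
  "\<exists>n e. orthonormal_upto n e \<and> (\<forall>u\<in>ground_states. H.nsq (u - proj n e u) = 0)"
proof (rule ccontr)
  assume contr: "\<not> ?thesis"
  let ?P = "\<lambda>e (n::nat) r. r \<in> ground_states \<and> H.nsq r = 1 \<and> (\<forall>m<n. ip r (e m) = 0)"
  have "\<exists>e. \<forall>n. ?P e n (e n)"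
  \<comment> \<open>Choice with access to all earlier values: the next vector is the normalised
    remainder of some u that the first n vectors do not represent.\<close>
  proof (rule dependent_wellorder_choice[where P = ?P])
    fix n and e :: "nat \<Rightarrow> 'v"
    assume *: "\<And>m. m < n \<Longrightarrow> ?P e m (e m)"
    have ip0: "ip (e i) (e j) = 0" if "i < n" "j < n" "i \<noteq> j" for i j
    proof (cases "j < i")
      case True
      then show ?thesis using *[OF that(1)] by blast
    next
      case False
      then have "ip (e j) (e i) = 0" using *[OF that(2)] that(3) by simp
      then show ?thesis using H.ip_cnj[of "e j" "e i"] *[OF that(1)] *[OF that(2)] by simp
    qed
    then have on: "orthonormal_upto n e" using * by (auto simp: orthonormal_upto_def)
    then obtain u where u: "u \<in> ground_states" "H.nsq (u - proj n e u) \<noteq> 0" using contr by blast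
    define p where "p = u - proj n e u"
    have p: "p \<in> ground_states" "H.nsq p \<noteq> 0" using u proj_F[OF on] by (auto simp: p_def)
    have p0: "ip p (e m) = 0" if "m < n" for m
      using ip_proj[OF on, of u m] proj_F[OF on, of u] u(1) that *[OF that]
      by (simp add: p_def H.ip_diff_left)
    obtain v where v: "H.nsq v = 1" "v = of_real (1 / H.nrm p) \<cdot> p"
      using normalize[of p] p by blast
    have "?P e n v" using v p p0 * by (auto simp: H.ip_scale_left)
    then show "\<exists>r. ?P e n r" by blast
  qed simp
  then obtain e :: "nat \<Rightarrow> 'v" where e: "\<And>n. e n \<in> ground_states" "\<And>n. H.nsq (e n) = 1" "\<And>n m. m < n \<Longrightarrow> ip (e n) (e m) = 0"
    by blast
  have "(\<lambda>n. B.nsq (e n)) \<longlonglongrightarrow> 0" using e(1) by (simp add: F_iff)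
  from infimum_sequence_convergent[OF _ e(2) this] e(1)
  obtain r u where r: "strict_mono (r :: nat \<Rightarrow> nat)" and u: "u \<in> V" "(\<lambda>n. H.nrm (e (r n) - u)) \<longlonglongrightarrow> 0"
    by blast
  have "(\<lambda>n. H.nrm (e (r (Suc n)) - u) + H.nrm (e (r n) - u)) \<longlonglongrightarrow> 0 + 0"
    by (intro tendsto_add u LIMSEQ_Suc[OF u(2)])
  then have "\<forall>\<^sub>F n in sequentially. H.nrm (e (r (Suc n)) - u) + H.nrm (e (r n) - u) < 1"
    by (intro order_tendstoD) auto
  then obtain n where n: "H.nrm (e (r (Suc n)) - u) + H.nrm (e (r n) - u) < 1"
    by (auto simp: eventually_sequentially)
  have "H.nrm (e (r (Suc n)) - e (r n)) < 1"
    using H.nrm_triangle3[of "e (r (Suc n))" u "e (r n)"] H.nrm_minus_commute[of u "e (r n)"] n e(1) u(1)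
    by (auto simp: F_V)
  moreover have "H.nsq (e (r (Suc n)) - e (r n)) = 2"
    using e(1,2) e(3)[of "r n" "r (Suc n)"] r by (simp add: H.nsq_diff strict_mono_Suc_iff)
  ultimately show False by (simp add: H.nrm_def)
qed

definition ground_perp :: "'v set" where "ground_perp = {u \<in> V. \<forall>v\<in>ground_states. ip u v = 0}"

lemma closed_G: "closed_in_form ground_perp"
  unfolding closed_in_form_def
proof (intro conjI allI impI)
  show "H.subspace ground_perp"
    unfolding ground_perp_def by (rule H.subspaceI) (auto simp: H.ip_simps)
  show "ground_perp \<subseteq> V" by (auto simp: ground_perp_def)
  fix X u
  assume X: "\<forall>n::nat. X n \<in> ground_perp" "u \<in> V" "(\<lambda>n. H.nrm (X n - u)) \<longlonglongrightarrow> 0"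
  have "ip u v = 0" if v: "v \<in> ground_states" for v
  proof -
    have "(\<lambda>n. ip (X n) v) \<longlonglongrightarrow> ip u v"
      using X v by (intro H.ip_tendsto_left) (auto simp: ground_perp_def)
    then show ?thesis using X(1) v by (auto simp: ground_perp_def LIMSEQ_const_iff)
  qed
  then show "u \<in> ground_perp" using X by (auto simp: ground_perp_def)
qed

lemma ground_perp_ops [simp, intro]:
  "0 \<in> ground_perp" "u \<in> ground_perp \<Longrightarrow> v \<in> ground_perp \<Longrightarrow> u + v \<in> ground_perp" "u \<in> ground_perp \<Longrightarrow> v \<in> ground_perp \<Longrightarrow> u - v \<in> ground_perp" "u \<in> ground_perp \<Longrightarrow> c \<cdot> u \<in> ground_perp"
  "u \<in> ground_perp \<Longrightarrow> u \<in> V"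
  using closed_G unfolding closed_in_form_def
  by (auto simp: H.subspace_0 H.subspace_add H.subspace_diff H.subspace_scale)

text \<open>If the quotient of \<open>B.nsq\<close> had infimum zero on the complement, a normalised
  sequence there would converge to a unit vector that is a ground state and, the complement being
  closed, also orthogonal to all ground states.\<close>

lemma gap: "\<exists>\<delta>>0. \<forall>u\<in>ground_perp. \<delta> * H.nsq u \<le> B.nsq u"
proof (rule ccontr)
  assume contr: "\<not> ?thesis"
  have "\<exists>u\<in>ground_perp. H.nsq u = 1 \<and> B.nsq u < 1 / Suc n" for n
  proof -
    have "\<not> (\<forall>u\<in>ground_perp. 1 / Suc n * H.nsq u \<le> B.nsq u)"
      using contr by (meson divide_pos_pos of_nat_0_less_iff zero_less_Suc zero_less_one)
    then obtain u where u: "u \<in> ground_perp" "B.nsq u < 1 / Suc n * H.nsq u" by force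
    have nz: "H.nsq u \<noteq> 0" using u B.nsq_ge0[OF ground_perp_ops(5)[OF u(1)]] by (metis mult_zero_right not_le)
    obtain v where v: "v \<in> V" "H.nsq v = 1" "V.nsq v = V.nsq u / H.nsq u"
      "v = of_real (1 / H.nrm u) \<cdot> u"
      using normalize[of u] u(1) nz by blast
    have "B.nsq v = B.nsq u / H.nsq u" using v nz by (simp add: B_nsq diff_divide_distrib)
    moreover have "H.nsq u > 0" using nz u(1) by (auto intro: H.nsq_pos)
    ultimately have "B.nsq v < 1 / Suc n" using u by (simp add: divide_less_eq del: of_nat_Suc)
    moreover have "v \<in> ground_perp" using v(4) u(1) by simp
    ultimately show ?thesis using v(2) by blast
  qed
  then obtain X where X: "\<And>n. X n \<in> ground_perp" "\<And>n. H.nsq (X n) = 1" "\<And>n. B.nsq (X n) < 1 / Suc n"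
    by metis
  have "(\<lambda>n. B.nsq (X n)) \<longlonglongrightarrow> 0"
  proof (rule real_tendsto_sandwich)
    show "\<forall>\<^sub>F n in sequentially. 0 \<le> B.nsq (X n)" using X(1) by simp
    show "\<forall>\<^sub>F n in sequentially. B.nsq (X n) \<le> 1 / Suc n" using X(3) by (simp add: less_imp_le)
    show "(\<lambda>n. 1 / real (Suc n)) \<longlonglongrightarrow> 0" by (rule LIMSEQ_Suc[OF lim_1_over_n])
  qed simp
  from infimum_sequence_convergent[OF _ X(2) this] X(1)
  obtain r u where r: "strict_mono (r :: nat \<Rightarrow> nat)" and u: "u \<in> V" "(\<lambda>n. H.nrm (X (r n) - u)) \<longlonglongrightarrow> 0"
      "H.nsq u = 1" "B.nsq u = 0"
    by blast
  have "u \<in> ground_perp" using closed_G X(1) u(1,2) unfolding closed_in_form_def by metis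
  moreover have "u \<in> ground_states" using u by (simp add: F_iff)
  ultimately have "ip u u = 0" unfolding ground_perp_def by blast
  then show False using u(3) by (simp add: H.nsq_def)
qed

end

section \<open>Resolvents near and below the bottom of the spectrum\<close>

lemma le_divide_of_square_le:
  fixes x y c :: real
  assumes "c * x\<^sup>2 \<le> y * x" "0 < c" "0 \<le> x" "0 \<le> y"
  shows "x \<le> y / c"
proof (cases "x = 0")
  case False
  then have "c * x \<le> y" using assms by (simp add: power2_eq_square order_less_le)
  then show ?thesis using assms by (simp add: field_simps)
qed (use assms in simp)

context closed_form
begin

text \<open>The condition that defines \<open>resolvent_set\<close>, with equality almost everywhere
  replaced by a difference of zero seminorm in H.\<close>

definition regular_value :: "complex \<Rightarrow> bool" where
  "regular_value z \<longleftrightarrow>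
     (\<forall>w\<in>H. \<exists>(u, v)\<in>associated. H.nsq (v - z \<cdot> u - w) = 0) \<and>
     (\<exists>C. \<forall>(u, v)\<in>associated. H.nrm u \<le> C * H.nrm (v - z \<cdot> u))"

end

context compactly_perturbed_form
begin

text \<open>The vectors e span the ground states only up to null vectors. So f is split into
  \<open>proj n e f\<close>, to which the remainder is orthogonal term by term, and a null vector,
  which is orthogonal to everything by Cauchy-Schwarz.\<close>

lemma proj_perp:
  assumes on: "orthonormal_upto n e" and basis: "\<And>u. u \<in> ground_states \<Longrightarrow> H.nsq (u - proj n e u) = 0"
    and w: "w \<in> H" and f: "f \<in> ground_states"
  shows "ip (w - proj n e w) f = 0"
proof -
  define r where "r = w - proj n e w"
  have pV: "proj n e u \<in> H" for u using proj_F[OF on] by blast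
  have r: "r \<in> H" using w pV by (auto simp: r_def)
  have e: "e i \<in> H" if "i < n" for i using on that by (auto simp: orthonormal_upto_def)
  have re: "ip (e i) r = 0" if "i < n" for i
    using ip_proj[OF on w that] H.ip_cnj[OF r e[OF that]] w pV e[OF that] by (simp add: r_def H.ip_diff_left)
  have "ip (proj n e f) r = (\<Sum>i<n. ip f (e i) * ip (e i) r)"
    unfolding proj_def using e r by (subst H.ip_sum_left) (auto simp: H.ip_scale_left)
  also have "\<dots> = 0" using re by simp
  finally have "ip r (proj n e f) = 0" using H.ip_cnj[OF pV r, of f] by simp
  moreover have "ip r (f - proj n e f) = 0"
    using H.cauchy_schwarz_sq[of r "f - proj n e f"] basis[OF f] r pV f by force
  ultimately show ?thesis using r pV f by (simp add: H.ip_diff_right flip: r_def)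
qed

lemma proj_G:
  assumes "orthonormal_upto n e" "\<And>u. u \<in> ground_states \<Longrightarrow> H.nsq (u - proj n e u) = 0" "u \<in> V"
  shows "u - proj n e u \<in> ground_perp"
proof -
  have "proj n e u \<in> V" using proj_F[OF assms(1)] by blast
  then have "u - proj n e u \<in> V" using assms(3) by blast
  moreover have "ip (u - proj n e u) f = 0" if "f \<in> ground_states" for f
    using proj_perp[OF assms(1,2) _ that] assms(3) by blast
  ultimately show ?thesis unfolding ground_perp_def by blast
qed

lemma a_F_left: "f \<in> ground_states \<Longrightarrow> v \<in> V \<Longrightarrow> a f v = of_real E * ip f v"
  unfolding ground_states_def by blast

lemma a_F_right: "f \<in> ground_states \<Longrightarrow> v \<in> V \<Longrightarrow> a v f = of_real E * ip v f"
  using V.ip_cnj[of f v] H.ip_cnj[of f v] a_F_left[of f v] by simp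

lemma ip_GF: "g \<in> ground_perp \<Longrightarrow> f \<in> ground_states \<Longrightarrow> ip g f = 0"
  unfolding ground_perp_def by blast

lemma ip_FG: "g \<in> ground_perp \<Longrightarrow> f \<in> ground_states \<Longrightarrow> ip f g = 0"
  using H.ip_cnj[of g f] ip_GF[of g f] by simp

text \<open>The equation is tested with u itself. Applied to differences of solutions, this also
  gives the Lipschitz bound that drives the iteration.\<close>

lemma solution_bound:
  assumes gap: "\<forall>u\<in>ground_perp. \<delta> * H.nsq u \<le> B.nsq u" and "\<delta> > 0" "u \<in> ground_perp" "w \<in> H"
    and eq: "\<And>v. v \<in> ground_perp \<Longrightarrow> gap_form u v = ip w v"
  shows "\<delta> * H.nrm u \<le> H.nrm w"
proof (cases "H.nrm u = 0")
  case False
  then have pos: "H.nrm u > 0" using assms(3) by (simp add: order_less_le)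
  have "\<delta> * (H.nrm u)\<^sup>2 \<le> B.nsq u" using gap assms by (simp add: H.nrm_sq)
  also have "B.nsq u = Re (ip w u)" using eq[of u] assms by (simp add: B.nsq_def)
  also have "\<dots> \<le> H.nrm w * H.nrm u"
    using H.cauchy_schwarz[of w u] complex_Re_le_cmod[of "ip w u"] assms by fastforce
  finally show ?thesis using pos by (simp add: power2_eq_square)
qed (use assms in simp)

text \<open>
  On the orthogonal complement of the ground state space the resolvent equation is solved by
  iterating the solution operator at \<open>E\<close>, whose norm is at most \<open>1 / \<delta>\<close>.
\<close>

lemma resolvent_on_complement:
  assumes gap: "\<forall>u\<in>ground_perp. \<delta> * H.nsq u \<le> B.nsq u" and \<delta>: "\<delta> > 0"
    and z: "cmod (z - of_real E) < \<delta>" and w: "w \<in> H"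
  shows "\<exists>u\<in>ground_perp. \<forall>v\<in>ground_perp. a u v - z * ip u v = ip w v"
proof -
  have "\<forall>x\<in>H. \<exists>u. u \<in> ground_perp \<and> (\<forall>v\<in>ground_perp. gap_form u v = ip x v)"
    using riesz[OF closed_G \<delta>, of E] gap unfolding gap_form_def B_nsq by blast
  \<comment> \<open>T picks one of several solutions that differ by null vectors. It need not be
    linear; the estimates go through \<open>T_lip\<close>.\<close>
  then obtain T where TG: "\<And>x. x \<in> H \<Longrightarrow> T x \<in> ground_perp"
    and T: "\<And>x v. x \<in> H \<Longrightarrow> v \<in> ground_perp \<Longrightarrow> gap_form (T x) v = ip x v"
    by metis
  have T_lip: "\<delta> * H.nrm (T x - T y) \<le> H.nrm (x - y)" if "x \<in> H" "y \<in> H" for x y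
    using that TG T by (intro solution_bound[OF gap \<delta>]) (auto simp: B.ip_diff_left H.ip_diff_left)
  have T_bd: "\<delta> * H.nrm (T x) \<le> H.nrm x" if "x \<in> H" for x
    using that TG T by (intro solution_bound[OF gap \<delta>]) auto
  \<comment> \<open>The equation at z reads \<open>gap_form\<close> u v = <w + \<zeta> u, v>, so its
    solutions are fixed points of the map S below, a contraction because |\<zeta>| <
    \<delta>.\<close>
  define \<zeta> where "\<zeta> = z - of_real E"
  define q where "q = cmod \<zeta> / \<delta>"
  have q: "0 \<le> q" "q < 1" using z \<delta> by (auto simp: q_def \<zeta>_def)
  define S where "S x = T (w + \<zeta> \<cdot> x)" for x
  have SG: "S x \<in> ground_perp" if "x \<in> H" for x using that w TG by (simp add: S_def)
  have S_lip: "H.nrm (S x - S y) \<le> q * H.nrm (x - y)" if "x \<in> H" "y \<in> H" for x y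
  proof -
    have "\<delta> * H.nrm (S x - S y) \<le> H.nrm ((w + \<zeta> \<cdot> x) - (w + \<zeta> \<cdot> y))"
      unfolding S_def using that w by (intro T_lip) auto
    also have "(w + \<zeta> \<cdot> x) - (w + \<zeta> \<cdot> y) = \<zeta> \<cdot> (x - y)" by (simp add: H.scale_right_diff_distrib)
    also have "H.nrm \<dots> = cmod \<zeta> * H.nrm (x - y)" using that by (intro H.nrm_scale) auto
    finally show ?thesis using \<delta> by (simp add: q_def field_simps)
  qed
  define X where "X n = (S ^^ n) 0" for n
  have X_Suc: "X (Suc n) = S (X n)" for n by (simp add: X_def)
  have XH: "X n \<in> H" for n
    by (induction n) (use SG in \<open>auto simp: X_Suc, simp add: X_def\<close>)
  \<comment> \<open>R solves |w| + |\<zeta>| R = \<delta> R, so the ball of radius R is mapped into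
    itself.\<close>
  define R where "R = H.nrm w / (\<delta> * (1 - q))"
  have R0: "R \<ge> 0" using \<delta> q w by (simp add: R_def)
  have XR: "H.nrm (X n) \<le> R" for n
  proof (induction n)
    case 0
    then show ?case using R0 by (simp add: X_def H.nrm_def H.nsq_def)
  next
    case (Suc n)
    have "\<delta> * H.nrm (X (Suc n)) \<le> H.nrm (w + \<zeta> \<cdot> X n)"
      unfolding X_Suc S_def using w XH by (intro T_bd) auto
    also have "\<dots> \<le> H.nrm w + cmod \<zeta> * H.nrm (X n)"
      using H.nrm_triangle[of w "\<zeta> \<cdot> X n"] w XH by (simp add: H.nrm_scale)
    also have "\<dots> \<le> H.nrm w + cmod \<zeta> * R" using Suc by (intro add_left_mono mult_left_mono) auto
    also have "\<dots> = \<delta> * R" using \<delta> q by (simp add: R_def q_def field_simps)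
    finally show ?case using \<delta> by simp
  qed
  have X_shift: "H.nrm (X (n + k) - X n) \<le> q ^ n * R" for n k
  proof (induction n)
    case 0
    then show ?case using XR[of k] by (simp add: X_def)
  next
    case (Suc n)
    have "H.nrm (X (Suc n + k) - X (Suc n)) \<le> q * H.nrm (X (n + k) - X n)"
      using S_lip XH by (simp add: X_Suc)
    also have "\<dots> \<le> q * (q ^ n * R)" using Suc q by (intro mult_left_mono) auto
    finally show ?case by simp
  qed
  have "\<exists>u\<in>H. (\<lambda>n. H.nrm (X n - u)) \<longlonglongrightarrow> 0"
  proof (rule H_complete[OF XH])
    fix d :: real assume d: "d > 0"
    have "(\<lambda>n. q ^ n * R) \<longlonglongrightarrow> 0"
      using q by (intro tendsto_mult_left_zero LIMSEQ_realpow_zero) auto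
    then have "\<forall>\<^sub>F n in sequentially. q ^ n * R < d" using d by (rule order_tendstoD)
    then obtain N where N: "\<And>n. n \<ge> N \<Longrightarrow> q ^ n * R < d" by (auto simp: eventually_sequentially)
    have "H.nrm (X m - X n) < d" if "m \<ge> N" "n \<ge> N" for m n
    proof (cases "n \<le> m")
      case True
      then show ?thesis using X_shift[of n "m - n"] N[OF that(2)] by simp
    next
      case False
      then show ?thesis
        using X_shift[of m "n - m"] N[OF that(1)] H.nrm_minus_commute[OF XH XH, of m n] by simp
    qed
    then show "\<exists>N. \<forall>m\<ge>N. \<forall>n\<ge>N. H.nrm (X m - X n) < d" by blast
  qed
  then obtain u where u: "u \<in> H" "(\<lambda>n. H.nrm (X n - u)) \<longlonglongrightarrow> 0" by blast
  have Su: "S u \<in> ground_perp" "S u \<in> V" "S u \<in> H" using SG[OF u(1)] by auto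
  have le: "H.nrm (S u - u) \<le> q * H.nrm (X n - u) + H.nrm (X (Suc n) - u)" for n
    using H.nrm_triangle3[OF Su(3) XH u(1), of "Suc n"] S_lip[OF u(1) XH, of n]
      H.nrm_minus_commute[OF u(1) XH, of n] by (simp add: X_Suc)
  have "H.nrm (S u - u) \<le> q * 0 + 0"
    by (rule tendsto_lowerbound[OF tendsto_add[OF tendsto_mult[OF tendsto_const u(2)] LIMSEQ_Suc[OF u(2)]]])
       (use le in auto)
  moreover have SuH: "S u - u \<in> H" using Su u by blast
  ultimately have "H.nsq (S u - u) = 0" using H.nrm_ge0[OF SuH] H.nrm_eq0_iff[OF SuH] by simp
  then have "ip (S u - u) v = 0" if "v \<in> H" for v
    using H.cauchy_schwarz_sq[of "S u - u" v] that Su u by simp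
  then have eq: "ip u v = ip (S u) v" if "v \<in> H" for v
    using that Su u by (simp add: H.ip_diff_left)
  \<comment> \<open>The limit u is only known to lie in H and is a fixed point up to a null vector.
    Its image S u lies in \<open>ground_perp\<close> and is therefore taken as the solution.\<close>
  have "a (S u) v - z * ip (S u) v = ip w v" if v: "v \<in> ground_perp" for v
  proof -
    have "gap_form (S u) v = ip (w + \<zeta> \<cdot> u) v"
      unfolding S_def using v u w by (intro T) auto
    also have "\<dots> = ip w v + \<zeta> * ip (S u) v" using v u w eq[of v] by (simp add: H.ip_simps)
    finally show ?thesis by (simp add: gap_form_def \<zeta>_def algebra_simps)
  qed
  then show ?thesis using Su by blast
qed

text \<open>Form and inner product are block diagonal for the splitting into ground states and their
  complement. On the ground states the equation is division by E - z, on the complement it is solved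
  by \<open>resolvent_on_complement\<close>. The a priori estimate adds the two bounds 1 / d and 1 /
  (\<delta> - d), where d is the distance of z from E.\<close>

lemma regular_near_E:
  assumes gap: "\<forall>u\<in>ground_perp. \<delta> * H.nsq u \<le> B.nsq u" and \<delta>: "\<delta> > 0"
    and z: "cmod (z - of_real E) < \<delta>" "z \<noteq> of_real E"
  shows "regular_value z"
  unfolding regular_value_def
proof
  obtain n e where on: "orthonormal_upto n e"
    and basis: "\<And>u. u \<in> ground_states \<Longrightarrow> H.nsq (u - proj n e u) = 0"
    using finite_orthonormal_basis by blast
  have PF: "proj n e u \<in> ground_states" for u using proj_F[OF on] .
  have PH: "proj n e u \<in> H" for u using PF by blast
  have nz: "of_real E - z \<noteq> 0" using z by auto
  show "\<forall>w\<in>H. \<exists>(u, v)\<in>associated. H.nsq (v - z \<cdot> u - w) = 0"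
  proof
    fix w assume w: "w \<in> H"
    define p where "p = proj n e w"
    have p: "p \<in> ground_states" "p \<in> V" "p \<in> H" using PF by (auto simp: p_def)
    obtain u1 where u1: "u1 \<in> ground_perp" and u1_eq: "\<And>v. v \<in> ground_perp \<Longrightarrow> a u1 v - z * ip u1 v = ip (w - p) v"
      using resolvent_on_complement[OF gap \<delta> z(1), of "w - p"] w p by blast
    define c where "c = 1 / (of_real E - z)"
    define u where "u = c \<cdot> p + u1"
    have u: "u \<in> V" using p u1 by (auto simp: u_def)
    have "a u y = ip (w + z \<cdot> u) y" if y: "y \<in> V" for y
    proof -
      define f where "f = proj n e y"
      define g where "g = y - f"
      have f: "f \<in> ground_states" "f \<in> V" using PF by (auto simp: f_def)
      have g: "g \<in> ground_perp" "g \<in> V" using proj_G[OF on basis y] by (auto simp: f_def g_def)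
      have "ip (w - p) f = 0" unfolding p_def by (rule proj_perp[OF on basis w f(1)])
      then have wf: "ip w f = ip p f" using w p f by (simp add: H.ip_diff_left)
      have "a u f - z * ip u f = (of_real E - z) * ip u f"
        using a_F_right[OF f(1) u] by (simp add: algebra_simps)
      also have "\<dots> = (of_real E - z) * (c * ip p f)"
        using p u1 f ip_GF by (simp add: u_def H.ip_simps)
      also have "\<dots> = ip w f" using nz wf by (simp add: c_def)
      finally have 1: "a u f - z * ip u f = ip w f" .
      have "a u g - z * ip u g = a u1 g - z * ip u1 g"
        using p u1 g a_F_left[OF p(1) g(2)] ip_FG[OF g(1) p(1)]
        by (simp add: u_def V.ip_simps H.ip_simps)
      also have "\<dots> = ip w g"
        using u1_eq[OF g(1)] ip_FG[OF g(1) p(1)] w p g by (simp add: H.ip_diff_left)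
      finally have 2: "a u g - z * ip u g = ip w g" .
      have "y = f + g" by (simp add: g_def)
      then show ?thesis using 1 2 u f g w by (simp add: V.ip_simps H.ip_simps algebra_simps)
    qed
    then have "(u, w + z \<cdot> u) \<in> associated" using u w by (auto simp: associated_def)
    moreover have "H.nsq ((w + z \<cdot> u) - z \<cdot> u - w) = 0" by (simp add: H.nsq_def)
    ultimately show "\<exists>(u, v)\<in>associated. H.nsq (v - z \<cdot> u - w) = 0" by blast
  qed
  define d where "d = cmod (of_real E - z)"
  have d: "0 < d" "d < \<delta>" using nz z by (auto simp: d_def norm_minus_commute)
  show "\<exists>C. \<forall>(u, v)\<in>associated. H.nrm u \<le> C * H.nrm (v - z \<cdot> u)"
  proof (intro exI[of _ "1 / d + 1 / (\<delta> - d)"] ballI, clarify)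
    fix u v assume "(u, v) \<in> associated"
    then have u: "u \<in> V" and v: "v \<in> H" and uv: "\<And>y. y \<in> V \<Longrightarrow> a u y = ip v y"
      by (auto simp: associated_def)
    define r where "r = v - z \<cdot> u"
    have r: "r \<in> H" using u v by (auto simp: r_def)
    have ipr: "ip r y = a u y - z * ip u y" if "y \<in> V" for y
      using that u v uv by (simp add: r_def H.ip_simps)
    define f where "f = proj n e u"
    define g where "g = u - f"
    have f: "f \<in> ground_states" "f \<in> V" using PF by (auto simp: f_def)
    have g: "g \<in> ground_perp" "g \<in> V" using proj_G[OF on basis u] by (auto simp: f_def g_def)
    have ufg: "u = f + g" by (simp add: g_def)
    have "ip r f = (of_real E - z) * ip f f"
      using ipr[OF f(2)] a_F_right[OF f(1) u] ip_GF[OF g(1) f(1)] f g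
      by (simp add: ufg H.ip_simps algebra_simps)
    then have "d * (H.nrm f)\<^sup>2 = cmod (ip r f)"
      using f by (simp add: d_def norm_mult H.ip_self H.nrm_sq)
    also have "\<dots> \<le> H.nrm r * H.nrm f" using r f by (intro H.cauchy_schwarz) auto
    finally have 1: "H.nrm f \<le> H.nrm r / d"
      using d f r by (intro le_divide_of_square_le) auto
    have "ip r g = a g g - z * ip g g"
      using ipr[OF g(2)] a_F_left[OF f(1) g(2)] ip_FG[OF g(1) f(1)] f g
      by (simp add: ufg V.ip_simps H.ip_simps)
    then have "Re (ip r g) = B.nsq g + (E - Re z) * H.nsq g"
      using g by (simp add: B_nsq V.ip_self[OF g(2)] H.ip_self[OF VH[OF g(2)]] left_diff_distrib)
    \<comment> \<open>Taking real parts, moving from E to z costs at most d of the gap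
      \<delta>.\<close>
    moreover have "\<bar>Re (of_real E - z)\<bar> \<le> d" unfolding d_def by (rule abs_Re_le_cmod)
    then have "(- d) * H.nsq g \<le> (E - Re z) * H.nsq g" using g by (intro mult_right_mono) auto
    ultimately have "(\<delta> - d) * (H.nrm g)\<^sup>2 \<le> Re (ip r g)"
      using gap g by (auto simp: H.nrm_sq left_diff_distrib dest!: bspec[of ground_perp _ g])
    also have "\<dots> \<le> H.nrm r * H.nrm g"
      using H.cauchy_schwarz[of r g] complex_Re_le_cmod[of "ip r g"] r g by fastforce
    finally have 2: "H.nrm g \<le> H.nrm r / (\<delta> - d)"
      using d g r by (intro le_divide_of_square_le) auto
    have "H.nrm u \<le> H.nrm f + H.nrm g" unfolding ufg using f g by (intro H.nrm_triangle) auto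
    then show "H.nrm u \<le> (1 / d + 1 / (\<delta> - d)) * H.nrm (v - z \<cdot> u)"
      using 1 2 by (simp add: r_def distrib_right)
  qed
qed

text \<open>The shifted form is coercive on all of V with constant E - l, so \<open>riesz\<close>
  applies with G = V.\<close>

lemma regular_below_E:
  assumes l: "l < E"
  shows "regular_value (of_real l)"
  unfolding regular_value_def
proof
  have coer: "(E - l) * H.nsq u \<le> V.nsq u - l * H.nsq u" if "u \<in> V" for u
    using E_le[OF that] by (simp add: algebra_simps)
  have cl: "closed_in_form V"
    unfolding closed_in_form_def using V.subspace_carrier by auto
  show "\<forall>w\<in>H. \<exists>(u, v)\<in>associated. H.nsq (v - of_real l \<cdot> u - w) = 0"
  proof
    fix w assume w: "w \<in> H"
    obtain u where u: "u \<in> V" and eq: "\<And>v. v \<in> V \<Longrightarrow> a u v - of_real l * ip u v = ip w v"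
      using riesz[OF cl _ coer w] l by auto
    have "(u, w + of_real l \<cdot> u) \<in> associated"
      using u w eq by (auto simp: associated_def H.ip_simps algebra_simps)
    moreover have "H.nsq ((w + of_real l \<cdot> u) - of_real l \<cdot> u - w) = 0" by (simp add: H.nsq_def)
    ultimately show "\<exists>(u, v)\<in>associated. H.nsq (v - of_real l \<cdot> u - w) = 0" by blast
  qed
  show "\<exists>C. \<forall>(u, v)\<in>associated. H.nrm u \<le> C * H.nrm (v - of_real l \<cdot> u)"
  proof (intro exI[of _ "1 / (E - l)"] ballI, clarify)
    fix u v assume "(u, v) \<in> associated"
    then have u: "u \<in> V" and v: "v \<in> H" and uv: "\<And>y. y \<in> V \<Longrightarrow> a u y = ip v y"
      by (auto simp: associated_def)
    define r where "r = v - of_real l \<cdot> u"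
    have r: "r \<in> H" using u v by (auto simp: r_def)
    have "(E - l) * (H.nrm u)\<^sup>2 \<le> V.nsq u - l * H.nsq u" using coer[OF u] u by (simp add: H.nrm_sq)
    also have "\<dots> = Re (ip r u)" using u v uv[OF u] by (simp add: r_def H.ip_simps H.nsq_def V.nsq_def)
    also have "\<dots> \<le> H.nrm r * H.nrm u"
      using H.cauchy_schwarz[of r u] complex_Re_le_cmod[of "ip r u"] r u by fastforce
    finally have "H.nrm u \<le> H.nrm r / (E - l)"
      using l u r by (intro le_divide_of_square_le) auto
    then show "H.nrm u \<le> 1 / (E - l) * H.nrm (v - of_real l \<cdot> u)" by (simp add: r_def)
  qed
qed

theorem bottom_of_spectrum:
  "\<exists>E \<delta>. \<delta> > 0 \<and>
     (\<exists>u. (u, of_real E \<cdot> u) \<in> associated \<and> H.nsq u \<noteq> 0) \<and>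
     (\<exists>B. finite B \<and> (\<forall>b\<in>B. (b, of_real E \<cdot> b) \<in> associated) \<and>
        (\<forall>u. (u, of_real E \<cdot> u) \<in> associated \<longrightarrow> (\<exists>c. H.nsq (u - (\<Sum>b\<in>B. c b \<cdot> b)) = 0))) \<and>
     (\<forall>z. z \<noteq> of_real E \<longrightarrow> cmod (z - of_real E) < \<delta> \<longrightarrow> regular_value z) \<and>
     (\<forall>l<E. regular_value (of_real l))"
proof -
  obtain \<delta> where \<delta>: "\<delta> > 0" "\<forall>u\<in>ground_perp. \<delta> * H.nsq u \<le> B.nsq u" using gap by blast
  have ground_iff: "(u, of_real E \<cdot> u) \<in> associated \<longleftrightarrow> u \<in> ground_states" for u
    unfolding associated_def ground_states_def by (auto simp: H.ip_scale_left)
  obtain n e where on: "orthonormal_upto n e"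
    and basis: "\<And>u. u \<in> ground_states \<Longrightarrow> H.nsq (u - proj n e u) = 0"
    using finite_orthonormal_basis by blast
  \<comment> \<open>The basis is to be a set with coefficients on its elements; orthonormal vectors
    are distinct, so the sum over indices can be reindexed.\<close>
  have inj: "inj_on e {..<n}"
  proof (rule inj_onI, rule ccontr)
    fix i j assume ij: "i \<in> {..<n}" "j \<in> {..<n}" "e i = e j" "i \<noteq> j"
    then have "ip (e i) (e i) = 0" using on unfolding orthonormal_upto_def by (metis lessThan_iff)
    moreover have "H.nsq (e i) = 1" using on ij by (auto simp: orthonormal_upto_def)
    ultimately show False by (simp add: H.nsq_def)
  qed
  have "\<exists>c. H.nsq (u - (\<Sum>b\<in>e ` {..<n}. c b \<cdot> b)) = 0" if "u \<in> ground_states" for u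
    using basis[OF that] by (intro exI[of _ "ip u"]) (simp add: sum.reindex[OF inj] proj_def)
  moreover have "\<forall>b\<in>e ` {..<n}. b \<in> ground_states" using on by (auto simp: orthonormal_upto_def)
  ultimately have "\<exists>B. finite B \<and> (\<forall>b\<in>B. b \<in> ground_states) \<and>
        (\<forall>u. u \<in> ground_states \<longrightarrow> (\<exists>c. H.nsq (u - (\<Sum>b\<in>B. c b \<cdot> b)) = 0))" by blast
  then show ?thesis
    unfolding ground_iff[symmetric]
    using \<delta> regular_near_E regular_below_E E_attained
    by (intro exI[of _ E] exI[of _ \<delta>]) (auto simp: ground_iff intro!: bexI)
qed

end

subsection \<open>Smooth functions\<close>

text \<open>By uniqueness of derivatives any explicit D may stand in for
  \<open>frechet_derivative\<close>. The closure properties below are inductions over this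
  rule.\<close>

lemma C_k_SucI:
  fixes f :: "'a::euclidean_space \<Rightarrow> 'b::real_normed_vector"
  assumes "\<And>x. (f has_derivative D x) (at x)" "\<And>e. e \<in> Basis \<Longrightarrow> C_k k (\<lambda>x. D x e)"
  shows "C_k (Suc k) f"
proof -
  have "frechet_derivative f (at x) = D x" for x
    using frechet_derivative_at[OF assms(1)] by simp
  moreover have "f differentiable_on UNIV"
    using assms(1) by (auto simp: differentiable_on_def differentiable_def)
  ultimately show ?thesis using assms(2) by simp
qed

lemma C_k_SucE:
  fixes f :: "'a::euclidean_space \<Rightarrow> 'b::real_normed_vector"
  assumes "C_k (Suc k) f"
  obtains D where "\<And>x. (f has_derivative D x) (at x)" "\<And>e. e \<in> Basis \<Longrightarrow> C_k k (\<lambda>x. D x e)"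
proof
  show "(f has_derivative frechet_derivative f (at x)) (at x)" for x
    using assms by (auto simp: differentiable_on_def frechet_derivative_works[symmetric])
  show "C_k k (\<lambda>x. frechet_derivative f (at x) e)" if "e \<in> Basis" for e
    using assms that by simp
qed

lemma C_k_Suc_imp: "C_k (Suc k) f \<Longrightarrow> C_k k f"
proof (induction k arbitrary: f)
  case 0
  then show ?case by (auto intro: differentiable_imp_continuous_on)
next
  case (Suc k)
  from C_k_SucE[OF Suc.prems] obtain D
    where D: "\<And>x. (f has_derivative D x) (at x)" "\<And>e. e \<in> Basis \<Longrightarrow> C_k (Suc k) (\<lambda>x. D x e)" by blast
  show ?case using D Suc.IH by (intro C_k_SucI[of f D]) blast+
qed

lemma smoothD: "smooth f \<Longrightarrow> C_k k f"
  by (simp add: smooth_def)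

lemma smooth_imp_continuous: "smooth f \<Longrightarrow> continuous_on A f"
  using smoothD[of f 0] continuous_on_subset by fastforce

lemma smooth_has_derivative: "smooth f \<Longrightarrow> (f has_derivative frechet_derivative f (at x)) (at x)"
  using smoothD[of f 1] by (auto simp: differentiable_on_def frechet_derivative_works[symmetric])

lemma smooth_frechet: "smooth f \<Longrightarrow> e \<in> Basis \<Longrightarrow> smooth (\<lambda>x. frechet_derivative f (at x) e)"
  unfolding smooth_def
proof
  assume "\<forall>k. C_k k f" "e \<in> Basis"
  then show "C_k k (\<lambda>x. frechet_derivative f (at x) e)" for k by (metis C_k.simps(2))
qed

lemma C_k_zero: "C_k k (\<lambda>x. 0)"
  by (induction k) (auto intro!: C_k_SucI[where D = "\<lambda>x h. 0"] simp del: C_k.simps(2))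

lemma C_k_const: "C_k k (\<lambda>x. c)"
  by (cases k) (auto intro!: C_k_SucI[where D = "\<lambda>x h. 0"] C_k_zero simp del: C_k.simps(2))

lemma C_k_add: "C_k k f \<Longrightarrow> C_k k g \<Longrightarrow> C_k k (\<lambda>x. f x + g x)"
proof (induction k arbitrary: f g)
  case (Suc k)
  from C_k_SucE[OF Suc.prems(1)] obtain D
    where D: "\<And>x. (f has_derivative D x) (at x)" "\<And>e. e \<in> Basis \<Longrightarrow> C_k k (\<lambda>x. D x e)" by blast
  from C_k_SucE[OF Suc.prems(2)] obtain D'
    where D': "\<And>x. (g has_derivative D' x) (at x)" "\<And>e. e \<in> Basis \<Longrightarrow> C_k k (\<lambda>x. D' x e)" by blast
  show ?case
    by (rule C_k_SucI[OF has_derivative_add[OF D(1) D'(1)]]) (intro Suc.IH D D')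
qed (auto intro: continuous_intros)

lemma C_k_bounded_linear: "bounded_linear L \<Longrightarrow> C_k k f \<Longrightarrow> C_k k (\<lambda>x. L (f x))"
proof (induction k arbitrary: f)
  case (Suc k)
  from C_k_SucE[OF Suc.prems(2)] obtain D
    where D: "\<And>x. (f has_derivative D x) (at x)" "\<And>e. e \<in> Basis \<Longrightarrow> C_k k (\<lambda>x. D x e)" by blast
  show ?case
    by (rule C_k_SucI[OF bounded_linear.has_derivative[OF Suc.prems(1) D(1)]])
       (intro Suc.IH D Suc.prems)
qed (auto intro: bounded_linear.continuous_on)

lemma C_k_mult:
  fixes f g :: "'a::euclidean_space \<Rightarrow> 'b::real_normed_algebra"
  shows "C_k k f \<Longrightarrow> C_k k g \<Longrightarrow> C_k k (\<lambda>x. f x * g x)"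
proof (induction k arbitrary: f g)
  case (Suc k)
  from C_k_SucE[OF Suc.prems(1)] obtain D
    where D: "\<And>x. (f has_derivative D x) (at x)" "\<And>e. e \<in> Basis \<Longrightarrow> C_k k (\<lambda>x. D x e)" by blast
  from C_k_SucE[OF Suc.prems(2)] obtain D'
    where D': "\<And>x. (g has_derivative D' x) (at x)" "\<And>e. e \<in> Basis \<Longrightarrow> C_k k (\<lambda>x. D' x e)" by blast
  show ?case
    by (rule C_k_SucI[OF has_derivative_mult[OF D(1) D'(1)]])
       (intro C_k_add Suc.IH D D' C_k_Suc_imp[OF Suc.prems(1)] C_k_Suc_imp[OF Suc.prems(2)])
qed (auto intro: continuous_intros)

lemma C_k_linear: "bounded_linear L \<Longrightarrow> C_k k L"
  by (cases k)
     (auto intro: C_k_SucI[where D = "\<lambda>x. L"] C_k_const bounded_linear_imp_has_derivative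
        linear_continuous_on simp del: C_k.simps(2))

lemma C_k_compose:
  fixes g :: "real \<Rightarrow> real" and u :: "'a::euclidean_space \<Rightarrow> real"
  shows "smooth g \<Longrightarrow> C_k k u \<Longrightarrow> C_k k (\<lambda>x. g (u x))"
proof (induction k arbitrary: g)
  case 0
  then show ?case
    using continuous_on_compose2[OF smooth_imp_continuous[of g UNIV]] by auto
next
  case (Suc k)
  from C_k_SucE[OF Suc.prems(2)] obtain D
    where D: "\<And>x. (u has_derivative D x) (at x)" "\<And>e. e \<in> Basis \<Longrightarrow> C_k k (\<lambda>x. D x e)" by blast
  let ?g' = "\<lambda>y. frechet_derivative g (at y) 1"
  have lin: "frechet_derivative g (at y) h = h * ?g' y" for y h
    using linear_scale[OF has_derivative_linear[OF smooth_has_derivative[OF Suc.prems(1)]], of y h 1]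
    by simp
  have "((\<lambda>x. g (u x)) has_derivative (\<lambda>h. frechet_derivative g (at (u x)) (D x h))) (at x)" for x
    by (rule has_derivative_compose[OF D(1) smooth_has_derivative[OF Suc.prems(1)]])
  then show ?case
  proof (rule C_k_SucI)
    fix e :: 'a assume e: "e \<in> Basis"
    have "smooth ?g'" using Suc.prems(1) by (intro smooth_frechet) auto
    then have "C_k k (\<lambda>x. ?g' (u x))" using Suc.IH C_k_Suc_imp[OF Suc.prems(2)] by blast
    then show "C_k k (\<lambda>x. frechet_derivative g (at (u x)) (D x e))"
      unfolding lin[of _ "D _ _"] by (rule C_k_mult[OF D(2)[OF e]])
  qed
qed

text \<open>The derivative of 1 / u is a product of D and copies of 1 / u, and the latter are
  covered by the induction hypothesis one order lower.\<close>

lemma C_k_inverse: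
  fixes u :: "'a::euclidean_space \<Rightarrow> real"
  assumes "\<And>x. u x \<noteq> 0"
  shows "C_k k u \<Longrightarrow> C_k k (\<lambda>x. 1 / u x)"
proof (induction k)
  case (Suc k)
  from C_k_SucE[OF Suc.prems] obtain D
    where D: "\<And>x. (u has_derivative D x) (at x)" "\<And>e. e \<in> Basis \<Longrightarrow> C_k k (\<lambda>x. D x e)" by blast
  have "((\<lambda>x. 1 / u x) has_derivative (\<lambda>h. D x h * ((1 / u x) * ((-1) * (1 / u x))))) (at x)" for x
    using assms by (auto intro!: derivative_eq_intros D simp: field_simps)
  then show ?case
    by (rule C_k_SucI) (intro C_k_mult C_k_const D Suc.IH C_k_Suc_imp[OF Suc.prems])
qed (use assms in \<open>auto intro!: continuous_intros\<close>)

text \<open>As for the reciprocal: the derivative D sqrt(u) / (2 u) contains the square root itself,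
  one order lower.\<close>

lemma C_k_sqrt:
  fixes u :: "'a::euclidean_space \<Rightarrow> real"
  assumes "\<And>x. u x > 0"
  shows "C_k k u \<Longrightarrow> C_k k (\<lambda>x. sqrt (u x))"
proof (induction k)
  case (Suc k)
  from C_k_SucE[OF Suc.prems] obtain D
    where D: "\<And>x. (u has_derivative D x) (at x)" "\<And>e. e \<in> Basis \<Longrightarrow> C_k k (\<lambda>x. D x e)" by blast
  have u0: "u x \<noteq> 0" for x using assms[of x] by simp
  have "((\<lambda>x. sqrt (u x)) has_derivative (\<lambda>h. D x h * ((1/2) * ((1 / u x) * sqrt (u x))))) (at x)" for x
  proof -
    have "inverse (sqrt (u x)) = sqrt (u x) / u x"
      using assms[of x] by (simp add: field_simps)
    then show ?thesis
      using assms[of x] by (auto intro!: derivative_eq_intros D simp: fun_eq_iff)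
  qed
  then show ?case
    by (rule C_k_SucI) (intro C_k_mult C_k_const C_k_inverse D Suc.IH C_k_Suc_imp[OF Suc.prems] u0)
qed (auto intro!: continuous_intros)

lemma C_k_sin_cos: "C_k k (sin :: real \<Rightarrow> real) \<and> C_k k (cos :: real \<Rightarrow> real)"
proof (induction k)
  case (Suc k)
  have "C_k (Suc k) (sin :: real \<Rightarrow> real)"
    by (rule C_k_SucI[where D = "\<lambda>x h. cos x * h"])
       (use Suc in \<open>auto intro!: derivative_eq_intros C_k_mult C_k_const\<close>)
  moreover have "C_k (Suc k) (cos :: real \<Rightarrow> real)"
    by (rule C_k_SucI[where D = "\<lambda>x h. (- 1) * sin x * h"])
       (use Suc in \<open>auto intro!: derivative_eq_intros intro: C_k_mult C_k_const C_k_bounded_linear[OF bounded_linear_minus[OF bounded_linear_ident]]\<close>)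
  ultimately show ?case by simp
qed (auto intro: continuous_intros)

lemma smooth_const [simp]: "smooth (\<lambda>x. c)"
  by (simp add: smooth_def C_k_const)

lemma smooth_add: "smooth f \<Longrightarrow> smooth g \<Longrightarrow> smooth (\<lambda>x. f x + g x)"
  by (simp add: smooth_def C_k_add)

lemma smooth_bounded_linear: "bounded_linear L \<Longrightarrow> smooth f \<Longrightarrow> smooth (\<lambda>x. L (f x))"
  by (simp add: smooth_def C_k_bounded_linear)

lemma smooth_linear: "bounded_linear L \<Longrightarrow> smooth L"
  by (simp add: smooth_def C_k_linear)

lemma smooth_mult:
  fixes f g :: "'a::euclidean_space \<Rightarrow> 'b::real_normed_algebra"
  shows "smooth f \<Longrightarrow> smooth g \<Longrightarrow> smooth (\<lambda>x. f x * g x)"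
  by (simp add: smooth_def C_k_mult)

lemma smooth_uminus: "smooth f \<Longrightarrow> smooth (\<lambda>x. - f x)"
  by (rule smooth_bounded_linear[OF bounded_linear_minus[OF bounded_linear_ident]])

lemma smooth_diff: "smooth f \<Longrightarrow> smooth g \<Longrightarrow> smooth (\<lambda>x. f x - g x)"
  using smooth_add[OF _ smooth_uminus, of f g] by simp

lemma smooth_compose:
  fixes g :: "real \<Rightarrow> real" and u :: "'a::euclidean_space \<Rightarrow> real"
  shows "smooth g \<Longrightarrow> smooth u \<Longrightarrow> smooth (\<lambda>x. g (u x))"
  using C_k_compose unfolding smooth_def by blast

lemma smooth_inverse:
  fixes u :: "'a::euclidean_space \<Rightarrow> real"
  shows "smooth u \<Longrightarrow> (\<And>x. u x \<noteq> 0) \<Longrightarrow> smooth (\<lambda>x. 1 / u x)"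
  using C_k_inverse unfolding smooth_def by blast

lemma smooth_sqrt:
  fixes u :: "'a::euclidean_space \<Rightarrow> real"
  shows "smooth u \<Longrightarrow> (\<And>x. u x > 0) \<Longrightarrow> smooth (\<lambda>x. sqrt (u x))"
  using C_k_sqrt unfolding smooth_def by blast

lemma smooth_sin: "smooth (sin :: real \<Rightarrow> real)"
  by (simp add: smooth_def C_k_sin_cos)

lemma smooth_prod:
  fixes f :: "'i \<Rightarrow> 'a::euclidean_space \<Rightarrow> 'b::real_normed_field"
  shows "(\<And>i. i \<in> I \<Longrightarrow> smooth (f i)) \<Longrightarrow> smooth (\<lambda>x. \<Prod>i\<in>I. f i x)"
  by (induction I rule: infinite_finite_induct) (auto intro: smooth_mult)

text \<open>W and the complement of C form an open cover; on the first set the function is u, on the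
  second it is 0. The sine profile needs this, since the sine is positive again on later
  periods.\<close>

lemma smooth_restrict:
  fixes u :: "'a::euclidean_space \<Rightarrow> 'b::real_normed_vector"
  assumes u: "smooth u" and W: "open W" and C: "closed C" "C \<subseteq> W" and zero: "\<And>x. x \<in> W - C \<Longrightarrow> u x = 0"
  shows "smooth (\<lambda>x. if x \<in> W then u x else 0)"
proof -
  have "C_k k (\<lambda>x. if x \<in> W then v x else 0)"
    if "C_k k v" "\<And>x. x \<in> W - C \<Longrightarrow> v x = 0" for k and v :: "'a \<Rightarrow> 'b"
    using that
  proof (induction k arbitrary: v)
    case 0
    have "continuous_on (W \<union> - C) (\<lambda>x. if x \<in> W then v x else 0)"
    proof (rule continuous_on_open_Un)
      show "continuous_on W (\<lambda>x. if x \<in> W then v x else 0)"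
        using continuous_on_subset[of UNIV v W] 0 by (simp cong: continuous_on_cong)
      have "continuous_on (- C) (\<lambda>x. 0 :: 'b)" by simp
      then show "continuous_on (- C) (\<lambda>x. if x \<in> W then v x else 0)"
        by (rule continuous_on_eq) (use 0 in auto)
    qed (use W C in auto)
    moreover have "W \<union> - C = UNIV" using C by auto
    ultimately show ?case by simp
  next
    case (Suc k)
    from C_k_SucE[OF Suc.prems(1)] obtain D
      where D: "\<And>x. (v has_derivative D x) (at x)" "\<And>e. e \<in> Basis \<Longrightarrow> C_k k (\<lambda>x. D x e)" by blast
    have der0: "((\<lambda>x. if x \<in> W then v x else 0) has_derivative (\<lambda>h. 0)) (at x)" if x: "x \<notin> C" for x
    proof (rule has_derivative_transform_within_open[OF has_derivative_const[of 0]])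
      show "open (- C)" "x \<in> - C" using C x by auto
      show "0 = (if y \<in> W then v y else 0)" if "y \<in> - C" for y using that Suc.prems(2) by auto
    qed
    have derW: "((\<lambda>x. if x \<in> W then v x else 0) has_derivative D x) (at x)" if "x \<in> W" for x
      using has_derivative_transform_within_open[OF D(1) W that, of "\<lambda>x. if x \<in> W then v x else 0"]
      by auto
    have D0: "D x e = 0" if "x \<in> W - C" for x e
      using has_derivative_unique[OF derW der0] that by auto
    have "((\<lambda>x. if x \<in> W then v x else 0) has_derivative (\<lambda>e. if x \<in> W then D x e else 0)) (at x)" for x
    proof (cases "x \<in> W")
      case True
      then show ?thesis using derW[OF True] by simp
    next
      case False
      then have "x \<notin> C" using C by blast
      then show ?thesis using der0 False by simp
    qed
    then show ?case
      by (rule C_k_SucI) (use D0 D(2) Suc.IH in blast)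
  qed
  then show ?thesis using u zero unfolding smooth_def by blast
qed

text \<open>All cutoffs below are built from this function. It tends to 1 at infinity, so
  \<open>flat (real n * s)\<close> approximates the indicator of s > 0 while staying between 0 and
  1.\<close>

definition flat :: "real \<Rightarrow> real" where
  "flat x = (if 0 < x then exp (- 1 / x) else 0)"

lemma poly_exp_tendsto_0: "((\<lambda>t. poly p t * exp (- t)) \<longlongrightarrow> (0::real)) at_top"
proof -
  have *: "((\<lambda>t. t ^ n * exp (- t)) \<longlongrightarrow> (0::real)) at_top" for n
    using tendsto_power_div_exp_0[of n] by (simp add: exp_minus field_simps)
  have "((\<lambda>t. \<Sum>i\<le>degree p. coeff p i * (t ^ i * exp (- t))) \<longlongrightarrow> (\<Sum>i\<le>degree p. coeff p i * 0)) at_top"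
    by (intro tendsto_intros *)
  then show ?thesis by (simp add: poly_altdef sum_distrib_right mult.assoc)
qed

text \<open>The functions \<open>p (1 / x) * flat x\<close> are closed under differentiation.\<close>

definition poly_flat :: "real poly \<Rightarrow> real \<Rightarrow> real" where
  "poly_flat p x = (if 0 < x then poly p (1 / x) * exp (- 1 / x) else 0)"

text \<open>With t = 1 / x the chain rule gives t^2 (p(t) - p'(t)) exp(-t). At x = 0 the right
  difference quotient is t p(t) exp(-t), which tends to 0 as t grows.\<close>

lemma poly_flat_derivative:
  "(poly_flat p has_real_derivative poly_flat ([:0, 0, 1:] * (p - pderiv p)) x) (at x)"
proof -
  consider "x > 0" | "x < 0" | "x = 0" by linarith
  then show ?thesis
  proof cases
    case 1
    have "((\<lambda>x. poly p (1 / x) * exp (- 1 / x)) has_real_derivative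
        poly_flat ([:0, 0, 1:] * (p - pderiv p)) x) (at x)"
      using 1 by (auto intro!: derivative_eq_intros DERIV_chain2[OF poly_DERIV]
          simp: poly_flat_def field_simps power2_eq_square)
    then show ?thesis
      by (rule has_field_derivative_transform_within_open[where S = "{0<..}"]) (use 1 in \<open>auto simp: poly_flat_def\<close>)
  next
    case 2
    have "((\<lambda>x. 0) has_real_derivative poly_flat ([:0, 0, 1:] * (p - pderiv p)) x) (at x)"
      using 2 by (simp add: poly_flat_def)
    then show ?thesis
      by (rule has_field_derivative_transform_within_open[where S = "{..<0}"]) (use 2 in \<open>auto simp: poly_flat_def\<close>)
  next
    case 3
    have "((\<lambda>h. poly_flat p h / h) \<longlongrightarrow> 0) (at_right 0)"
    proof -
      have "((\<lambda>t. poly ([:0, 1:] * p) t * exp (- t)) \<longlongrightarrow> 0) at_top" by (rule poly_exp_tendsto_0)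
      then have "((\<lambda>h. poly ([:0, 1:] * p) (inverse h) * exp (- inverse h)) \<longlongrightarrow> 0) (at_right 0)"
        by (rule filterlim_compose[OF _ filterlim_inverse_at_top_right])
      then show ?thesis
        by (rule Lim_transform_eventually)
           (auto simp: poly_flat_def eventually_at_filter field_simps intro!: always_eventually)
    qed
    moreover have "((\<lambda>h. poly_flat p h / h) \<longlongrightarrow> 0) (at_left 0)"
      by (rule Lim_transform_eventually[of "\<lambda>h. 0"])
         (auto simp: poly_flat_def eventually_at_filter intro!: always_eventually)
    ultimately have "((\<lambda>h. poly_flat p h / h) \<longlongrightarrow> 0) (at 0)" by (simp add: filterlim_split_at)
    moreover have "poly_flat p (0 + h) - poly_flat p 0 = poly_flat p h" for h by (simp add: poly_flat_def)
    ultimately have "(poly_flat p has_real_derivative 0) (at 0)" unfolding has_field_derivative_iff by simp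
    then show ?thesis using 3 by (simp add: poly_flat_def)
  qed
qed

lemma poly_flat_1: "poly_flat 1 = flat"
  by (auto simp: poly_flat_def flat_def)

lemma smooth_flat: "smooth flat"
proof -
  have "C_k k (poly_flat p)" for k p
  proof (induction k arbitrary: p)
    case 0
    then show ?case using poly_flat_derivative by (auto intro: DERIV_continuous_on)
  next
    case (Suc k)
    have "(poly_flat p has_derivative (\<lambda>h. poly_flat ([:0, 0, 1:] * (p - pderiv p)) x * h)) (at x)" for x
      using poly_flat_derivative[of p x] by (simp add: has_field_derivative_def)
    then show ?case by (rule C_k_SucI) (intro C_k_mult Suc.IH C_k_const)
  qed
  then have "smooth (poly_flat 1)" by (simp add: smooth_def)
  moreover have "poly_flat 1 = flat" by (rule poly_flat_1)
  ultimately show ?thesis by simp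
qed

lemma flat_derivative: "(flat has_real_derivative (if 0 < x then exp (- 1 / x) / x\<^sup>2 else 0)) (at x)"
proof -
  have "poly_flat ([:0, 0, 1:] * (1 - pderiv 1)) x = (if 0 < x then exp (- 1 / x) / x\<^sup>2 else 0)"
    by (cases "0 < x") (simp_all add: poly_flat_def power2_eq_square)
  then show ?thesis using poly_flat_derivative[of 1 x] by (simp only: poly_flat_1)
qed

lemma flat_bounds: "0 \<le> flat x" "flat x \<le> 1" "flat x = 0 \<longleftrightarrow> x \<le> 0"
  by (auto simp: flat_def)

subsection \<open>Square-integrable functions\<close>

lemma norm_add_sq_le: "(norm (a + b))\<^sup>2 \<le> 2 * (norm a)\<^sup>2 + 2 * (norm b)\<^sup>2"
  for a b :: "'a::real_normed_vector"
proof -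
  have "(norm (a + b))\<^sup>2 \<le> (norm a + norm b)\<^sup>2" by (intro power_mono norm_triangle_ineq) auto
  also have "\<dots> \<le> 2 * (norm a)\<^sup>2 + 2 * (norm b)\<^sup>2"
    using sum_squares_bound[of "norm a" "norm b"] by (simp add: power2_sum)
  finally show ?thesis .
qed

lemma square_integrable_add:
  fixes u v :: "'a \<Rightarrow> complex"
  assumes [measurable]: "u \<in> borel_measurable M" "v \<in> borel_measurable M"
    and "integrable M (\<lambda>x. (norm (u x))\<^sup>2)" "integrable M (\<lambda>x. (norm (v x))\<^sup>2)"
  shows "integrable M (\<lambda>x. (norm (u x + v x))\<^sup>2)"
proof (rule Bochner_Integration.integrable_bound)
  show "integrable M (\<lambda>x. 2 * (norm (u x))\<^sup>2 + 2 * (norm (v x))\<^sup>2)" using assms by simp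
  show "AE x in M. norm ((norm (u x + v x))\<^sup>2) \<le> norm (2 * (norm (u x))\<^sup>2 + 2 * (norm (v x))\<^sup>2)"
    using norm_add_sq_le by (intro always_eventually) auto
qed measurable

text \<open>Riesz-Fischer for squared norms. A rapidly Cauchy subsequence converges almost
  everywhere, and Fatou's lemma transfers the Cauchy bounds to its limit.\<close>

lemma square_integrable_complete:
  fixes X :: "nat \<Rightarrow> 'a \<Rightarrow> complex"
  assumes meas [measurable]: "\<And>n. X n \<in> borel_measurable M"
    and int: "\<And>n. integrable M (\<lambda>x. (norm (X n x))\<^sup>2)"
    and Cauchy: "\<And>e. e > 0 \<Longrightarrow> \<exists>N. \<forall>m\<ge>N. \<forall>n\<ge>N. (LINT x|M. (norm (X m x - X n x))\<^sup>2) < e"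
  shows "\<exists>u \<in> borel_measurable M. integrable M (\<lambda>x. (norm (u x))\<^sup>2) \<and>
           (\<lambda>n. LINT x|M. (norm (X n x - u x))\<^sup>2) \<longlonglongrightarrow> 0"
proof -
  have int_diff: "integrable M (\<lambda>x. (norm (X m x - X n x))\<^sup>2)" for m n
    using square_integrable_add[of "X m" M "\<lambda>x. - X n x"] int by simp
  \<comment> \<open>The rate 1/8 leaves a summable (1/2)^n after the weight 4^n; that weight forces
    the increments to be eventually at most (1/2)^n at almost every point.\<close>
  have "\<exists>N. \<forall>m\<ge>N. \<forall>n\<ge>N. (LINT x|M. (norm (X m x - X n x))\<^sup>2) < (1/8) ^ k" for k
    by (rule Cauchy) simp
  then obtain N where N: "\<And>k m n. m \<ge> N k \<Longrightarrow> n \<ge> N k \<Longrightarrow> (LINT x|M. (norm (X m x - X n x))\<^sup>2) < (1/8) ^ k"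
    by metis
  \<comment> \<open>The partial sums make r monotone and at least N n; the summand n makes it exceed
    every bound.\<close>
  define r where "r n = n + (\<Sum>i\<le>n. N i)" for n
  have r: "n \<le> r n" "N n \<le> r n" "r n \<le> r (Suc n)" for n
    using member_le_sum[of n "{..n}" N] by (auto simp: r_def)
  define D where "D n x = X (r (Suc n)) x - X (r n) x" for n x
  have [measurable]: "D n \<in> borel_measurable M" for n by (simp add: D_def[abs_def])
  have D_le: "(LINT x|M. (norm (D n x))\<^sup>2) \<le> (1/8) ^ n" for n
    unfolding D_def using r[of n] by (intro less_imp_le[OF N[of n]]) auto
  have "(\<integral>\<^sup>+x. (\<Sum>n. ennreal (4 ^ n * (norm (D n x))\<^sup>2)) \<partial>M) =
      (\<Sum>n. \<integral>\<^sup>+x. ennreal (4 ^ n * (norm (D n x))\<^sup>2) \<partial>M)"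
    by (rule nn_integral_suminf) measurable
  also have "\<dots> \<le> (\<Sum>n. ennreal ((1/2) ^ n))"
  proof (rule suminf_le)
    show "(\<integral>\<^sup>+x. ennreal (4 ^ n * (norm (D n x))\<^sup>2) \<partial>M) \<le> ennreal ((1/2) ^ n)" for n
    proof -
      have "(\<integral>\<^sup>+x. ennreal (4 ^ n * (norm (D n x))\<^sup>2) \<partial>M) = ennreal (LINT x|M. 4 ^ n * (norm (D n x))\<^sup>2)"
        by (rule nn_integral_eq_integral) (auto simp: D_def int_diff)
      also have "\<dots> \<le> ennreal (4 ^ n * (1/8) ^ n)"
        using D_le[of n] by (intro ennreal_leI) simp
      also have "(4 ^ n * (1/8) ^ n :: real) = (1/2) ^ n" by (simp flip: power_mult_distrib)
      finally show ?thesis .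
    qed
  qed auto
  also have "\<dots> = ennreal (\<Sum>n. (1/2) ^ n)" by (intro suminf_ennreal2) (auto intro: summable_geometric)
  also have "\<dots> < \<infinity>" by simp
  finally have fin: "(\<integral>\<^sup>+x. (\<Sum>n. ennreal (4 ^ n * (norm (D n x))\<^sup>2)) \<partial>M) \<noteq> \<infinity>" by simp
  have "AE x in M. (\<Sum>n. ennreal (4 ^ n * (norm (D n x))\<^sup>2)) \<noteq> \<infinity>"
    by (rule nn_integral_PInf_AE[OF _ fin]) measurable
  then have conv: "AE x in M. convergent (\<lambda>n. X (r n) x)"
  proof eventually_elim
    case (elim x)
    have "summable (\<lambda>n. 4 ^ n * (norm (D n x))\<^sup>2)"
      using elim by (intro summable_suminf_not_top) auto
    then have "(\<lambda>n. 4 ^ n * (norm (D n x))\<^sup>2) \<longlonglongrightarrow> 0" by (rule summable_LIMSEQ_zero)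
    then have "\<forall>\<^sub>F n in sequentially. 4 ^ n * (norm (D n x))\<^sup>2 < 1" by (rule order_tendstoD) simp
    then have "\<forall>\<^sub>F n in sequentially. norm (D n x) \<le> (1/2) ^ n"
    proof eventually_elim
      case (elim n)
      have two: "(2 ^ n)\<^sup>2 = (4 ^ n :: real)"
        by (simp add: power2_eq_square flip: power_mult_distrib)
      have "(2 ^ n * norm (D n x))\<^sup>2 < 1"
        using elim by (simp add: power_mult_distrib two)
      then have "2 ^ n * norm (D n x) < 1" by (simp add: power2_less_1_iff abs_less_iff)
      then show ?case by (simp add: field_simps)
    qed
    then have "summable (\<lambda>n. D n x)"
      by (rule summable_comparison_test_ev) (auto intro: summable_geometric)
    then have "convergent (\<lambda>n. \<Sum>i<n. X (r (Suc i)) x - X (r i) x)"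
      by (simp add: summable_iff_convergent D_def)
    then have "convergent (\<lambda>n. X (r n) x - X (r 0) x)" by (simp only: sum_lessThan_telescope[of "\<lambda>n. X (r n) x"])
    then have "convergent (\<lambda>n. (X (r n) x - X (r 0) x) + X (r 0) x)"
      by (intro convergent_add convergent_const)
    then show ?case by simp
  qed
  define u where "u x = lim (\<lambda>n. X (r n) x)" for x
  have [measurable]: "u \<in> borel_measurable M" unfolding u_def by (rule borel_measurable_lim_metric) measurable
  have lim: "AE x in M. (\<lambda>n. X (r n) x) \<longlonglongrightarrow> u x"
    using conv by eventually_elim (simp add: u_def convergent_LIMSEQ_iff)
  \<comment> \<open>Fatou is applied in the index of the subsequence only, so the estimate holds for
    every late member of the full sequence.\<close>
  have bound: "\<exists>N. \<forall>m\<ge>N. (\<integral>\<^sup>+x. ennreal ((norm (X m x - u x))\<^sup>2) \<partial>M) \<le> ennreal e" if e: "e > 0" for e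
  proof -
    obtain K where K: "\<And>m n. m \<ge> K \<Longrightarrow> n \<ge> K \<Longrightarrow> (LINT x|M. (norm (X m x - X n x))\<^sup>2) < e"
      using Cauchy[OF e] by blast
    have "(\<integral>\<^sup>+x. ennreal ((norm (X m x - u x))\<^sup>2) \<partial>M) \<le> ennreal e" if m: "m \<ge> K" for m
    proof -
      have "(\<integral>\<^sup>+x. ennreal ((norm (X m x - u x))\<^sup>2) \<partial>M) =
          (\<integral>\<^sup>+x. liminf (\<lambda>n. ennreal ((norm (X m x - X (r n) x))\<^sup>2)) \<partial>M)"
      proof (rule nn_integral_cong_AE)
        show "AE x in M. ennreal ((norm (X m x - u x))\<^sup>2) =
            liminf (\<lambda>n. ennreal ((norm (X m x - X (r n) x))\<^sup>2))"
          using lim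
        proof eventually_elim
          case (elim x)
          have "(\<lambda>n. ennreal ((norm (X m x - X (r n) x))\<^sup>2)) \<longlonglongrightarrow> ennreal ((norm (X m x - u x))\<^sup>2)"
            by (intro tendsto_ennrealI tendsto_intros elim)
          from lim_imp_Liminf[OF _ this] show ?case by simp
        qed
      qed
      also have "\<dots> \<le> liminf (\<lambda>n. \<integral>\<^sup>+x. ennreal ((norm (X m x - X (r n) x))\<^sup>2) \<partial>M)"
        by (rule nn_integral_liminf) measurable
      also have "\<dots> \<le> ennreal e"
      proof (rule Liminf_le)
        have "(\<integral>\<^sup>+x. ennreal ((norm (X m x - X (r n) x))\<^sup>2) \<partial>M) \<le> ennreal e" if "n \<ge> K" for n
        proof -
          have "(\<integral>\<^sup>+x. ennreal ((norm (X m x - X (r n) x))\<^sup>2) \<partial>M) =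
              ennreal (LINT x|M. (norm (X m x - X (r n) x))\<^sup>2)"
            by (rule nn_integral_eq_integral) (auto simp: int_diff)
          then show ?thesis using K[OF m, of "r n"] r(1)[of n] that by (simp add: ennreal_leI less_imp_le)
        qed
        then show "\<forall>\<^sub>F n in sequentially. (\<integral>\<^sup>+x. ennreal ((norm (X m x - X (r n) x))\<^sup>2) \<partial>M) \<le> ennreal e"
          by (auto simp: eventually_sequentially)
      qed simp
      finally show ?thesis .
    qed
    then show ?thesis by blast
  qed
  obtain K where K: "\<And>m. m \<ge> K \<Longrightarrow> (\<integral>\<^sup>+x. ennreal ((norm (X m x - u x))\<^sup>2) \<partial>M) \<le> ennreal 1"
    using bound[of 1] by auto
  have int_u: "integrable M (\<lambda>x. (norm (X m x - u x))\<^sup>2)" if "m \<ge> K" for m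
    using K[OF that] by (intro integrableI_bounded) (auto intro: le_less_trans)
  have "integrable M (\<lambda>x. (norm (X K x + - (X K x - u x)))\<^sup>2)"
    using int int_u[of K] by (intro square_integrable_add) (auto simp: norm_minus_commute)
  then have u2: "integrable M (\<lambda>x. (norm (u x))\<^sup>2)" by simp
  have "(\<lambda>n. LINT x|M. (norm (X n x - u x))\<^sup>2) \<longlonglongrightarrow> 0"
  proof (rule LIMSEQ_I)
    fix e :: real assume "e > 0"
    then obtain K' where K': "\<And>m. m \<ge> K' \<Longrightarrow> (\<integral>\<^sup>+x. ennreal ((norm (X m x - u x))\<^sup>2) \<partial>M) \<le> ennreal (e / 2)"
      using bound[of "e / 2"] by auto
    have "(LINT x|M. (norm (X m x - u x))\<^sup>2) < e" if "m \<ge> max K K'" for m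
    proof -
      have "ennreal (LINT x|M. (norm (X m x - u x))\<^sup>2) \<le> ennreal (e / 2)"
        using K'[of m] int_u[of m] that by (subst nn_integral_eq_integral[symmetric]) auto
      then show ?thesis using \<open>e > 0\<close> by (simp add: ennreal_le_iff)
    qed
    then show "\<exists>no. \<forall>n\<ge>no. norm ((LINT x|M. (norm (X n x - u x))\<^sup>2) - 0) < e"
      by (intro exI[of _ "max K K'"]) (auto simp: integral_nonneg_AE)
  qed
  then show ?thesis using u2 by (intro bexI[of _ u]) auto
qed

section \<open>The space L^2 as a complete semi-inner product space\<close>

definition cscale :: "complex \<Rightarrow> ('a \<Rightarrow> complex) \<Rightarrow> 'a \<Rightarrow> complex" where
  "cscale c u = (\<lambda>x. c * u x)"

interpretation cscale: vector_space cscale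
  by unfold_locales (auto simp: cscale_def fun_eq_iff algebra_simps)

lemma cscale_apply [simp]: "cscale c u x = c * u x"
  by (simp add: cscale_def)

lemma L2_add:
  assumes "u \<in> L2_space \<Omega>" "v \<in> L2_space \<Omega>"
  shows "(\<lambda>x. u x + v x) \<in> L2_space \<Omega>"
  using assms by (auto simp: L2_space_def intro: square_integrable_add)

lemma L2_cmult: "u \<in> L2_space \<Omega> \<Longrightarrow> (\<lambda>x. c * u x) \<in> L2_space \<Omega>"
  by (auto simp: L2_space_def norm_mult power_mult_distrib)

lemma L2_zero: "(\<lambda>x. 0) \<in> L2_space \<Omega>"
  by (simp add: L2_space_def)

lemma L2_cnj: "u \<in> L2_space \<Omega> \<Longrightarrow> (\<lambda>x. cnj (u x)) \<in> L2_space \<Omega>"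
  unfolding L2_space_def
  by (auto intro!: borel_measurable_continuous_on[of cnj] continuous_intros)

lemma L2_diff: "u \<in> L2_space \<Omega> \<Longrightarrow> v \<in> L2_space \<Omega> \<Longrightarrow> (\<lambda>x. u x - v x) \<in> L2_space \<Omega>"
  using L2_add[of u \<Omega> "\<lambda>x. (-1) * v x"] L2_cmult[of v \<Omega> "-1"] by simp

lemma L2_mult_integrable:
  assumes "u \<in> L2_space \<Omega>" "v \<in> L2_space \<Omega>"
  shows "integrable (lebesgue_on \<Omega>) (\<lambda>x. u x * v x)"
proof (rule Bochner_Integration.integrable_bound)
  show "integrable (lebesgue_on \<Omega>) (\<lambda>x. (norm (u x))\<^sup>2 + (norm (v x))\<^sup>2)"
    using assms by (auto simp: L2_space_def)
  show "AE x in lebesgue_on \<Omega>. norm (u x * v x) \<le> norm ((norm (u x))\<^sup>2 + (norm (v x))\<^sup>2)"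
  proof (intro always_eventually allI)
    fix x
    have "2 * norm (u x) * norm (v x) \<le> (norm (u x))\<^sup>2 + (norm (v x))\<^sup>2" by (rule sum_squares_bound)
    moreover have "0 \<le> norm (u x) * norm (v x)" by simp
    ultimately have "norm (u x) * norm (v x) \<le> (norm (u x))\<^sup>2 + (norm (v x))\<^sup>2"
      unfolding mult.assoc by linarith
    then show "norm (u x * v x) \<le> norm ((norm (u x))\<^sup>2 + (norm (v x))\<^sup>2)"
      by (simp add: norm_mult)
  qed
qed (use assms in \<open>auto simp: L2_space_def\<close>)

lemma L2_inner_self: "L2_inner \<Omega> u u = of_real (LINT x|lebesgue_on \<Omega>. (norm (u x))\<^sup>2)"
  unfolding L2_inner_def complex_norm_square[symmetric] by (rule integral_complex_of_real)

interpretation L2: semi_inner cscale "L2_space \<Omega>" "L2_inner \<Omega>" for \<Omega> :: "'a::euclidean_space set"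
proof unfold_locales
  show "cscale.subspace (L2_space \<Omega>)"
    by (rule cscale.subspaceI) (auto simp: plus_fun_def zero_fun_def cscale_def L2_zero L2_add L2_cmult)
  note i = L2_mult_integrable[OF _ L2_cnj]
  show "L2_inner \<Omega> (u + v) w = L2_inner \<Omega> u w + L2_inner \<Omega> v w"
    if "u \<in> L2_space \<Omega>" "v \<in> L2_space \<Omega>" "w \<in> L2_space \<Omega>" for u v w
    using that by (simp add: L2_inner_def distrib_right i)
  show "L2_inner \<Omega> (cscale c u) v = c * L2_inner \<Omega> u v" for c u v
    by (simp add: L2_inner_def mult.assoc)
  show "L2_inner \<Omega> v u = cnj (L2_inner \<Omega> u v)" for u v
  proof -
    have "L2_inner \<Omega> v u = (LINT x|lebesgue_on \<Omega>. cnj (u x * cnj (v x)))"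
      by (simp add: L2_inner_def mult.commute)
    then show ?thesis by (simp only: Bochner_Integration.integral_cnj L2_inner_def)
  qed
  show "0 \<le> Re (L2_inner \<Omega> u u)" if "u \<in> L2_space \<Omega>" for u
    by (simp add: L2_inner_self integral_nonneg_AE)
qed

lemma L2_nsq: "L2.nsq \<Omega> u = (LINT x|lebesgue_on \<Omega>. (norm (u x))\<^sup>2)"
  by (simp add: L2.nsq_def L2_inner_self)

lemma L2_nrm: "L2.nrm \<Omega> u = L2_norm \<Omega> u"
  by (simp add: L2.nrm_def L2_nsq L2_norm_def)

lemma L2_nsq_eq_0_iff:
  "u \<in> L2_space \<Omega> \<Longrightarrow> L2.nsq \<Omega> u = 0 \<longleftrightarrow> (AE x in lebesgue_on \<Omega>. u x = 0)"
  unfolding L2_nsq by (subst integral_nonneg_eq_0_iff_AE) (auto simp: L2_space_def)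

lemma L2_complete:
  fixes X :: "nat \<Rightarrow> 'a::euclidean_space \<Rightarrow> complex"
  assumes X: "\<And>n. X n \<in> L2_space \<Omega>"
    and Cauchy: "\<And>e. e > 0 \<Longrightarrow> \<exists>N. \<forall>m\<ge>N. \<forall>n\<ge>N. L2.nrm \<Omega> (X m - X n) < e"
  shows "\<exists>u\<in>L2_space \<Omega>. (\<lambda>n. L2.nrm \<Omega> (X n - u)) \<longlonglongrightarrow> 0"
proof -
  have "\<exists>N. \<forall>m\<ge>N. \<forall>n\<ge>N. (LINT x|lebesgue_on \<Omega>. (norm (X m x - X n x))\<^sup>2) < e" if e: "e > 0" for e
  proof -
    obtain N where N: "\<And>m n. m \<ge> N \<Longrightarrow> n \<ge> N \<Longrightarrow> L2.nrm \<Omega> (X m - X n) < sqrt e"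
      using Cauchy[of "sqrt e"] e by auto
    then show ?thesis by (auto simp: L2.nrm_def L2_nsq)
  qed
  with square_integrable_complete[of X "lebesgue_on \<Omega>"] X
  obtain u where u: "u \<in> borel_measurable (lebesgue_on \<Omega>)" "integrable (lebesgue_on \<Omega>) (\<lambda>x. (norm (u x))\<^sup>2)"
      "(\<lambda>n. LINT x|lebesgue_on \<Omega>. (norm (X n x - u x))\<^sup>2) \<longlonglongrightarrow> 0"
    unfolding L2_space_def by blast
  have "(\<lambda>n. L2.nrm \<Omega> (X n - u)) \<longlonglongrightarrow> sqrt 0"
    unfolding L2.nrm_def L2_nsq using u(3) by (intro tendsto_real_sqrt) simp
  then show ?thesis using u by (intro bexI[of _ u]) (auto simp: L2_space_def)
qed

section \<open>Integrals of continuous and smooth functions of compact support\<close>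

lemma smooth_complex_of_real: "smooth g \<Longrightarrow> smooth (\<lambda>x. complex_of_real (g x))"
  by (rule smooth_bounded_linear[OF bounded_linear_of_real])

lemma borel_lebesgue_on: "f \<in> borel_measurable borel \<Longrightarrow> f \<in> borel_measurable (lebesgue_on \<Omega>)"
  by (rule measurable_restrict_space1) (simp add: measurable_completion)

text \<open>The function spaces live over \<open>lebesgue_on\<close>, whereas slicing, translation
  and the fundamental theorem of calculus are carried out over \<open>lborel\<close>. For Borel
  functions vanishing off \<Omega> the two integrals agree.\<close>

lemma lebesgue_on_lborel:
  fixes f :: "'a::euclidean_space \<Rightarrow> 'b::{banach, second_countable_topology}"
  assumes \<Omega>: "open \<Omega>" and f: "f \<in> borel_measurable borel" and zero: "\<And>x. x \<notin> \<Omega> \<Longrightarrow> f x = 0"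
  shows "integrable (lebesgue_on \<Omega>) f \<longleftrightarrow> integrable lborel f"
    and "integral\<^sup>L (lebesgue_on \<Omega>) f = integral\<^sup>L lborel f"
proof -
  have s: "\<Omega> \<inter> space lebesgue \<in> sets lebesgue" using \<Omega> by simp
  have i: "(\<lambda>x. indicator \<Omega> x *\<^sub>R f x) = f" using zero by (auto simp: indicator_def fun_eq_iff)
  have "f \<in> borel_measurable lborel" using f by simp
  then show "integrable (lebesgue_on \<Omega>) f \<longleftrightarrow> integrable lborel f"
    "integral\<^sup>L (lebesgue_on \<Omega>) f = integral\<^sup>L lborel f"
    using integrable_restrict_space[OF s, of f] integral_restrict_space[OF s, of f]
    by (simp_all add: i integrable_completion integral_completion)
qed

lemma continuous_compact_support_integrable:
  fixes f :: "'a::euclidean_space \<Rightarrow> 'b::{banach, second_countable_topology}"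
  assumes f: "continuous_on UNIV f" and K: "compact K" and zero: "\<And>x. x \<notin> K \<Longrightarrow> f x = 0"
  shows "integrable lborel f"
proof -
  have "integrable lborel (\<lambda>x. indicator K x *\<^sub>R f x)"
    using borel_integrable_compact[OF K] continuous_on_subset[OF f] by auto
  moreover have "(\<lambda>x. indicator K x *\<^sub>R f x) = f" using zero by (auto simp: indicator_def fun_eq_iff)
  ultimately show ?thesis by simp
qed

lemma continuous_compact_support_bounded:
  fixes f :: "'a::euclidean_space \<Rightarrow> 'b::real_normed_vector"
  assumes f: "continuous_on UNIV f" and K: "compact K" and zero: "\<And>x. x \<notin> K \<Longrightarrow> f x = 0"
  obtains B where "B \<ge> 0" "\<And>x. norm (f x) \<le> B"
proof -
  have "bounded (f ` K)"
    by (intro compact_imp_bounded compact_continuous_image continuous_on_subset[OF f] K) auto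
  then obtain B where B: "\<And>x. x \<in> K \<Longrightarrow> norm (f x) \<le> B" by (auto simp: bounded_iff)
  have "norm (f x) \<le> \<bar>B\<bar>" for x using B[of x] zero[of x] by (cases "x \<in> K") auto
  then show ?thesis using that[of "\<bar>B\<bar>"] by auto
qed

text \<open>By translation invariance, difference quotients of \<open>F\<close> have integral zero.\<close>

lemma integral_derivative_zero:
  fixes F :: "'a::euclidean_space \<Rightarrow> complex"
  assumes F: "smooth F" and e: "e \<in> Basis" and K: "compact K" and zero: "\<And>x. x \<notin> K \<Longrightarrow> F x = 0"
  shows "(LINT x|lborel. frechet_derivative F (at x) e) = 0"
proof -
  let ?F' = "\<lambda>x. frechet_derivative F (at x) e"
  have cF: "continuous_on UNIV F" using smooth_imp_continuous[OF F] .
  have cF': "continuous_on UNIV ?F'" using smooth_imp_continuous[OF smooth_frechet[OF F e]] .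
  have [measurable]: "F \<in> borel_measurable borel" "?F' \<in> borel_measurable borel"
    using cF cF' by (auto intro: borel_measurable_continuous_onI)
  have zero': "?F' x = 0" if "x \<notin> K" for x
  proof -
    have "(F has_derivative (\<lambda>h. 0)) (at x)"
      by (rule has_derivative_transform_within_open[OF has_derivative_const[of 0], of "- K"])
         (use that K zero in \<open>auto intro: compact_imp_closed\<close>)
    then show ?thesis by (simp flip: frechet_derivative_at)
  qed
  obtain B where B: "B \<ge> 0" "\<And>x. norm (?F' x) \<le> B"
    using continuous_compact_support_bounded[OF cF' K zero'] by blast
  obtain R where R: "\<And>x. x \<in> K \<Longrightarrow> norm x \<le> R"
    using compact_imp_bounded[OF K] by (auto simp: bounded_iff)
  have intF: "integrable lborel F" by (rule continuous_compact_support_integrable[OF cF K zero])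
  define Q where "Q n x = of_real (real (Suc n)) * (F (x + (1 / Suc n) *\<^sub>R e) - F x)" for n x
  have line: "((\<lambda>t. F (x + t *\<^sub>R e)) has_vector_derivative ?F' (x + t *\<^sub>R e)) (at t within S)" for x t S
  proof -
    have "((\<lambda>t. F (x + t *\<^sub>R e)) has_derivative (\<lambda>h. frechet_derivative F (at (x + t *\<^sub>R e)) (h *\<^sub>R e))) (at t within S)"
      by (rule has_derivative_compose[OF _ smooth_has_derivative[OF F]]) (auto intro!: derivative_eq_intros)
    then show ?thesis
      using linear_scale[OF has_derivative_linear[OF smooth_has_derivative[OF F]]]
      by (simp add: has_vector_derivative_def)
  qed
  \<comment> \<open>The mean value inequality bounds all difference quotients at once and so
    provides the dominating function.\<close>
  have Q_le: "norm (Q n x) \<le> B" for n x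
  proof -
    have "norm (F (x + (1 / Suc n) *\<^sub>R e) - F (x + 0 *\<^sub>R e)) \<le> B * norm (1 / real (Suc n) - 0)"
    proof (rule differentiable_bound[where S = UNIV and f' = "\<lambda>t h. h *\<^sub>R ?F' (x + t *\<^sub>R e)"])
      show "((\<lambda>t. F (x + t *\<^sub>R e)) has_derivative (\<lambda>h. h *\<^sub>R ?F' (x + t *\<^sub>R e))) (at t within UNIV)" for t
        using line by (simp add: has_vector_derivative_def)
      show "onorm (\<lambda>h. h *\<^sub>R ?F' (x + t *\<^sub>R e)) \<le> B" for t :: real
        using B by (intro onorm_bound) (auto simp: mult.commute[of B] intro: mult_left_mono)
    qed auto
    moreover have "norm (Q n x) = Suc n * norm (F (x + (1 / Suc n) *\<^sub>R e) - F (x + 0 *\<^sub>R e))"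
      unfolding Q_def norm_mult norm_of_real by (simp del: of_nat_Suc)
    ultimately show ?thesis by (simp add: field_simps del: of_nat_Suc)
  qed
  \<comment> \<open>All shifts 1 / Suc n have length at most 1, so enlarging the radius by 1 catches
    every translated support.\<close>
  have Q_zero: "Q n x = 0" if "x \<notin> cball 0 (R + 1)" for n x
  proof -
    have "x \<notin> K" using R[of x] that by auto
    moreover have "x + (1 / Suc n) *\<^sub>R e \<notin> K"
    proof
      assume "x + (1 / Suc n) *\<^sub>R e \<in> K"
      from R[OF this] have "norm x \<le> R + norm ((1 / Suc n) *\<^sub>R e)"
        using norm_triangle_ineq4[of "x + (1 / Suc n) *\<^sub>R e" "(1 / Suc n) *\<^sub>R e"] by simp
      also have "norm ((1 / Suc n) *\<^sub>R e) \<le> 1" using e by simp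
      finally show False using that by simp
    qed
    ultimately show ?thesis using zero by (simp add: Q_def)
  qed
  have "(\<lambda>n. LINT x|lborel. Q n x) \<longlonglongrightarrow> (LINT x|lborel. ?F' x)"
  proof (rule integral_dominated_convergence)
    show "integrable lborel (\<lambda>x. B * indicator (cball 0 (R + 1)) x :: real)"
      by (intro integrable_mult_right integrable_real_indicator) (auto simp: emeasure_lborel_cball_finite[unfolded infinity_ennreal_def])
    show "AE x in lborel. norm (Q n x) \<le> B * indicator (cball 0 (R + 1)) x" for n
      using Q_le Q_zero by (intro always_eventually) (auto simp: indicator_def)
    show "AE x in lborel. (\<lambda>n. Q n x) \<longlonglongrightarrow> ?F' x"
    proof (intro always_eventually allI)
      fix x
      have "((\<lambda>t. F (x + t *\<^sub>R e)) has_derivative (\<lambda>h. h *\<^sub>R ?F' x)) (at 0)"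
        using line[of x 0 UNIV] by (simp add: has_vector_derivative_def)
      then have "((\<lambda>t. norm (F (x + t *\<^sub>R e) - F x - t *\<^sub>R ?F' x) / norm t) \<longlongrightarrow> 0) (at 0)"
        by (simp add: has_derivative_at)
      then have "((\<lambda>t. norm ((F (x + t *\<^sub>R e) - F x) /\<^sub>R t - ?F' x)) \<longlongrightarrow> 0) (at 0)"
      proof (rule Lim_transform_eventually)
        have "norm (F (x + t *\<^sub>R e) - F x - t *\<^sub>R ?F' x) / norm t = norm ((F (x + t *\<^sub>R e) - F x) /\<^sub>R t - ?F' x)"
          if "t \<noteq> 0" for t
        proof -
          have "(F (x + t *\<^sub>R e) - F x) /\<^sub>R t - ?F' x = (F (x + t *\<^sub>R e) - F x - t *\<^sub>R ?F' x) /\<^sub>R t"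
            using that by (simp add: algebra_simps)
          then show ?thesis by (simp only:) (simp add: divide_inverse mult.commute)
        qed
        then show "\<forall>\<^sub>F t in at 0. norm (F (x + t *\<^sub>R e) - F x - t *\<^sub>R ?F' x) / norm t =
            norm ((F (x + t *\<^sub>R e) - F x) /\<^sub>R t - ?F' x)"
          by (auto simp: eventually_at_filter)
      qed
      then have *: "((\<lambda>t. (F (x + t *\<^sub>R e) - F x) /\<^sub>R t) \<longlongrightarrow> ?F' x) (at 0)"
        by (rule LIM_zero_cancel[OF tendsto_norm_zero_cancel])
      have "filterlim (\<lambda>n. 1 / real (Suc n)) (at 0) sequentially"
        using LIMSEQ_Suc[OF lim_1_over_n] by (auto simp: filterlim_at)
      from filterlim_compose[OF * this] show "(\<lambda>n. Q n x) \<longlonglongrightarrow> ?F' x"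
        by (simp add: Q_def scaleR_conv_of_real del: of_nat_Suc)
    qed
  qed (auto simp: Q_def)
  moreover have "(LINT x|lborel. Q n x) = 0" for n
  proof -
    let ?c = "(1 / Suc n) *\<^sub>R e"
    have "integrable lborel (\<lambda>x. F (?c + x)) \<and> (LINT x|lborel. F (?c + x)) = (LINT x|lborel. F x)"
      using lborel_distr_plus[of ?c] intF integrable_distr_eq[of "\<lambda>x. ?c + x" lborel borel F]
        integral_distr[of "\<lambda>x. ?c + x" lborel borel F] by simp
    then show ?thesis using intF unfolding Q_def by (simp add: add.commute)
  qed
  ultimately show ?thesis by (simp add: LIMSEQ_const_iff)
qed

subsection \<open>Test functions and weak derivatives\<close>

lemma test_functionsI:
  assumes "smooth \<phi>" "compact K" "K \<subseteq> \<Omega>" "\<And>x. x \<notin> K \<Longrightarrow> \<phi> x = 0"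
  shows "\<phi> \<in> test_functions \<Omega>"
proof -
  have "closure {x. \<phi> x \<noteq> 0} \<subseteq> K"
    using assms by (intro closure_minimal compact_imp_closed) auto
  moreover from this have "compact (closure {x. \<phi> x \<noteq> 0})"
    using assms(2) compact_Int_closed[of K "closure {x. \<phi> x \<noteq> 0}"] by (simp add: inf.absorb2)
  ultimately show ?thesis using assms by (auto simp: test_functions_def)
qed

lemma test_functionsE:
  assumes "\<phi> \<in> test_functions \<Omega>"
  obtains K where "smooth \<phi>" "compact K" "K \<subseteq> \<Omega>" "\<And>x. x \<notin> K \<Longrightarrow> \<phi> x = 0"
proof
  show "\<phi> x = 0" if "x \<notin> closure {x. \<phi> x \<noteq> 0}" for x
    using that closure_subset[of "{x. \<phi> x \<noteq> 0}"] by auto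
qed (use assms in \<open>auto simp: test_functions_def\<close>)

lemma test_smooth: "\<phi> \<in> test_functions \<Omega> \<Longrightarrow> smooth \<phi>"
  by (simp add: test_functions_def)

lemma test_zero: "\<phi> \<in> test_functions \<Omega> \<Longrightarrow> x \<notin> \<Omega> \<Longrightarrow> \<phi> x = 0"
  by (meson test_functionsE subsetD)

lemma test_continuous: "\<phi> \<in> test_functions \<Omega> \<Longrightarrow> continuous_on A \<phi>"
  by (rule smooth_imp_continuous[OF test_smooth])

lemma test_add:
  assumes "\<phi> \<in> test_functions \<Omega>" "\<psi> \<in> test_functions \<Omega>"
  shows "(\<lambda>x. \<phi> x + \<psi> x) \<in> test_functions \<Omega>"
proof -
  obtain K where K: "smooth \<phi>" "compact K" "K \<subseteq> \<Omega>" "\<And>x. x \<notin> K \<Longrightarrow> \<phi> x = 0"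
    using test_functionsE[OF assms(1)] by blast
  obtain L where L: "smooth \<psi>" "compact L" "L \<subseteq> \<Omega>" "\<And>x. x \<notin> L \<Longrightarrow> \<psi> x = 0"
    using test_functionsE[OF assms(2)] by blast
  show ?thesis
    using K L by (intro test_functionsI[of _ "K \<union> L"] smooth_add) auto
qed

lemma test_mult:
  assumes "\<phi> \<in> test_functions \<Omega>" "smooth \<psi>"
  shows "(\<lambda>x. \<phi> x * \<psi> x) \<in> test_functions \<Omega>"
proof -
  obtain K where K: "smooth \<phi>" "compact K" "K \<subseteq> \<Omega>" "\<And>x. x \<notin> K \<Longrightarrow> \<phi> x = 0"
    using test_functionsE[OF assms(1)] by blast
  then show ?thesis using assms(2) by (intro test_functionsI[of _ K] smooth_mult) auto
qed

lemma test_cmult: "\<phi> \<in> test_functions \<Omega> \<Longrightarrow> (\<lambda>x. c * \<phi> x) \<in> test_functions \<Omega>"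
  using test_mult[of \<phi> \<Omega> "\<lambda>x. c"] by (simp add: mult.commute)

lemma test_partial:
  assumes "\<phi> \<in> test_functions \<Omega>" "e \<in> Basis"
  shows "(\<lambda>x. frechet_derivative \<phi> (at x) e) \<in> test_functions \<Omega>"
proof -
  obtain K where K: "smooth \<phi>" "compact K" "K \<subseteq> \<Omega>" "\<And>x. x \<notin> K \<Longrightarrow> \<phi> x = 0"
    using test_functionsE[OF assms(1)] by blast
  have "frechet_derivative \<phi> (at x) e = 0" if "x \<notin> K" for x
  proof -
    have "(\<phi> has_derivative (\<lambda>h. 0)) (at x)"
      by (rule has_derivative_transform_within_open[OF has_derivative_const[of 0], of "- K"])
         (use that K in \<open>auto intro: compact_imp_closed\<close>)
    then show ?thesis by (simp flip: frechet_derivative_at)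
  qed
  then show ?thesis using K assms(2) by (intro test_functionsI[of _ K] smooth_frechet) auto
qed

lemma test_integrable:
  assumes "\<phi> \<in> test_functions \<Omega>"
  shows "integrable lborel \<phi>"
proof -
  obtain K where K: "compact K" "\<And>x. x \<notin> K \<Longrightarrow> \<phi> x = 0"
    using test_functionsE[OF assms] by metis
  show ?thesis by (rule continuous_compact_support_integrable[OF test_continuous[OF assms] K])
qed

lemma test_borel [measurable]: "\<phi> \<in> test_functions \<Omega> \<Longrightarrow> \<phi> \<in> borel_measurable borel"
  by (intro borel_measurable_continuous_onI test_continuous)

lemma test_norm_sq_integrable:
  assumes "\<phi> \<in> test_functions \<Omega>"
  shows "integrable lborel (\<lambda>x. (norm (\<phi> x))\<^sup>2)"
proof -
  obtain K where K: "compact K" "\<And>x. x \<notin> K \<Longrightarrow> \<phi> x = 0"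
    using test_functionsE[OF assms] by metis
  show ?thesis
    by (rule continuous_compact_support_integrable[OF _ K(1)])
       (use K test_continuous[OF assms] in \<open>auto intro!: continuous_intros\<close>)
qed

lemma test_integral_eq:
  assumes "open \<Omega>" "\<phi> \<in> test_functions \<Omega>"
  shows "integral\<^sup>L (lebesgue_on \<Omega>) \<phi> = integral\<^sup>L lborel \<phi>"
    and "(LINT x|lebesgue_on \<Omega>. (norm (\<phi> x))\<^sup>2) = (LINT x|lborel. (norm (\<phi> x))\<^sup>2)"
  using assms(2) test_zero[OF assms(2)]
  by (auto intro!: lebesgue_on_lborel(2)[OF assms(1)] test_borel)

lemma test_L2:
  assumes "open \<Omega>" "\<phi> \<in> test_functions \<Omega>"
  shows "\<phi> \<in> L2_space \<Omega>"
proof -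
  have "(\<lambda>x. (norm (\<phi> x))\<^sup>2) \<in> borel_measurable borel" using test_borel[OF assms(2)] by measurable
  then have "integrable (lebesgue_on \<Omega>) (\<lambda>x. (norm (\<phi> x))\<^sup>2)"
    using lebesgue_on_lborel(1)[OF assms(1), of "\<lambda>x. (norm (\<phi> x))\<^sup>2"] test_zero[OF assms(2)]
      test_norm_sq_integrable[OF assms(2)] by simp
  then show ?thesis using borel_lebesgue_on[OF test_borel[OF assms(2)]] by (simp add: L2_space_def)
qed

text \<open>Integration by parts: the product of two test functions has compact support, so the
  integral of its derivative vanishes by \<open>integral_derivative_zero\<close>.\<close>

lemma has_weak_partial_test:
  assumes \<Omega>: "open \<Omega>" and \<psi>: "\<psi> \<in> test_functions \<Omega>" and e: "e \<in> Basis"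
  shows "has_weak_partial \<Omega> e \<psi> (\<lambda>x. frechet_derivative \<psi> (at x) e)"
  unfolding has_weak_partial_def
proof (intro conjI ballI)
  let ?D = "\<lambda>f x. frechet_derivative f (at x) e"
  show "?D \<psi> \<in> L2_space \<Omega>" by (rule test_L2[OF \<Omega> test_partial[OF \<psi> e]])
  fix \<phi> assume \<phi>: "\<phi> \<in> test_functions \<Omega>"
  have 1: "(\<lambda>x. \<psi> x * ?D \<phi> x) \<in> test_functions \<Omega>" "(\<lambda>x. ?D \<psi> x * \<phi> x) \<in> test_functions \<Omega>"
    using test_mult[OF \<psi> smooth_frechet[OF test_smooth[OF \<phi>] e]]
      test_mult[OF test_partial[OF \<psi> e] test_smooth[OF \<phi>]] by auto
  have "?D (\<lambda>x. \<psi> x * \<phi> x) = (\<lambda>x. \<psi> x * ?D \<phi> x + ?D \<psi> x * \<phi> x)"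
    using frechet_derivative_at[OF has_derivative_mult[OF smooth_has_derivative[OF test_smooth[OF \<psi>]]
        smooth_has_derivative[OF test_smooth[OF \<phi>]]], symmetric] by simp
  moreover obtain K where "compact K" "\<And>x. x \<notin> K \<Longrightarrow> \<psi> x * \<phi> x = 0"
    using test_functionsE[OF test_mult[OF \<psi> test_smooth[OF \<phi>]]] by metis
  then have "(LINT x|lborel. ?D (\<lambda>x. \<psi> x * \<phi> x) x) = 0"
    using e \<psi> \<phi> by (intro integral_derivative_zero smooth_mult test_smooth) auto
  ultimately have "(LINT x|lborel. \<psi> x * ?D \<phi> x) + (LINT x|lborel. ?D \<psi> x * \<phi> x) = 0"
    using test_integrable[OF 1(1)] test_integrable[OF 1(2)] by simp
  then show "(LINT x|lebesgue_on \<Omega>. \<psi> x * ?D \<phi> x) = - (LINT x|lebesgue_on \<Omega>. ?D \<psi> x * \<phi> x)"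
    using test_integral_eq(1)[OF \<Omega> 1(1)] test_integral_eq(1)[OF \<Omega> 1(2)] by (simp add: add_eq_0_iff2)
qed

section \<open>The fundamental lemma of the calculus of variations\<close>

lemma sigma_finite_lebesgue: "sigma_finite_measure (lebesgue :: 'a::euclidean_space measure)"
proof
  obtain A :: "'a set set" where A: "countable A" "A \<subseteq> sets lborel" "\<Union>A = space lborel"
      "\<And>a. a \<in> A \<Longrightarrow> emeasure lborel a \<noteq> \<infinity>"
    using lborel.sigma_finite_countable by metis
  then show "\<exists>A. countable A \<and> A \<subseteq> sets (lebesgue :: 'a measure) \<and> \<Union>A = space lebesgue \<and>
      (\<forall>a\<in>A. emeasure lebesgue a \<noteq> \<infinity>)"
    by (intro exI[of _ A]) auto
qed

text \<open>Boxes are stable under intersection and generate the Borel sets, so a Dynkin argument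
  extends the vanishing integrals to Borel sets; Lebesgue sets differ from these by null sets. An
  integrable function with all these integrals zero vanishes almost everywhere.\<close>

lemma AE_zero_if_box_integrals_zero:
  fixes f :: "'a::euclidean_space \<Rightarrow> complex"
  assumes f: "integrable lebesgue f"
    and box0: "\<And>a b. set_lebesgue_integral lebesgue (box a b) f = 0"
  shows "AE x in lebesgue. f x = 0"
proof (rule sigma_finite_measure.density_zero[OF sigma_finite_lebesgue f])
  have si: "set_integrable lebesgue A f" if "A \<in> sets lebesgue" for A
    unfolding set_integrable_def using f that by (rule integrable_mult_indicator[rotated])
  \<comment> \<open>The complement step of the Dynkin argument needs the integral over the whole
    space, here the limit over growing boxes.\<close>
  have total: "(LINT x|lebesgue. f x) = 0"
  proof -
    define B where "B n = box (- real n *\<^sub>R One) (real n *\<^sub>R One :: 'a)" for n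
    have "(\<lambda>n. LINT x|lebesgue. indicator (B n) x *\<^sub>R f x) \<longlonglongrightarrow> (LINT x|lebesgue. f x)"
    proof (rule integral_dominated_convergence[where w = "\<lambda>x. norm (f x)"])
      show "AE x in lebesgue. (\<lambda>n. indicator (B n) x *\<^sub>R f x) \<longlonglongrightarrow> f x"
      proof (intro always_eventually allI)
        fix x :: 'a
        obtain N :: nat where N: "norm x < N" using reals_Archimedean2 by blast
        have "x \<in> B n" if "n \<ge> N" for n
        proof -
          have "\<bar>x \<bullet> i\<bar> < real n" if "i \<in> Basis" for i
            using Basis_le_norm[OF that, of x] N \<open>n \<ge> N\<close> by linarith
          then show ?thesis by (force simp: B_def mem_box abs_less_iff)
        qed
        then have "\<forall>\<^sub>F n in sequentially. indicator (B n) x *\<^sub>R f x = f x"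
          by (auto simp: eventually_sequentially intro!: exI[of _ N])
        then show "(\<lambda>n. indicator (B n) x *\<^sub>R f x) \<longlonglongrightarrow> f x"
          by (rule tendsto_eventually)
      qed
      show "(\<lambda>x. indicator (B n) x *\<^sub>R f x) \<in> borel_measurable lebesgue" for n
        by (intro borel_measurable_scaleR borel_measurable_indicator borel_measurable_integrable[OF f])
           (simp add: B_def)
    qed (use f in \<open>auto simp: indicator_def\<close>)
    moreover have "(LINT x|lebesgue. indicator (B n) x *\<^sub>R f x) = 0" for n
      using box0 unfolding B_def set_lebesgue_integral_def by blast
    ultimately show ?thesis by (simp add: LIMSEQ_const_iff)
  qed
  have borel0: "set_lebesgue_integral lebesgue A f = 0" if "A \<in> sets borel" for A
  proof -
    let ?G = "range (\<lambda>(a, b). box a b :: 'a set)"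
    have A: "A \<in> sigma_sets UNIV ?G" using that by (subst (asm) borel_eq_box) simp
    have "Int_stable ?G" by (auto simp: Int_stable_def box_Int_box)
    moreover have "?G \<subseteq> Pow UNIV" by simp
    ultimately show ?thesis using A
    proof (induction rule: sigma_sets_induct_disjoint)
      case (compl A)
      then have A: "A \<in> sets borel" by (simp add: borel_eq_box)
      then have L: "A \<in> sets lebesgue" by simp
      have "(LINT x:UNIV|lebesgue. f x) = (LINT x:A|lebesgue. f x) + (LINT x:UNIV - A|lebesgue. f x)"
        using si[OF L] si[of "UNIV - A"] sets.compl_sets[OF L] by (subst set_integral_Un[symmetric]) (auto simp: Un_Diff_cancel)
      then show ?case using compl.IH total by (simp add: set_lebesgue_integral_def)
    next
      case (union A)
      then have A: "A i \<in> sets borel" for i by (auto simp: borel_eq_box)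
      then have L: "A i \<in> sets lebesgue" for i by simp
      have "(LINT x:(\<Union>i. A i)|lebesgue. f x) = (\<Sum>i. (LINT x:(A i)|lebesgue. f x))"
        using union.hyps(1) L
        by (intro lebesgue_integral_countable_add si) (auto simp: disjoint_family_on_def)
      then show ?case using union.IH by simp
    qed (use box0 in \<open>auto simp: set_lebesgue_integral_def\<close>)
  qed
  fix A :: "'a set" assume A: "A \<in> sets lebesgue"
  then obtain S N N' where S: "A = S \<union> N" "N \<subseteq> N'" "N' \<in> null_sets lborel" "S \<in> sets lborel"
    by (rule sets_completionE)
  have "AE x in lebesgue. x \<notin> N'" using S(3) by (intro AE_completion AE_not_in)
  then have "set_lebesgue_integral lebesgue A f = set_lebesgue_integral lebesgue S f"
    unfolding set_lebesgue_integral_def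
  proof (intro integral_cong_AE borel_measurable_scaleR borel_measurable_indicator borel_measurable_integrable[OF f])
    show "AE x in lebesgue. x \<notin> N' \<Longrightarrow>
        AE x in lebesgue. indicator A x *\<^sub>R f x = indicator S x *\<^sub>R f x"
      by (erule eventually_mono) (use S in \<open>auto simp: indicator_def\<close>)
  qed (use A S in auto)
  then show "set_lebesgue_integral lebesgue A f = 0" using borel0[of S] S(4) by simp
qed

text \<open>One flat factor for each face of the box; as n grows, the product tends boundedly to the
  indicator of the open box.\<close>

definition box_bump :: "'a::euclidean_space \<Rightarrow> 'a \<Rightarrow> nat \<Rightarrow> 'a \<Rightarrow> real" where
  "box_bump a b n x = (\<Prod>i\<in>Basis. flat (real n * (x \<bullet> i - a \<bullet> i)) * flat (real n * (b \<bullet> i - x \<bullet> i)))"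

lemma smooth_box_bump: "smooth (box_bump a b n)"
  unfolding box_bump_def[abs_def]
  by (intro smooth_prod smooth_mult smooth_compose[OF smooth_flat] smooth_const smooth_diff
        smooth_linear bounded_linear_inner_left)

lemma box_bump_bounds: "0 \<le> box_bump a b n x" "box_bump a b n x \<le> 1"
  unfolding box_bump_def
  by (auto intro!: prod_nonneg prod_le_1 mult_nonneg_nonneg mult_le_one simp: flat_bounds)

lemma box_bump_zero: "x \<notin> box a b \<Longrightarrow> box_bump a b n x = 0"
  unfolding box_bump_def mem_box
  by (rule prod_zero) (auto simp: flat_bounds not_less intro!: mult_nonneg_nonpos)

lemma flat_tendsto_1: "s > 0 \<Longrightarrow> (\<lambda>n. flat (real n * s)) \<longlonglongrightarrow> 1"
proof -
  assume s: "s > 0"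
  have "(\<lambda>n. exp (- (1 / s) * (1 / real n))) \<longlonglongrightarrow> exp (- (1 / s) * 0)"
    by (intro tendsto_intros lim_1_over_n)
  then have "(\<lambda>n. exp (- (1 / s) * (1 / real n))) \<longlonglongrightarrow> 1" by simp
  then show ?thesis
    by (rule Lim_transform_eventually)
       (use s in \<open>auto simp: flat_def eventually_sequentially field_simps intro!: exI[of _ 1]\<close>)
qed

lemma box_bump_tendsto: "(\<lambda>n. box_bump a b n x) \<longlonglongrightarrow> indicator (box a b) x"
proof (cases "x \<in> box a b")
  case True
  have "(\<lambda>n. box_bump a b n x) \<longlonglongrightarrow> (\<Prod>i\<in>(Basis::'a set). 1 * 1)"
    unfolding box_bump_def using True
    by (intro tendsto_intros flat_tendsto_1) (auto simp: mem_box)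
  then show ?thesis using True by simp
qed (simp add: box_bump_zero)

lemma box_bump_test:
  assumes "cbox a b \<subseteq> \<Omega>"
  shows "(\<lambda>x. complex_of_real (box_bump a b n x)) \<in> test_functions \<Omega>"
  using assms box_subset_cbox[of a b]
  by (intro test_functionsI[of _ "cbox a b"] smooth_complex_of_real smooth_box_bump)
     (auto intro: box_bump_zero)

text \<open>Bumps converging to indicators turn the hypothesis into vanishing integrals over boxes.
  Since g is controlled only inside \<Omega>, this is done on each closed box contained in \<Omega>,
  and countably many of them exhaust \<Omega>.\<close>

theorem fundamental_lemma:
  assumes \<Omega>: "open \<Omega>" and g: "g \<in> L2_space \<Omega>"
    and zero: "\<And>\<phi>. \<phi> \<in> test_functions \<Omega> \<Longrightarrow> (LINT x|lebesgue_on \<Omega>. g x * \<phi> x) = 0"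
  shows "AE x in lebesgue_on \<Omega>. g x = 0"
proof -
  have s: "\<Omega> \<inter> space lebesgue \<in> sets lebesgue" using \<Omega> by simp
  have intg: "integrable lebesgue (\<lambda>x. indicator (cbox a b) x *\<^sub>R g x)" if "cbox a b \<subseteq> \<Omega>" for a b
  proof -
    have "(\<lambda>x. complex_of_real (indicator (cbox a b) x)) \<in> L2_space \<Omega>"
    proof -
      have m: "(\<lambda>x. complex_of_real (indicator (cbox a b) x)) \<in> borel_measurable (lebesgue_on \<Omega>)"
        by (intro borel_lebesgue_on) measurable
      have "integrable lborel (\<lambda>x. indicator (cbox a b) x :: real)"
        by (intro integrable_real_indicator) (auto simp: emeasure_lborel_cbox_finite[unfolded infinity_ennreal_def])
      moreover have "(norm (complex_of_real (indicator (cbox a b) x)))\<^sup>2 = (indicator (cbox a b) x :: real)" for x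
        by (simp add: indicator_def)
      ultimately show ?thesis
        using m that lebesgue_on_lborel(1)[OF \<Omega>, of "\<lambda>x. indicator (cbox a b) x :: real"]
        by (auto simp: L2_space_def indicator_def)
    qed
    then have "integrable (lebesgue_on \<Omega>) (\<lambda>x. complex_of_real (indicator (cbox a b) x) * g x)"
      using g by (rule L2_mult_integrable)
    then have "integrable lebesgue (\<lambda>x. indicator \<Omega> x *\<^sub>R (complex_of_real (indicator (cbox a b) x) * g x))"
      by (simp add: integrable_restrict_space[OF s])
    moreover have "indicator \<Omega> x *\<^sub>R (complex_of_real (indicator (cbox a b) x) * g x) = indicator (cbox a b) x *\<^sub>R g x" for x
      using that by (auto simp: indicator_def)
    ultimately show ?thesis by simp
  qed
  have box0: "(LINT x|lebesgue. indicator (box a b) x *\<^sub>R g x) = 0" if ab: "cbox a b \<subseteq> \<Omega>" for a b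
  proof -
    let ?w = "\<lambda>n x. box_bump a b n x *\<^sub>R (indicator (cbox a b) x *\<^sub>R g x)"
    have ind: "box_bump a b n x *\<^sub>R indicator (cbox a b) x *\<^sub>R g x = box_bump a b n x *\<^sub>R g x" for n x
      using box_bump_zero[of x a b n] box_subset_cbox[of a b] by (auto simp: indicator_def)
    have [measurable]: "box_bump a b n \<in> borel_measurable lebesgue" for n
      using borel_measurable_continuous_onI[OF smooth_imp_continuous[OF smooth_box_bump]]
      by (intro measurable_completion) simp
    define G where "G x = indicator (cbox a b) x *\<^sub>R g x" for x
    have G: "integrable lebesgue G" using intg[OF ab] by (simp add: G_def[abs_def])
    have "(\<lambda>n. LINT x|lebesgue. box_bump a b n x *\<^sub>R G x) \<longlonglongrightarrow> (LINT x|lebesgue. indicator (box a b) x *\<^sub>R G x)"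
    proof (rule integral_dominated_convergence[where w = "\<lambda>x. norm (G x)"])
      show "AE x in lebesgue. (\<lambda>n. box_bump a b n x *\<^sub>R G x) \<longlonglongrightarrow> indicator (box a b) x *\<^sub>R G x"
        by (intro always_eventually allI tendsto_intros box_bump_tendsto)
      show "AE x in lebesgue. norm (box_bump a b n x *\<^sub>R G x) \<le> norm (G x)" for n
        using box_bump_bounds[of a b n]
        by (intro always_eventually allI) (simp add: mult_left_le_one_le)
      show "(\<lambda>x. indicator (box a b) x *\<^sub>R G x) \<in> borel_measurable lebesgue"
        by (intro borel_measurable_scaleR borel_measurable_indicator borel_measurable_integrable[OF G]) auto
      show "(\<lambda>x. box_bump a b n x *\<^sub>R G x) \<in> borel_measurable lebesgue" for n
        by (intro borel_measurable_scaleR borel_measurable_integrable[OF G]) auto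
      show "integrable lebesgue (\<lambda>x. norm (G x))" using G by simp
    qed
    then have "(\<lambda>n. LINT x|lebesgue. ?w n x) \<longlonglongrightarrow> (LINT x|lebesgue. indicator (box a b) x *\<^sub>R (indicator (cbox a b) x *\<^sub>R g x))"
      by (simp only: G_def)
    moreover have "(LINT x|lebesgue. ?w n x) = 0" for n
    proof -
      have "(LINT x|lebesgue. ?w n x) = (LINT x|lebesgue. indicator \<Omega> x *\<^sub>R (g x * complex_of_real (box_bump a b n x)))"
        unfolding ind using box_bump_zero[of _ a b n] box_subset_cbox[of a b] ab
        by (intro Bochner_Integration.integral_cong) (auto simp: indicator_def scaleR_conv_of_real mult.commute)
      also have "\<dots> = (LINT x|lebesgue_on \<Omega>. g x * complex_of_real (box_bump a b n x))"
        by (simp add: integral_restrict_space[OF s])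
      also have "\<dots> = 0" by (rule zero[OF box_bump_test[OF ab]])
      finally show ?thesis .
    qed
    ultimately have "(LINT x|lebesgue. indicator (box a b) x *\<^sub>R (indicator (cbox a b) x *\<^sub>R g x)) = 0"
      by (simp add: LIMSEQ_const_iff)
    moreover have "indicator (box a b) x *\<^sub>R (indicator (cbox a b) x *\<^sub>R g x) = indicator (box a b) x *\<^sub>R g x" for x
      using box_subset_cbox[of a b] by (auto simp: indicator_def)
    ultimately show ?thesis by (simp only:)
  qed
  have cbox_zero: "AE x in lebesgue. indicator (cbox p q) x *\<^sub>R g x = 0" if pq: "cbox p q \<subseteq> \<Omega>" for p q
  proof (rule AE_zero_if_box_integrals_zero[OF intg[OF pq]])
    fix a b
    \<comment> \<open>The faces are a null set. Dropping them makes the domain an intersection of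
      open boxes, again an open box, whose closure stays inside \<Omega> if it is nonempty.\<close>
    have "AE x in lebesgue. x \<notin> cbox p q - box p q"
      using negligible_frontier_interval[of p q] by (intro AE_not_in) (simp add: negligible_iff_null_sets)
    then have "set_lebesgue_integral lebesgue (box a b) (\<lambda>x. indicator (cbox p q) x *\<^sub>R g x) =
        (LINT x|lebesgue. indicator (box a b \<inter> box p q) x *\<^sub>R (indicator (cbox p q) x *\<^sub>R g x))"
      unfolding set_lebesgue_integral_def
    proof (intro integral_cong_AE)
      show "AE x in lebesgue. x \<notin> cbox p q - box p q \<Longrightarrow>
          AE x in lebesgue. indicator (box a b) x *\<^sub>R indicator (cbox p q) x *\<^sub>R g x =
            indicator (box a b \<inter> box p q) x *\<^sub>R indicator (cbox p q) x *\<^sub>R g x"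
        by (erule eventually_mono) (auto simp: indicator_def)
      show "(\<lambda>x. indicator (box a b) x *\<^sub>R indicator (cbox p q) x *\<^sub>R g x) \<in> borel_measurable lebesgue"
        by (intro borel_measurable_scaleR[OF _ borel_measurable_integrable[OF intg[OF pq]]]
            borel_measurable_indicator) auto
      show "(\<lambda>x. indicator (box a b \<inter> box p q) x *\<^sub>R indicator (cbox p q) x *\<^sub>R g x) \<in> borel_measurable lebesgue"
        by (intro borel_measurable_scaleR[OF _ borel_measurable_integrable[OF intg[OF pq]]]
            borel_measurable_indicator) auto
    qed
    also have "\<dots> = (LINT x|lebesgue. indicator (box a b \<inter> box p q) x *\<^sub>R g x)"
      using box_subset_cbox[of p q] by (intro Bochner_Integration.integral_cong) (auto simp: indicator_def)
    also have "\<dots> = 0"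
    proof (cases "box a b \<inter> box p q = {}")
      case False
      obtain c d where cd: "box a b \<inter> box p q = box c d" using box_Int_box by blast
      then have "closure (box c d) \<subseteq> closure (box p q)" by (intro closure_mono) auto
      also have "\<dots> \<subseteq> cbox p q" by (intro closure_minimal box_subset_cbox) auto
      finally have "cbox c d \<subseteq> \<Omega>" using False cd closure_box[of c d] pq by auto
      then show ?thesis using box0 cd by simp
    qed simp
    finally show "set_lebesgue_integral lebesgue (box a b) (\<lambda>x. indicator (cbox p q) x *\<^sub>R g x) = 0" .
  qed
  obtain \<D> where D: "countable \<D>" "\<D> \<subseteq> Pow \<Omega>" "\<And>X. X \<in> \<D> \<Longrightarrow> \<exists>a b. X = cbox a b" "\<Union>\<D> = \<Omega>"
    using open_countable_Union_open_cbox[OF \<Omega>] by metis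
  have "AE x in lebesgue. \<forall>X\<in>\<D>. indicator X x *\<^sub>R g x = 0"
    using D(2,3) cbox_zero by (subst AE_ball_countable[OF D(1)]) blast
  then have "AE x in lebesgue. x \<in> \<Omega> \<longrightarrow> g x = 0"
    by eventually_elim (use D(4) in \<open>auto simp: indicator_def\<close>)
  then show ?thesis by (simp add: AE_restrict_space_iff[OF s])
qed

subsection \<open>Sobolev spaces and the Dirichlet form\<close>

lemma has_weak_partial_unique:
  assumes "open \<Omega>" "has_weak_partial \<Omega> e u g" "has_weak_partial \<Omega> e u g'"
  shows "AE x in lebesgue_on \<Omega>. g x = g' x"
proof -
  have g: "g \<in> L2_space \<Omega>" "g' \<in> L2_space \<Omega>" using assms by (auto simp: has_weak_partial_def)
  have "AE x in lebesgue_on \<Omega>. g x - g' x = 0"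
  proof (rule fundamental_lemma[OF assms(1) L2_diff[OF g]])
    fix \<phi> assume \<phi>: "\<phi> \<in> test_functions \<Omega>"
    have "(LINT x|lebesgue_on \<Omega>. g x * \<phi> x) = (LINT x|lebesgue_on \<Omega>. g' x * \<phi> x)"
      using assms(2,3) \<phi> unfolding has_weak_partial_def by (metis neg_equal_iff_equal)
    then show "(LINT x|lebesgue_on \<Omega>. (g x - g' x) * \<phi> x) = 0"
      using L2_mult_integrable[OF g(1) test_L2[OF assms(1) \<phi>]] L2_mult_integrable[OF g(2) test_L2[OF assms(1) \<phi>]]
      by (simp add: left_diff_distrib)
  qed
  then show ?thesis by simp
qed

lemma weak_partial_works: "has_weak_partial \<Omega> e u g \<Longrightarrow> has_weak_partial \<Omega> e u (weak_partial \<Omega> e u)"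
  unfolding weak_partial_def by (rule someI[where P = "has_weak_partial \<Omega> e u"])

lemma weak_partial_AE:
  "open \<Omega> \<Longrightarrow> has_weak_partial \<Omega> e u g \<Longrightarrow> AE x in lebesgue_on \<Omega>. weak_partial \<Omega> e u x = g x"
  using has_weak_partial_unique weak_partial_works by blast

lemma H1_has_weak_partial:
  "u \<in> H1_space \<Omega> \<Longrightarrow> e \<in> Basis \<Longrightarrow> has_weak_partial \<Omega> e u (weak_partial \<Omega> e u)"
  using weak_partial_works unfolding H1_space_def by blast

lemma H1_L2: "u \<in> H1_space \<Omega> \<Longrightarrow> u \<in> L2_space \<Omega>"
  by (simp add: H1_space_def)

lemma weak_partial_L2: "u \<in> H1_space \<Omega> \<Longrightarrow> e \<in> Basis \<Longrightarrow> weak_partial \<Omega> e u \<in> L2_space \<Omega>"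
  using H1_has_weak_partial[of u \<Omega> e] by (simp add: has_weak_partial_def)

lemma has_weak_partial_add:
  assumes \<Omega>: "open \<Omega>" and e: "e \<in> Basis" and u: "u \<in> L2_space \<Omega>" "v \<in> L2_space \<Omega>"
    and g: "has_weak_partial \<Omega> e u g" "has_weak_partial \<Omega> e v h"
  shows "has_weak_partial \<Omega> e (\<lambda>x. u x + v x) (\<lambda>x. g x + h x)"
proof -
  have L: "g \<in> L2_space \<Omega>" "h \<in> L2_space \<Omega>" using g by (auto simp: has_weak_partial_def)
  have "(LINT x|lebesgue_on \<Omega>. (u x + v x) * frechet_derivative \<phi> (at x) e) =
      - (LINT x|lebesgue_on \<Omega>. (g x + h x) * \<phi> x)" if \<phi>: "\<phi> \<in> test_functions \<Omega>" for \<phi>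
  proof -
    note i = L2_mult_integrable[OF _ test_L2[OF \<Omega> test_partial[OF \<phi> e]]] L2_mult_integrable[OF _ test_L2[OF \<Omega> \<phi>]]
    show ?thesis using g \<phi> u L by (simp add: distrib_right i has_weak_partial_def)
  qed
  then show ?thesis using L2_add[OF L] by (simp add: has_weak_partial_def)
qed

lemma has_weak_partial_cmult:
  assumes "has_weak_partial \<Omega> e u g"
  shows "has_weak_partial \<Omega> e (\<lambda>x. c * u x) (\<lambda>x. c * g x)"
  using assms by (auto simp: has_weak_partial_def L2_cmult mult.assoc)

lemma weak_partial_add:
  assumes "open \<Omega>" "e \<in> Basis" "u \<in> H1_space \<Omega>" "v \<in> H1_space \<Omega>"
  shows "AE x in lebesgue_on \<Omega>. weak_partial \<Omega> e (\<lambda>x. u x + v x) x = weak_partial \<Omega> e u x + weak_partial \<Omega> e v x"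
  by (rule weak_partial_AE[OF assms(1) has_weak_partial_add[OF assms(1,2)]])
     (use assms in \<open>auto intro: H1_has_weak_partial H1_L2\<close>)

lemma weak_partial_cmult:
  assumes "open \<Omega>" "e \<in> Basis" "u \<in> H1_space \<Omega>"
  shows "AE x in lebesgue_on \<Omega>. weak_partial \<Omega> e (\<lambda>x. c * u x) x = c * weak_partial \<Omega> e u x"
  by (rule weak_partial_AE[OF assms(1) has_weak_partial_cmult])
     (use assms in \<open>auto intro: H1_has_weak_partial\<close>)

lemma H1_add: "open \<Omega> \<Longrightarrow> u \<in> H1_space \<Omega> \<Longrightarrow> v \<in> H1_space \<Omega> \<Longrightarrow> (\<lambda>x. u x + v x) \<in> H1_space \<Omega>"
  using has_weak_partial_add unfolding H1_space_def by (blast intro: L2_add)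

lemma H1_cmult: "u \<in> H1_space \<Omega> \<Longrightarrow> (\<lambda>x. c * u x) \<in> H1_space \<Omega>"
  using has_weak_partial_cmult unfolding H1_space_def by (blast intro: L2_cmult)

lemma H1_diff: "open \<Omega> \<Longrightarrow> u \<in> H1_space \<Omega> \<Longrightarrow> v \<in> H1_space \<Omega> \<Longrightarrow> (\<lambda>x. u x - v x) \<in> H1_space \<Omega>"
  using H1_add[of \<Omega> u "\<lambda>x. (-1) * v x"] H1_cmult[of v \<Omega> "-1"] by simp

lemma H1_zero: "(\<lambda>x. 0) \<in> H1_space \<Omega>"
  by (auto simp: H1_space_def has_weak_partial_def L2_zero intro!: exI[of _ "\<lambda>x. 0"])

lemma test_H1: "open \<Omega> \<Longrightarrow> \<phi> \<in> test_functions \<Omega> \<Longrightarrow> \<phi> \<in> H1_space \<Omega>"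
  using has_weak_partial_test test_L2 unfolding H1_space_def by blast

lemma L2_inner_cong_AE:
  assumes "AE x in lebesgue_on \<Omega>. u x = u' x" "AE x in lebesgue_on \<Omega>. v x = v' x"
    "u \<in> L2_space \<Omega>" "u' \<in> L2_space \<Omega>" "v \<in> L2_space \<Omega>" "v' \<in> L2_space \<Omega>"
  shows "L2_inner \<Omega> u v = L2_inner \<Omega> u' v'"
  unfolding L2_inner_def
proof (rule integral_cong_AE)
  show "AE x in lebesgue_on \<Omega>. u x * cnj (v x) = u' x * cnj (v' x)"
    using assms(1,2) by eventually_elim simp
qed (rule borel_measurable_integrable[OF L2_mult_integrable[OF _ L2_cnj]], (rule assms)+)+

lemma L2_nrm_cong_AE:
  assumes "AE x in lebesgue_on \<Omega>. u x = u' x" "u \<in> L2_space \<Omega>" "u' \<in> L2_space \<Omega>"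
  shows "L2.nrm \<Omega> u = L2.nrm \<Omega> u'"
  using L2_inner_cong_AE[OF assms(1,1,2,3,2,3)] by (simp add: L2.nrm_def L2.nsq_def)

text \<open>\<open>weak_partial\<close> is an arbitrary choice and hence additive only almost
  everywhere; inner products do not see the difference.\<close>

lemma dirichlet_form_add:
  assumes \<Omega>: "open \<Omega>" and "u \<in> H1_space \<Omega>" "v \<in> H1_space \<Omega>" "w \<in> H1_space \<Omega>"
  shows "dirichlet_form \<Omega> (\<lambda>x. u x + v x) w = dirichlet_form \<Omega> u w + dirichlet_form \<Omega> v w"
proof -
  have "L2_inner \<Omega> (weak_partial \<Omega> e (\<lambda>x. u x + v x)) (weak_partial \<Omega> e w) =
      L2_inner \<Omega> (weak_partial \<Omega> e u) (weak_partial \<Omega> e w) + L2_inner \<Omega> (weak_partial \<Omega> e v) (weak_partial \<Omega> e w)"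
    if e: "e \<in> Basis" for e
  proof -
    have L: "weak_partial \<Omega> e u \<in> L2_space \<Omega>" "weak_partial \<Omega> e v \<in> L2_space \<Omega>" "weak_partial \<Omega> e w \<in> L2_space \<Omega>"
      using assms e by (auto intro: weak_partial_L2)
    have "L2_inner \<Omega> (weak_partial \<Omega> e (\<lambda>x. u x + v x)) (weak_partial \<Omega> e w) =
        L2_inner \<Omega> (weak_partial \<Omega> e u + weak_partial \<Omega> e v) (weak_partial \<Omega> e w)"
      using weak_partial_add[OF \<Omega> e assms(2,3)] assms(4) e L H1_add[OF assms(1-3)]
      by (intro L2_inner_cong_AE) (auto intro: weak_partial_L2)
    then show ?thesis using L by (simp add: L2.ip_add_left)
  qed
  then show ?thesis unfolding dirichlet_form_def by (simp add: sum.distrib)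
qed

lemma dirichlet_form_cmult:
  assumes \<Omega>: "open \<Omega>" and "u \<in> H1_space \<Omega>" "v \<in> H1_space \<Omega>"
  shows "dirichlet_form \<Omega> (\<lambda>x. c * u x) v = c * dirichlet_form \<Omega> u v"
proof -
  have "L2_inner \<Omega> (weak_partial \<Omega> e (\<lambda>x. c * u x)) (weak_partial \<Omega> e v) =
      c * L2_inner \<Omega> (weak_partial \<Omega> e u) (weak_partial \<Omega> e v)"
    if e: "e \<in> Basis" for e
  proof -
    have L: "weak_partial \<Omega> e u \<in> L2_space \<Omega>" "weak_partial \<Omega> e v \<in> L2_space \<Omega>"
      using assms e by (auto intro: weak_partial_L2)
    have "L2_inner \<Omega> (weak_partial \<Omega> e (\<lambda>x. c * u x)) (weak_partial \<Omega> e v) =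
        L2_inner \<Omega> (cscale c (weak_partial \<Omega> e u)) (weak_partial \<Omega> e v)"
      using weak_partial_cmult[OF \<Omega> e assms(2)] e L H1_cmult[OF assms(2)]
      by (intro L2_inner_cong_AE) (auto intro: weak_partial_L2)
    then show ?thesis using L by (simp add: L2.ip_scale_left)
  qed
  then show ?thesis unfolding dirichlet_form_def by (simp add: sum_distrib_left)
qed

lemma dirichlet_form_self:
  "dirichlet_form \<Omega> u u = of_real (\<Sum>e\<in>Basis. L2.nsq \<Omega> (weak_partial \<Omega> e u))"
  by (simp add: dirichlet_form_def L2_inner_self L2_nsq)

lemma dirichlet_form_semi_inner:
  assumes \<Omega>: "open \<Omega>" and V: "cscale.subspace V" "V \<subseteq> H1_space \<Omega>"
  shows "semi_inner cscale V (dirichlet_form \<Omega>)"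
proof unfold_locales
  show "cscale.subspace V" by fact
  show "dirichlet_form \<Omega> (u + v) w = dirichlet_form \<Omega> u w + dirichlet_form \<Omega> v w"
    if "u \<in> V" "v \<in> V" "w \<in> V" for u v w
    using dirichlet_form_add[OF \<Omega>, of u v w] that V by (auto simp: plus_fun_def)
  show "dirichlet_form \<Omega> (cscale c u) v = c * dirichlet_form \<Omega> u v" if "u \<in> V" "v \<in> V" for c u v
    using dirichlet_form_cmult[OF \<Omega>, of u v c] that V by (auto simp: cscale_def)
  show "dirichlet_form \<Omega> v u = cnj (dirichlet_form \<Omega> u v)" if "u \<in> V" "v \<in> V" for u v
    unfolding dirichlet_form_def cnj_sum
    using that V by (intro sum.cong L2.ip_cnj) (auto intro: weak_partial_L2)
  show "0 \<le> Re (dirichlet_form \<Omega> u u)" if "u \<in> V" for u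
    using that V by (auto simp: dirichlet_form_self intro!: sum_nonneg L2.nsq_ge0 weak_partial_L2)
qed

lemma H1_norm_sq:
  assumes "u \<in> H1_space \<Omega>"
  shows "(H1_norm \<Omega> u)\<^sup>2 = L2.nsq \<Omega> u + Re (dirichlet_form \<Omega> u u)"
  unfolding H1_norm_def L2_nrm[symmetric] using assms
  by (simp add: dirichlet_form_self L2.nrm_sq weak_partial_L2 H1_L2 sum_nonneg cong: sum.cong)

lemma H1_semi_inner: "open \<Omega> \<Longrightarrow> semi_inner cscale (H1_space \<Omega>) (dirichlet_form \<Omega>)"
  by (rule dirichlet_form_semi_inner)
     (auto intro!: cscale.subspaceI simp: plus_fun_def zero_fun_def cscale_def H1_zero H1_add H1_cmult)

section \<open>The closure of the test functions in the energy norm\<close>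

definition grad_nrm :: "'a::euclidean_space set \<Rightarrow> ('a \<Rightarrow> complex) \<Rightarrow> real" where
  "grad_nrm \<Omega> u = sqrt (Re (dirichlet_form \<Omega> u u))"

lemma H1_norm_tendsto_0_iff:
  assumes "\<And>n. X n \<in> H1_space \<Omega>"
  shows "(\<lambda>n. H1_norm \<Omega> (X n)) \<longlonglongrightarrow> 0 \<longleftrightarrow>
    (\<lambda>n. L2.nrm \<Omega> (X n)) \<longlonglongrightarrow> 0 \<and> (\<lambda>n. grad_nrm \<Omega> (X n)) \<longlonglongrightarrow> 0"
proof -
  have nn: "0 \<le> L2.nsq \<Omega> (X n)" "0 \<le> Re (dirichlet_form \<Omega> (X n) (X n))" for n
    using L2.nsq_ge0[OF H1_L2[OF assms]]
    by (simp_all add: dirichlet_form_self sum_nonneg L2.nsq_ge0 weak_partial_L2[OF assms])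
  have H: "H1_norm \<Omega> (X n) = sqrt (L2.nsq \<Omega> (X n) + Re (dirichlet_form \<Omega> (X n) (X n)))" for n
    by (rule real_sqrt_unique[symmetric, OF H1_norm_sq[OF assms]]) (simp add: H1_norm_def sum_nonneg)
  show ?thesis
  proof
  assume *: "(\<lambda>n. H1_norm \<Omega> (X n)) \<longlonglongrightarrow> 0"
  show "(\<lambda>n. L2.nrm \<Omega> (X n)) \<longlonglongrightarrow> 0 \<and> (\<lambda>n. grad_nrm \<Omega> (X n)) \<longlonglongrightarrow> 0"
  proof
    show "(\<lambda>n. L2.nrm \<Omega> (X n)) \<longlonglongrightarrow> 0"
      by (rule tendsto_sandwich[OF _ _ tendsto_const *]) (use nn in \<open>auto simp: H L2.nrm_def\<close>)
    show "(\<lambda>n. grad_nrm \<Omega> (X n)) \<longlonglongrightarrow> 0"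
      by (rule tendsto_sandwich[OF _ _ tendsto_const *]) (use nn in \<open>auto simp: H grad_nrm_def\<close>)
  qed
  next
  assume "(\<lambda>n. L2.nrm \<Omega> (X n)) \<longlonglongrightarrow> 0 \<and> (\<lambda>n. grad_nrm \<Omega> (X n)) \<longlonglongrightarrow> 0"
  then have "(\<lambda>n. sqrt ((L2.nrm \<Omega> (X n))\<^sup>2 + (grad_nrm \<Omega> (X n))\<^sup>2)) \<longlonglongrightarrow> sqrt (0\<^sup>2 + 0\<^sup>2)"
    by (intro tendsto_intros) auto
  moreover have "sqrt ((L2.nrm \<Omega> (X n))\<^sup>2 + (grad_nrm \<Omega> (X n))\<^sup>2) = H1_norm \<Omega> (X n)" for n
    using nn by (simp add: H grad_nrm_def L2.nrm_def)
  ultimately show "(\<lambda>n. H1_norm \<Omega> (X n)) \<longlonglongrightarrow> 0" by simp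
  qed
qed

lemma grad_nrm_eq:
  assumes "open \<Omega>"
  shows "semi_inner.nrm (dirichlet_form \<Omega>) = grad_nrm \<Omega>"
proof -
  interpret D: semi_inner cscale "H1_space \<Omega>" "dirichlet_form \<Omega>" by (rule H1_semi_inner[OF assms])
  show ?thesis by (simp add: fun_eq_iff D.nrm_def D.nsq_def grad_nrm_def)
qed

lemma grad_nrm_triangle:
  assumes "open \<Omega>" "u \<in> H1_space \<Omega>" "v \<in> H1_space \<Omega>"
  shows "grad_nrm \<Omega> (u + v) \<le> grad_nrm \<Omega> u + grad_nrm \<Omega> v"
proof -
  interpret D: semi_inner cscale "H1_space \<Omega>" "dirichlet_form \<Omega>" by (rule H1_semi_inner[OF assms(1)])
  show ?thesis using D.nrm_triangle[OF assms(2,3)] by (simp add: grad_nrm_eq[OF assms(1)])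
qed

lemma grad_nrm_cscale:
  assumes "open \<Omega>" "u \<in> H1_space \<Omega>"
  shows "grad_nrm \<Omega> (cscale c u) = cmod c * grad_nrm \<Omega> u"
proof -
  interpret D: semi_inner cscale "H1_space \<Omega>" "dirichlet_form \<Omega>" by (rule H1_semi_inner[OF assms(1)])
  show ?thesis using D.nrm_scale[OF assms(2)] by (simp add: grad_nrm_eq[OF assms(1)])
qed

lemma H1_ops:
  assumes "open \<Omega>"
  shows "u \<in> H1_space \<Omega> \<Longrightarrow> v \<in> H1_space \<Omega> \<Longrightarrow> u + v \<in> H1_space \<Omega>"
    and "u \<in> H1_space \<Omega> \<Longrightarrow> v \<in> H1_space \<Omega> \<Longrightarrow> u - v \<in> H1_space \<Omega>"
    and "u \<in> H1_space \<Omega> \<Longrightarrow> cscale c u \<in> H1_space \<Omega>"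
  using H1_add[OF assms] H1_diff[OF assms] H1_cmult
  by (auto simp: plus_fun_def fun_diff_def cscale_def)

text \<open>Convergence in \<open>H1_norm\<close> is split into convergence in the two seminorms in
  which \<open>closed_form\<close> is phrased.\<close>

lemma H10_iff:
  assumes \<Omega>: "open \<Omega>"
  shows "u \<in> H10_space \<Omega> \<longleftrightarrow> u \<in> H1_space \<Omega> \<and> (\<exists>\<phi>::nat \<Rightarrow> _. (\<forall>n. \<phi> n \<in> test_functions \<Omega>) \<and>
     (\<lambda>n. L2.nrm \<Omega> (\<phi> n - u)) \<longlonglongrightarrow> 0 \<and> (\<lambda>n. grad_nrm \<Omega> (\<phi> n - u)) \<longlonglongrightarrow> 0)"
proof -
  have *: "(\<lambda>n. H1_norm \<Omega> (\<lambda>x. \<phi> n x - u x)) \<longlonglongrightarrow> 0 \<longleftrightarrow>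
      (\<lambda>n. L2.nrm \<Omega> (\<phi> n - u)) \<longlonglongrightarrow> 0 \<and> (\<lambda>n. grad_nrm \<Omega> (\<phi> n - u)) \<longlonglongrightarrow> 0"
    if "u \<in> H1_space \<Omega>" "\<forall>n. \<phi> n \<in> test_functions \<Omega>" for \<phi> :: "nat \<Rightarrow> _"
    using H1_norm_tendsto_0_iff[of "\<lambda>n. \<phi> n - u" \<Omega>] that H1_ops(2)[OF \<Omega>] test_H1[OF \<Omega>]
    by (simp add: fun_diff_def)
  then show ?thesis unfolding H10_space_def by blast
qed

lemma H10_H1: "u \<in> H10_space \<Omega> \<Longrightarrow> u \<in> H1_space \<Omega>"
  by (simp add: H10_space_def)

lemma H10_approx:
  assumes "open \<Omega>" "u \<in> H10_space \<Omega>" "d > 0"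
  obtains \<phi> where "\<phi> \<in> test_functions \<Omega>" "L2.nrm \<Omega> (\<phi> - u) < d" "grad_nrm \<Omega> (\<phi> - u) < d"
proof -
  obtain \<phi> :: "nat \<Rightarrow> _" where \<phi>: "\<And>n. \<phi> n \<in> test_functions \<Omega>"
     "(\<lambda>n. L2.nrm \<Omega> (\<phi> n - u)) \<longlonglongrightarrow> 0" "(\<lambda>n. grad_nrm \<Omega> (\<phi> n - u)) \<longlonglongrightarrow> 0"
    using assms(2) unfolding H10_iff[OF assms(1)] by blast
  have "\<forall>\<^sub>F n in sequentially. L2.nrm \<Omega> (\<phi> n - u) < d \<and> grad_nrm \<Omega> (\<phi> n - u) < d"
    using \<phi>(2,3) assms(3) by (intro eventually_conj order_tendstoD) auto
  then show ?thesis using \<phi>(1) that by (auto simp: eventually_sequentially)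
qed

lemma test_H10: "open \<Omega> \<Longrightarrow> \<phi> \<in> test_functions \<Omega> \<Longrightarrow> \<phi> \<in> H10_space \<Omega>"
proof -
  assume \<Omega>: "open \<Omega>" and \<phi>: "\<phi> \<in> test_functions \<Omega>"
  have "grad_nrm \<Omega> (cscale 0 \<phi>) = 0" "L2.nrm \<Omega> (cscale 0 \<phi>) = 0"
    using grad_nrm_cscale[OF \<Omega> test_H1[OF \<Omega> \<phi>], of 0] L2.nrm_scale[OF test_L2[OF \<Omega> \<phi>], of 0] by auto
  then have "grad_nrm \<Omega> (\<phi> - \<phi>) = 0" "L2.nrm \<Omega> (\<phi> - \<phi>) = 0" by auto
  then show ?thesis unfolding H10_iff[OF \<Omega>] using \<phi> test_H1[OF \<Omega> \<phi>]
    by (intro conjI exI[of _ "\<lambda>n. \<phi>"]) auto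
qed

lemma H10_subspace:
  assumes \<Omega>: "open \<Omega>"
  shows "cscale.subspace (H10_space \<Omega>)"
proof (rule cscale.subspaceI)
  have "(\<lambda>x. 0) \<in> test_functions \<Omega>" by (rule test_functionsI[of _ "{}"]) auto
  then show "0 \<in> H10_space \<Omega>" using test_H10[OF \<Omega>] by (simp add: zero_fun_def)
next
  fix u v assume uv: "u \<in> H10_space \<Omega>" "v \<in> H10_space \<Omega>"
  then have H1: "u \<in> H1_space \<Omega>" "v \<in> H1_space \<Omega>" by (auto intro: H10_H1)
  obtain \<phi> :: "nat \<Rightarrow> _" where \<phi>: "\<And>n. \<phi> n \<in> test_functions \<Omega>"
     "(\<lambda>n. L2.nrm \<Omega> (\<phi> n - u)) \<longlonglongrightarrow> 0" "(\<lambda>n. grad_nrm \<Omega> (\<phi> n - u)) \<longlonglongrightarrow> 0"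
    using uv(1) unfolding H10_iff[OF \<Omega>] by blast
  obtain \<psi> :: "nat \<Rightarrow> _" where \<psi>: "\<And>n. \<psi> n \<in> test_functions \<Omega>"
     "(\<lambda>n. L2.nrm \<Omega> (\<psi> n - v)) \<longlonglongrightarrow> 0" "(\<lambda>n. grad_nrm \<Omega> (\<psi> n - v)) \<longlonglongrightarrow> 0"
    using uv(2) unfolding H10_iff[OF \<Omega>] by blast
  have d: "\<phi> n - u \<in> H1_space \<Omega>" "\<psi> n - v \<in> H1_space \<Omega>" for n
    using \<phi>(1) \<psi>(1) H1 by (auto intro: H1_ops[OF \<Omega>] test_H1[OF \<Omega>])
  have eq: "(\<phi> n + \<psi> n) - (u + v) = (\<phi> n - u) + (\<psi> n - v)" for n by simp
  have dH1: "(\<phi> n + \<psi> n) - (u + v) \<in> H1_space \<Omega>" for n unfolding eq by (rule H1_ops(1)[OF \<Omega> d])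
  have "\<phi> n + \<psi> n \<in> test_functions \<Omega>" for n
    using test_add[OF \<phi>(1) \<psi>(1)] by (simp add: plus_fun_def)
  moreover have "(\<lambda>n. L2.nrm \<Omega> ((\<phi> n + \<psi> n) - (u + v))) \<longlonglongrightarrow> 0"
  proof (rule tendsto_sandwich[OF _ _ tendsto_const])
    show "(\<lambda>n. L2.nrm \<Omega> (\<phi> n - u) + L2.nrm \<Omega> (\<psi> n - v)) \<longlonglongrightarrow> 0" using tendsto_add[OF \<phi>(2) \<psi>(2)] by simp
    show "\<forall>\<^sub>F n in sequentially. 0 \<le> L2.nrm \<Omega> ((\<phi> n + \<psi> n) - (u + v))"
      using H1_L2[OF dH1] by (intro always_eventually allI L2.nrm_ge0)
    show "\<forall>\<^sub>F n in sequentially. L2.nrm \<Omega> ((\<phi> n + \<psi> n) - (u + v)) \<le> L2.nrm \<Omega> (\<phi> n - u) + L2.nrm \<Omega> (\<psi> n - v)"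
      unfolding eq by (intro always_eventually allI L2.nrm_triangle[OF H1_L2[OF d(1)] H1_L2[OF d(2)]])
  qed
  moreover have "(\<lambda>n. grad_nrm \<Omega> ((\<phi> n + \<psi> n) - (u + v))) \<longlonglongrightarrow> 0"
  proof (rule tendsto_sandwich[OF _ _ tendsto_const])
    show "(\<lambda>n. grad_nrm \<Omega> (\<phi> n - u) + grad_nrm \<Omega> (\<psi> n - v)) \<longlonglongrightarrow> 0" using tendsto_add[OF \<phi>(3) \<psi>(3)] by simp
    show "\<forall>\<^sub>F n in sequentially. 0 \<le> grad_nrm \<Omega> ((\<phi> n + \<psi> n) - (u + v))"
      using semi_inner.ip_ge0[OF H1_semi_inner[OF \<Omega>] dH1] by (simp add: grad_nrm_def)
    show "\<forall>\<^sub>F n in sequentially. grad_nrm \<Omega> ((\<phi> n + \<psi> n) - (u + v)) \<le> grad_nrm \<Omega> (\<phi> n - u) + grad_nrm \<Omega> (\<psi> n - v)"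
      unfolding eq using d by (intro always_eventually allI grad_nrm_triangle[OF \<Omega>])
  qed
  ultimately show "u + v \<in> H10_space \<Omega>"
    unfolding H10_iff[OF \<Omega>] using H1 H1_ops(1)[OF \<Omega>] by (intro conjI exI[of _ "\<lambda>n. \<phi> n + \<psi> n"]) auto
next
  fix c u assume u: "u \<in> H10_space \<Omega>"
  then have H1: "u \<in> H1_space \<Omega>" by (rule H10_H1)
  obtain \<phi> :: "nat \<Rightarrow> _" where \<phi>: "\<And>n. \<phi> n \<in> test_functions \<Omega>"
     "(\<lambda>n. L2.nrm \<Omega> (\<phi> n - u)) \<longlonglongrightarrow> 0" "(\<lambda>n. grad_nrm \<Omega> (\<phi> n - u)) \<longlonglongrightarrow> 0"
    using u unfolding H10_iff[OF \<Omega>] by blast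
  have d: "\<phi> n - u \<in> H1_space \<Omega>" for n
    using \<phi>(1) H1 by (auto intro: H1_ops[OF \<Omega>] test_H1[OF \<Omega>])
  have eq: "cscale c (\<phi> n) - cscale c u = cscale c (\<phi> n - u)" for n
    by (simp add: cscale.scale_right_diff_distrib)
  have "cscale c (\<phi> n) \<in> test_functions \<Omega>" for n
    using test_cmult[OF \<phi>(1)] by (simp add: cscale_def)
  moreover have "(\<lambda>n. L2.nrm \<Omega> (cscale c (\<phi> n) - cscale c u)) \<longlonglongrightarrow> 0"
    using tendsto_mult_right_zero[OF \<phi>(2), of "cmod c"] unfolding eq by (simp add: L2.nrm_scale[OF H1_L2[OF d]])
  moreover have "(\<lambda>n. grad_nrm \<Omega> (cscale c (\<phi> n) - cscale c u)) \<longlonglongrightarrow> 0"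
    using tendsto_mult_right_zero[OF \<phi>(3), of "cmod c"] unfolding eq by (simp add: grad_nrm_cscale[OF \<Omega> d])
  ultimately show "cscale c u \<in> H10_space \<Omega>"
    unfolding H10_iff[OF \<Omega>] using H1_ops(3)[OF \<Omega> H1] by (intro conjI exI[of _ "\<lambda>n. cscale c (\<phi> n)"]) auto
qed

lemma H10_semi_inner: "open \<Omega> \<Longrightarrow> semi_inner cscale (H10_space \<Omega>) (dirichlet_form \<Omega>)"
  by (rule dirichlet_form_semi_inner[OF _ H10_subspace]) (auto intro: H10_H1)

lemma weak_partial_diff:
  assumes \<Omega>: "open \<Omega>" and e: "e \<in> Basis" and H1: "u \<in> H1_space \<Omega>" "v \<in> H1_space \<Omega>"
    and g: "has_weak_partial \<Omega> e v g"
  shows "L2.nrm \<Omega> (weak_partial \<Omega> e (u - v)) = L2.nrm \<Omega> (weak_partial \<Omega> e u - g)"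
proof -
  have g2: "g \<in> L2_space \<Omega>" using g by (simp add: has_weak_partial_def)
  have "has_weak_partial \<Omega> e (\<lambda>x. u x + (-1) * v x) (\<lambda>x. weak_partial \<Omega> e u x + (-1) * g x)"
    by (intro has_weak_partial_add[OF \<Omega> e] has_weak_partial_cmult g H1_has_weak_partial H1_L2 H1 e H1_L2[OF H1_cmult])
  then have *: "has_weak_partial \<Omega> e (u - v) (weak_partial \<Omega> e u - g)" by (simp add: fun_diff_def)
  show ?thesis
    using weak_partial_AE[OF \<Omega> *] weak_partial_L2[OF H1_ops(2)[OF \<Omega> H1] e] weak_partial_L2[OF H1(1) e] g2
    by (intro L2_nrm_cong_AE) auto
qed

lemma grad_nrm_sq:
  assumes "u \<in> H1_space \<Omega>"
  shows "(grad_nrm \<Omega> u)\<^sup>2 = (\<Sum>e\<in>Basis. (L2.nrm \<Omega> (weak_partial \<Omega> e u))\<^sup>2)"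
  using assms by (simp add: grad_nrm_def dirichlet_form_self sum_nonneg L2.nsq_ge0 weak_partial_L2 L2.nrm_sq cong: sum.cong)

lemma weak_partial_nrm_le:
  assumes "u \<in> H1_space \<Omega>" "e \<in> Basis"
  shows "L2.nrm \<Omega> (weak_partial \<Omega> e u) \<le> grad_nrm \<Omega> u"
proof (rule power2_le_imp_le)
  show "(L2.nrm \<Omega> (weak_partial \<Omega> e u))\<^sup>2 \<le> (grad_nrm \<Omega> u)\<^sup>2"
    unfolding grad_nrm_sq[OF assms(1)] using assms(2) by (intro member_le_sum) auto
  show "0 \<le> grad_nrm \<Omega> u"
    using assms by (simp add: grad_nrm_def dirichlet_form_self sum_nonneg L2.nsq_ge0 weak_partial_L2)
qed

text \<open>Weak differentiation is a closed operation: u and the g e are the L^2 limits of the X n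
  and of their partial derivatives, and the defining identity passes to the limit. Membership in the
  closure follows by choosing a test function near each X n.\<close>

lemma H10_complete:
  assumes \<Omega>: "open (\<Omega> :: 'a::euclidean_space set)"
    and X: "\<And>n::nat. X n \<in> H10_space \<Omega>"
    and CL: "\<And>d. d > 0 \<Longrightarrow> \<exists>N. \<forall>m\<ge>N. \<forall>n\<ge>N. L2.nrm \<Omega> (X m - X n) < d"
    and CD: "\<And>d. d > 0 \<Longrightarrow> \<exists>N. \<forall>m\<ge>N. \<forall>n\<ge>N. grad_nrm \<Omega> (X m - X n) < d"
  shows "\<exists>u\<in>H10_space \<Omega>. (\<lambda>n. L2.nrm \<Omega> (X n - u)) \<longlonglongrightarrow> 0 \<and> (\<lambda>n. grad_nrm \<Omega> (X n - u)) \<longlonglongrightarrow> 0"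
proof -
  have H1: "X n \<in> H1_space \<Omega>" for n using X by (rule H10_H1)
  obtain u where u: "u \<in> L2_space \<Omega>" "(\<lambda>n. L2.nrm \<Omega> (X n - u)) \<longlonglongrightarrow> 0"
    using L2_complete[OF H1_L2[OF H1] CL] by blast
  have "\<exists>g\<in>L2_space \<Omega>. (\<lambda>n. L2.nrm \<Omega> (weak_partial \<Omega> e (X n) - g)) \<longlonglongrightarrow> 0" if e: "e \<in> Basis" for e
  proof (rule L2_complete)
    show "weak_partial \<Omega> e (X n) \<in> L2_space \<Omega>" for n by (rule weak_partial_L2[OF H1 e])
    fix d :: real assume "d > 0"
    then obtain N where N: "\<And>m n. m \<ge> N \<Longrightarrow> n \<ge> N \<Longrightarrow> grad_nrm \<Omega> (X m - X n) < d" using CD by blast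
    have "L2.nrm \<Omega> (weak_partial \<Omega> e (X m) - weak_partial \<Omega> e (X n)) \<le> grad_nrm \<Omega> (X m - X n)" for m n
      using weak_partial_nrm_le[OF H1_ops(2)[OF \<Omega> H1 H1] e]
      unfolding weak_partial_diff[OF \<Omega> e H1 H1 H1_has_weak_partial[OF H1 e]] .
    then show "\<exists>N. \<forall>m\<ge>N. \<forall>n\<ge>N. L2.nrm \<Omega> (weak_partial \<Omega> e (X m) - weak_partial \<Omega> e (X n)) < d"
      using N by (meson le_less_trans)
  qed
  then obtain g where g: "\<And>e. e \<in> Basis \<Longrightarrow> g e \<in> L2_space \<Omega>"
     "\<And>e. e \<in> Basis \<Longrightarrow> (\<lambda>n. L2.nrm \<Omega> (weak_partial \<Omega> e (X n) - g e)) \<longlonglongrightarrow> 0" by metis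
  have wp: "has_weak_partial \<Omega> e u (g e)" if e: "e \<in> Basis" for e
    unfolding has_weak_partial_def
  proof (intro conjI ballI)
    fix \<phi> assume \<phi>: "\<phi> \<in> test_functions \<Omega>"
    let ?D = "\<lambda>x. frechet_derivative \<phi> (at x) e"
    have L: "?D \<in> L2_space \<Omega>" "\<phi> \<in> L2_space \<Omega>" using test_L2[OF \<Omega>] test_partial[OF \<phi> e] \<phi> by auto
    \<comment> \<open>The inner product conjugates its second argument, so conjugated test functions
      reproduce the bilinear integral of the weak derivative.\<close>
    have 1: "(\<lambda>n. L2_inner \<Omega> (X n) (\<lambda>x. cnj (?D x))) \<longlonglongrightarrow> L2_inner \<Omega> u (\<lambda>x. cnj (?D x))"
      by (intro L2.ip_tendsto_left u L2_cnj L H1_L2 H1)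
    have 2: "(\<lambda>n. - L2_inner \<Omega> (weak_partial \<Omega> e (X n)) (\<lambda>x. cnj (\<phi> x))) \<longlonglongrightarrow> - L2_inner \<Omega> (g e) (\<lambda>x. cnj (\<phi> x))"
      by (intro tendsto_minus L2.ip_tendsto_left g e L2_cnj L weak_partial_L2[OF H1])
    have "L2_inner \<Omega> (X n) (\<lambda>x. cnj (?D x)) = - L2_inner \<Omega> (weak_partial \<Omega> e (X n)) (\<lambda>x. cnj (\<phi> x))" for n
      using H1_has_weak_partial[OF H1 e, of n] \<phi> by (simp add: has_weak_partial_def L2_inner_def)
    then have "L2_inner \<Omega> u (\<lambda>x. cnj (?D x)) = - L2_inner \<Omega> (g e) (\<lambda>x. cnj (\<phi> x))"
      using 1 2 LIMSEQ_unique by simp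
    then show "(LINT x|lebesgue_on \<Omega>. u x * ?D x) = - (LINT x|lebesgue_on \<Omega>. g e x * \<phi> x)"
      by (simp add: L2_inner_def)
  qed (use g e in auto)
  have uH1: "u \<in> H1_space \<Omega>" using u wp by (auto simp: H1_space_def)
  have lim: "(\<lambda>n. grad_nrm \<Omega> (X n - u)) \<longlonglongrightarrow> 0"
  proof -
    have nn: "0 \<le> grad_nrm \<Omega> (X n - u)" for n
      using semi_inner.ip_ge0[OF H1_semi_inner[OF \<Omega>] H1_ops(2)[OF \<Omega> H1 uH1]] by (simp add: grad_nrm_def)
    have "(\<lambda>n. \<Sum>e\<in>Basis. (L2.nrm \<Omega> (weak_partial \<Omega> e (X n) - g e))\<^sup>2) \<longlonglongrightarrow> (\<Sum>e\<in>(Basis::'a set). 0\<^sup>2)"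
      by (intro tendsto_intros g)
    then have "(\<lambda>n. sqrt ((grad_nrm \<Omega> (X n - u))\<^sup>2)) \<longlonglongrightarrow> sqrt (\<Sum>e\<in>(Basis::'a set). 0\<^sup>2)"
      by (intro tendsto_real_sqrt)
         (simp add: grad_nrm_sq[OF H1_ops(2)[OF \<Omega> H1 uH1]] weak_partial_diff[OF \<Omega> _ H1 uH1 wp] cong: sum.cong)
    then show ?thesis using nn by simp
  qed
  have "\<exists>\<phi>\<in>test_functions \<Omega>. L2.nrm \<Omega> (\<phi> - X n) < 1 / Suc n \<and> grad_nrm \<Omega> (\<phi> - X n) < 1 / Suc n" for n
    using H10_approx[OF \<Omega> X, of "1 / Suc n"] by (metis of_nat_0_less_iff zero_less_Suc zero_less_divide_1_iff)
  then obtain \<phi> where \<phi>: "\<And>n. \<phi> n \<in> test_functions \<Omega>" "\<And>n. L2.nrm \<Omega> (\<phi> n - X n) < 1 / Suc n"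
     "\<And>n. grad_nrm \<Omega> (\<phi> n - X n) < 1 / Suc n" by metis
  have eq: "\<phi> n - u = (\<phi> n - X n) + (X n - u)" for n by simp
  have d: "\<phi> n - X n \<in> H1_space \<Omega>" "X n - u \<in> H1_space \<Omega>" "\<phi> n - u \<in> H1_space \<Omega>" for n
    using \<phi>(1) H1 uH1 by (auto intro: H1_ops[OF \<Omega>] test_H1[OF \<Omega>])
  have inv: "(\<lambda>n. 1 / real (Suc n)) \<longlonglongrightarrow> 0" by (rule LIMSEQ_Suc[OF lim_1_over_n])
  have "(\<lambda>n. L2.nrm \<Omega> (\<phi> n - u)) \<longlonglongrightarrow> 0"
  proof (rule tendsto_sandwich[OF _ _ tendsto_const])
    show "(\<lambda>n. 1 / Suc n + L2.nrm \<Omega> (X n - u)) \<longlonglongrightarrow> 0" using tendsto_add[OF inv u(2)] by simp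
    show "\<forall>\<^sub>F n in sequentially. 0 \<le> L2.nrm \<Omega> (\<phi> n - u)"
      using H1_L2[OF d(3)] by (intro always_eventually allI L2.nrm_ge0)
    have "L2.nrm \<Omega> (\<phi> n - u) \<le> 1 / Suc n + L2.nrm \<Omega> (X n - u)" for n
      using L2.nrm_triangle[OF H1_L2[OF d(1)] H1_L2[OF d(2)], of n n] \<phi>(2)[of n] unfolding eq[of n] by linarith
    then show "\<forall>\<^sub>F n in sequentially. L2.nrm \<Omega> (\<phi> n - u) \<le> 1 / Suc n + L2.nrm \<Omega> (X n - u)" by simp
  qed
  moreover have "(\<lambda>n. grad_nrm \<Omega> (\<phi> n - u)) \<longlonglongrightarrow> 0"
  proof (rule tendsto_sandwich[OF _ _ tendsto_const])
    show "(\<lambda>n. 1 / Suc n + grad_nrm \<Omega> (X n - u)) \<longlonglongrightarrow> 0" using tendsto_add[OF inv lim] by simp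
    show "\<forall>\<^sub>F n in sequentially. 0 \<le> grad_nrm \<Omega> (\<phi> n - u)"
      using semi_inner.ip_ge0[OF H1_semi_inner[OF \<Omega>] d(3)] by (simp add: grad_nrm_def)
    have "grad_nrm \<Omega> (\<phi> n - u) \<le> 1 / Suc n + grad_nrm \<Omega> (X n - u)" for n
      using grad_nrm_triangle[OF \<Omega> d(1) d(2), of n n] \<phi>(3)[of n] unfolding eq[of n] by linarith
    then show "\<forall>\<^sub>F n in sequentially. grad_nrm \<Omega> (\<phi> n - u) \<le> 1 / Suc n + grad_nrm \<Omega> (X n - u)" by simp
  qed
  ultimately have "u \<in> H10_space \<Omega>" unfolding H10_iff[OF \<Omega>] using uH1 \<phi>(1) by blast
  then show ?thesis using u(2) lim by blast
qed

theorem dirichlet_closed_form: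
  assumes \<Omega>: "open \<Omega>"
  shows "closed_form cscale (L2_space \<Omega>) (H10_space \<Omega>) (L2_inner \<Omega>) (dirichlet_form \<Omega>)"
proof -
  interpret V: semi_inner cscale "H10_space \<Omega>" "dirichlet_form \<Omega>" by (rule H10_semi_inner[OF \<Omega>])
  show ?thesis
  proof unfold_locales
    show "H10_space \<Omega> \<subseteq> L2_space \<Omega>" by (auto intro: H1_L2 H10_H1)
  qed (use L2_complete[of _ \<Omega>] H10_complete[OF \<Omega>] in \<open>auto simp: grad_nrm_eq[OF \<Omega>]\<close>)
qed

subsection \<open>The compactness inequality for the waveguide\<close>

lemma variance_identity:
  fixes v :: "'a \<Rightarrow> 'b::euclidean_space"
  assumes A: "A \<in> sets M" "emeasure M A < \<infinity>" and d: "measure M A = d" "d > 0"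
    and v: "set_integrable M A v" "set_integrable M A (\<lambda>x. (norm (v x))\<^sup>2)"
  shows "set_integrable M A (\<lambda>x. (norm (v x - c))\<^sup>2)"
    and "(LINT x:A|M. (norm (v x - (1 / d) *\<^sub>R (LINT x:A|M. v x)))\<^sup>2) =
      (LINT x:A|M. (norm (v x))\<^sup>2) - (norm (LINT x:A|M. v x))\<^sup>2 / d"
proof -
  have const: "set_integrable M A (\<lambda>x. c)" for c :: real
    using A unfolding set_integrable_def by simp
  have inn: "set_integrable M A (\<lambda>x. v x \<bullet> c)" for c
  proof -
    have "integrable M (\<lambda>x. (indicator A x *\<^sub>R v x) \<bullet> c)" using v(1) unfolding set_integrable_def by (rule integrable_inner_left)
    then show ?thesis by (simp only: set_integrable_def inner_scaleR_left real_scaleR_def)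
  qed
  have inn_eq: "(LINT x:A|M. v x \<bullet> c) = (LINT x:A|M. v x) \<bullet> c" for c
  proof -
    have "(LINT x|M. (indicator A x *\<^sub>R v x) \<bullet> c) = (LINT x|M. indicator A x *\<^sub>R v x) \<bullet> c"
      using v(1) unfolding set_integrable_def by (intro integral_inner_left) auto
    then show ?thesis unfolding set_lebesgue_integral_def by simp
  qed
  have expand: "(norm (v x - c))\<^sup>2 = (norm (v x))\<^sup>2 - 2 * (v x \<bullet> c) + (norm c)\<^sup>2" for x c
    by (simp add: power2_norm_eq_inner inner_diff inner_commute)
  show "set_integrable M A (\<lambda>x. (norm (v x - c))\<^sup>2)"
    unfolding expand by (intro set_integral_add set_integral_diff v const set_integrable_mult_right inn)
  define c where "c = (1 / d) *\<^sub>R (LINT x:A|M. v x)"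
  have "(LINT x:A|M. (norm (v x - c))\<^sup>2) =
      (LINT x:A|M. (norm (v x))\<^sup>2) - 2 * ((LINT x:A|M. v x) \<bullet> c) + d * (norm c)\<^sup>2"
    unfolding expand using v const inn A d
    by (subst set_integral_add set_integral_diff, simp_all add: set_integrable_mult_right
        set_integral_diff set_integral_const inn_eq less_top)+
  also have "\<dots> = (LINT x:A|M. (norm (v x))\<^sup>2) - (norm (LINT x:A|M. v x))\<^sup>2 / d"
  proof -
    have "(LINT x:A|M. v x) \<bullet> c = (norm (LINT x:A|M. v x))\<^sup>2 / d"
      by (simp add: c_def power2_norm_eq_inner)
    moreover have "(norm c)\<^sup>2 = (norm (LINT x:A|M. v x))\<^sup>2 / d\<^sup>2"
      by (simp add: c_def power_mult_distrib power_divide)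
    ultimately show ?thesis using d by (simp add: power2_eq_square)
  qed
  finally show "(LINT x:A|M. (norm (v x - (1 / d) *\<^sub>R (LINT x:A|M. v x)))\<^sup>2) =
      (LINT x:A|M. (norm (v x))\<^sup>2) - (norm (LINT x:A|M. v x))\<^sup>2 / d"
    by (simp add: c_def)
qed

text \<open>The variance is nonnegative; this is Cauchy-Schwarz against the constant 1.\<close>

lemma norm_integral_sq_le:
  fixes v :: "'a \<Rightarrow> 'b::euclidean_space"
  assumes A: "A \<in> sets M" "emeasure M A < \<infinity>" and d: "measure M A = d" "d > 0"
    and v: "set_integrable M A v" "set_integrable M A (\<lambda>x. (norm (v x))\<^sup>2)"
  shows "(norm (LINT x:A|M. v x))\<^sup>2 \<le> d * (LINT x:A|M. (norm (v x))\<^sup>2)"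
proof -
  have "0 \<le> (LINT x:A|M. (norm (v x - (1 / d) *\<^sub>R (LINT x:A|M. v x)))\<^sup>2)"
    unfolding set_lebesgue_integral_def by (intro integral_nonneg_AE) auto
  then show ?thesis unfolding variance_identity(2)[OF assms] using d by (simp add: field_simps)
qed

text \<open>If all values of v are within sqrt K of each other, they are within sqrt K of their
  mean, so the variance integral is at most d K.\<close>

lemma norm_sq_integral_le_oscillation:
  fixes v :: "'a \<Rightarrow> 'b::euclidean_space"
  assumes A: "A \<in> sets M" "emeasure M A < \<infinity>" and d: "measure M A = d" "d > 0"
    and v: "set_integrable M A v" "set_integrable M A (\<lambda>x. (norm (v x))\<^sup>2)"
    and K: "\<And>s t. s \<in> A \<Longrightarrow> t \<in> A \<Longrightarrow> (norm (v s - v t))\<^sup>2 \<le> K"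
  shows "(LINT x:A|M. (norm (v x))\<^sup>2) \<le> d * K + (norm (LINT x:A|M. v x))\<^sup>2 / d"
proof -
  define c where "c = (1 / d) *\<^sub>R (LINT x:A|M. v x)"
  have ci: "set_integrable M A (\<lambda>x. k)" for k :: "'c::{banach, second_countable_topology}"
    using A unfolding set_integrable_def by simp
  have le: "(norm (v s - c))\<^sup>2 \<le> K" if s: "s \<in> A" for s
  proof -
    have K0: "0 \<le> K" using K[OF s s] by simp
    have "(LINT t:A|M. v s - v t) = d *\<^sub>R (v s - c)"
      unfolding set_integral_diff(2)[OF ci v(1)]
      using d A by (simp add: set_integral_const less_top c_def scaleR_right_diff_distrib)
    then have "d * norm (v s - c) = norm (LINT t:A|M. v s - v t)" using d by simp
    also have "\<dots> \<le> (LINT t:A|M. norm (v s - v t))"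
      by (intro set_integral_norm_bound set_integral_diff ci v)
    also have "\<dots> \<le> (LINT t:A|M. sqrt K)"
      using K[OF s] by (intro set_integral_mono set_integrable_norm set_integral_diff ci v) (simp add: real_le_rsqrt)
    also have "\<dots> = d * sqrt K" using A d by (simp add: set_integral_const less_top)
    finally have "norm (v s - c) \<le> sqrt K" using d by simp
    then show ?thesis using K0 by (metis norm_ge_zero power_mono real_sqrt_pow2)
  qed
  have "(LINT x:A|M. (norm (v x - c))\<^sup>2) \<le> (LINT x:A|M. K)"
    using le by (intro set_integral_mono variance_identity(1)[OF A d v] ci)
  also have "\<dots> = d * K" using A d by (simp add: set_integral_const less_top)
  finally show ?thesis unfolding c_def variance_identity(2)[OF A d v] by simp
qed

text \<open>
  Jacobi's identity \<open>\<bar>v'\<bar>\<^sup>2 - k\<^sup>2 \<bar>v\<bar>\<^sup>2 = \<bar>v' - k cot(k t) v\<bar>\<^sup>2 + (k cot(k t) \<bar>v\<bar>\<^sup>2)'\<close> gives the sharp constant.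
\<close>

lemma dirichlet_poincare_1d:
  fixes v :: "real \<Rightarrow> complex"
  assumes der: "\<And>t. (v has_vector_derivative v' t) (at t)" and cont: "continuous_on UNIV v'"
    and k: "k > 0" and K: "compact K" "K \<subseteq> {0<..<pi / k}" and zero: "\<And>t. t \<notin> K \<Longrightarrow> v t = 0"
  shows "k\<^sup>2 * (LINT t|lborel. (norm (v t))\<^sup>2) \<le> (LINT t|lborel. (norm (v' t))\<^sup>2)"
proof (cases "K = {}")
  case True
  then show ?thesis using zero by simp
next
  case False
  have contv: "continuous_on UNIV v"
    using der by (intro continuous_at_imp_continuous_on) (auto intro: has_vector_derivative_continuous)
  have zero': "v' t = 0" if "t \<notin> K" for t
  proof -
    have "(v has_vector_derivative 0) (at t)"
      by (rule has_vector_derivative_transform_within_open[of "\<lambda>t. 0" _ _ "- K"])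
         (use that K zero in \<open>auto intro: compact_imp_closed\<close>)
    then show ?thesis using der vector_derivative_unique_at by blast
  qed
  obtain a where a: "a \<in> K" "\<And>t. t \<in> K \<Longrightarrow> a \<le> t" using compact_attains_inf[OF K(1) False] by blast
  obtain b where b: "b \<in> K" "\<And>t. t \<in> K \<Longrightarrow> t \<le> b" using compact_attains_sup[OF K(1) False] by blast
  \<comment> \<open>The support stays away from both end points. On [a', b'] the cotangent is
    therefore smooth, and the boundary values of q are zero.\<close>
  obtain a' where a': "0 < a'" "a' < a" using a(1) K(2) dense[of 0 a] greaterThanLessThan_iff by blast
  obtain b' where b': "b < b'" "b' < pi / k" using b(1) K(2) dense[of b "pi / k"] greaterThanLessThan_iff by blast
  have ab: "a' \<le> b'" using a' b' a(2)[OF b(1)] by linarith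
  have out: "t \<notin> K" if "t \<notin> {a'..b'}" for t using that a(2)[of t] b(2)[of t] a' b' by auto
  have sin0: "sin (k * t) > 0" if "t \<in> {a'..b'}" for t
  proof (rule sin_gt_zero)
    show "0 < k * t" using that a' k by simp
    have "t < pi / k" using that b' by simp
    then show "k * t < pi" using k by (simp add: field_simps)
  qed
  define C where "C t = k * cos (k * t) / sin (k * t)" for t
  define q where "q t = C t * (v t \<bullet> v t)" for t
  define q' where "q' t = 2 * C t * (v t \<bullet> v' t) - (k\<^sup>2 + (C t)\<^sup>2) * (v t \<bullet> v t)" for t
  have derC: "(C has_real_derivative - (k\<^sup>2 + (C t)\<^sup>2)) (at t)" if "t \<in> {a'..b'}" for t
  proof -
    have s: "sin (k * t) \<noteq> 0" using sin0[OF that] by simp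
    have "(C has_real_derivative
        ((- (k * k * sin (k * t))) * sin (k * t) - k * cos (k * t) * (k * cos (k * t))) / (sin (k * t) * sin (k * t))) (at t)"
      unfolding C_def using s by (auto intro!: derivative_eq_intros)
    moreover have "((- (k * k * sin (k * t))) * sin (k * t) - k * cos (k * t) * (k * cos (k * t))) / (sin (k * t) * sin (k * t))
        = - (k\<^sup>2 + (C t)\<^sup>2)"
      using s by (simp add: C_def field_simps power2_eq_square)
    ultimately show ?thesis by simp
  qed
  have derq: "(q has_real_derivative q' t) (at t)" if "t \<in> {a'..b'}" for t
  proof -
    have "((\<lambda>t. v t \<bullet> v t) has_real_derivative 2 * (v t \<bullet> v' t)) (at t)"
      using has_derivative_inner[OF der[unfolded has_vector_derivative_def] der[unfolded has_vector_derivative_def]]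
      unfolding has_field_derivative_def
      by (rule has_derivative_eq_rhs) (auto simp: fun_eq_iff inner_commute)
    from DERIV_mult[OF derC[OF that] this] show ?thesis
      unfolding q_def q'_def by (rule DERIV_cong) (simp add: algebra_simps)
  qed
  have contC: "continuous_on {a'..b'} C"
    by (intro continuous_at_imp_continuous_on ballI) (rule DERIV_isCont[OF derC])
  have contq': "continuous_on {a'..b'} q'"
    unfolding q'_def
    by (intro continuous_intros contC continuous_on_subset[OF contv] continuous_on_subset[OF cont]) auto
  have intq': "set_integrable lborel {a'..b'} q'"
    unfolding set_integrable_def using contq' borel_integrable_compact[of "{a'..b'}" q'] by simp
  have FTC: "(LINT t:{a'..b'}|lborel. q' t) = 0"
  proof -
    have "(q' has_integral (q b' - q a')) {a'..b'}"
      using ab derq by (intro fundamental_theorem_of_calculus)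
         (auto simp: has_real_derivative_iff_has_vector_derivative[symmetric] intro: DERIV_subset)
    moreover have "q b' = 0" "q a' = 0" using zero[of a'] zero[of b'] a b a' b' by (force simp: q_def)+
    ultimately have "integral {a'..b'} q' = 0" by (simp add: integral_unique)
    then show ?thesis using set_borel_integral_eq_integral(2)[OF intq'] by simp
  qed
  have int1: "set_integrable lborel {a'..b'} (\<lambda>t. (norm (v' t))\<^sup>2)" "set_integrable lborel {a'..b'} (\<lambda>t. (norm (v t))\<^sup>2)"
    unfolding set_integrable_def
    by (auto intro!: borel_integrable_compact continuous_intros
        continuous_on_subset[OF contv] continuous_on_subset[OF cont] simp del: real_scaleR_def)
  have "0 \<le> (LINT t:{a'..b'}|lborel. (norm (v' t - C t *\<^sub>R v t))\<^sup>2)"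
    unfolding set_lebesgue_integral_def by (intro integral_nonneg_AE) auto
  also have "\<dots> = (LINT t:{a'..b'}|lborel. (norm (v' t))\<^sup>2 - k\<^sup>2 * (norm (v t))\<^sup>2 - q' t)"
  proof (intro set_lebesgue_integral_cong allI impI)
    show "(norm (v' t - C t *\<^sub>R v t))\<^sup>2 = (norm (v' t))\<^sup>2 - k\<^sup>2 * (norm (v t))\<^sup>2 - q' t" for t
      unfolding q'_def power2_norm_eq_inner
      by (simp add: inner_diff inner_commute algebra_simps power2_eq_square)
  qed simp
  also have "\<dots> = (LINT t:{a'..b'}|lborel. (norm (v' t))\<^sup>2) - k\<^sup>2 * (LINT t:{a'..b'}|lborel. (norm (v t))\<^sup>2)"
    using int1 intq' FTC by (simp add: set_integral_diff)
  also have "(LINT t:{a'..b'}|lborel. (norm (v' t))\<^sup>2) = (LINT t|lborel. (norm (v' t))\<^sup>2)"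
    unfolding set_lebesgue_integral_def using out zero'
    by (intro Bochner_Integration.integral_cong) (auto simp: indicator_def)
  also have "(LINT t:{a'..b'}|lborel. (norm (v t))\<^sup>2) = (LINT t|lborel. (norm (v t))\<^sup>2)"
    unfolding set_lebesgue_integral_def using out zero
    by (intro Bochner_Integration.integral_cong) (auto simp: indicator_def)
  finally show ?thesis by simp
qed

section \<open>Slices of the waveguide and the transverse inequality\<close>

lemma smooth_slice_derivative:
  fixes \<phi> :: "real \<times> real \<Rightarrow> complex"
  assumes "smooth \<phi>"
  shows "((\<lambda>t. \<phi> (x, t)) has_vector_derivative frechet_derivative \<phi> (at (x, t)) (0, 1)) (at t within S)"
    and "((\<lambda>t. \<phi> (t, y)) has_vector_derivative frechet_derivative \<phi> (at (t, y)) (1, 0)) (at t within S)"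
proof -
  have lin: "h *\<^sub>R frechet_derivative \<phi> (at p) (0, 1) = frechet_derivative \<phi> (at p) (0, h)"
    "h *\<^sub>R frechet_derivative \<phi> (at p) (1, 0) = frechet_derivative \<phi> (at p) (h, 0)" for p h
    using linear_scale[OF has_derivative_linear[OF smooth_has_derivative[OF assms]], of p h "(0, 1)"]
      linear_scale[OF has_derivative_linear[OF smooth_has_derivative[OF assms]], of p h "(1, 0)"] by simp_all
  have "((\<lambda>t. \<phi> (x, t)) has_derivative (\<lambda>h. frechet_derivative \<phi> (at (x, t)) (0, h))) (at t within S)"
    by (rule has_derivative_compose[OF _ smooth_has_derivative[OF assms], of "\<lambda>t. (x, t)"])
       (auto intro!: derivative_eq_intros)
  then show "((\<lambda>t. \<phi> (x, t)) has_vector_derivative frechet_derivative \<phi> (at (x, t)) (0, 1)) (at t within S)"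
    unfolding has_vector_derivative_def lin .
  have "((\<lambda>t. \<phi> (t, y)) has_derivative (\<lambda>h. frechet_derivative \<phi> (at (t, y)) (h, 0))) (at t within S)"
    by (rule has_derivative_compose[OF _ smooth_has_derivative[OF assms], of "\<lambda>t. (t, y)"])
       (auto intro!: derivative_eq_intros)
  then show "((\<lambda>t. \<phi> (t, y)) has_vector_derivative frechet_derivative \<phi> (at (t, y)) (1, 0)) (at t within S)"
    unfolding has_vector_derivative_def lin .
qed

lemma plane_Basis: "(1, 0) \<in> (Basis :: (real \<times> real) set)" "(0, 1) \<in> (Basis :: (real \<times> real) set)"
  "(Basis :: (real \<times> real) set) = {(1, 0), (0, 1)}"
  by (auto simp: Basis_prod_def)

lemma lborel_plane_integral:
  fixes F :: "real \<times> real \<Rightarrow> 'b::{banach, second_countable_topology}"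
  assumes "integrable lborel F"
  shows "integrable lborel (\<lambda>x. LINT y|lborel. F (x, y))" "(LINT x|lborel. LINT y|lborel. F (x, y)) = integral\<^sup>L lborel F"
    "integrable lborel (\<lambda>y. LINT x|lborel. F (x, y))" "(LINT y|lborel. LINT x|lborel. F (x, y)) = integral\<^sup>L lborel F"
proof -
  have F: "integrable (lborel \<Otimes>\<^sub>M lborel) F" using assms by (simp add: lborel_prod)
  show "integrable lborel (\<lambda>x. LINT y|lborel. F (x, y))" using lborel_pair.integrable_fst'[OF F] .
  show "(LINT x|lborel. LINT y|lborel. F (x, y)) = integral\<^sup>L lborel F"
    using lborel_pair.integral_fst'[OF F] by (simp add: lborel_prod)
  have F': "integrable (lborel \<Otimes>\<^sub>M lborel) (\<lambda>(x, y). F (x, y))" using F by simp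
  show "integrable lborel (\<lambda>y. LINT x|lborel. F (x, y))" using lborel_pair.integrable_snd[OF F'] .
  show "(LINT y|lborel. LINT x|lborel. F (x, y)) = integral\<^sup>L lborel F"
    using lborel_pair.integral_snd[OF F'] by (simp add: lborel_prod)
qed

lemma open_waveguide:
  assumes "continuous_on UNIV f"
  shows "open (waveguide f)"
proof -
  have c: "continuous_on UNIV (\<lambda>p::real \<times> real. pi + pi * f (fst p))"
    by (intro continuous_intros continuous_on_compose2[OF assms]) auto
  have "open ({p. 0 < snd p} \<inter> {p::real \<times> real. snd p < pi + pi * f (fst p)})"
    by (intro open_Int open_Collect_less continuous_on_const continuous_on_snd continuous_on_id c)
  moreover have "waveguide f = {p. 0 < snd p} \<inter> {p. snd p < pi + pi * f (fst p)}"
    by (auto simp: waveguide_def)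
  ultimately show ?thesis by simp
qed

text \<open>Each vertical slice of the support lies compactly in (0, pi / k) for k = 1 / (1 + f x),
  so the one-dimensional inequality holds there with constant k^2; it is then integrated in
  x.\<close>

lemma transverse_poincare:
  assumes f: "continuous_on UNIV f" "\<And>x. 0 \<le> f x" and \<phi>: "\<phi> \<in> test_functions (waveguide f)"
  shows "integrable lborel (\<lambda>p. (norm (\<phi> p))\<^sup>2 / (1 + f (fst p))\<^sup>2)"
    and "(LINT p|lborel. (norm (\<phi> p))\<^sup>2 / (1 + f (fst p))\<^sup>2) \<le>
      (LINT p|lborel. (norm (frechet_derivative \<phi> (at p) (0, 1)))\<^sup>2)"
proof -
  let ?uy = "\<lambda>p. frechet_derivative \<phi> (at p) (0, 1)"
  have uy: "?uy \<in> test_functions (waveguide f)" by (rule test_partial[OF \<phi> plane_Basis(2)])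
  obtain K where K: "smooth \<phi>" "compact K" "K \<subseteq> waveguide f" "\<And>p. p \<notin> K \<Longrightarrow> \<phi> p = 0"
    using test_functionsE[OF \<phi>] by blast
  have h0: "1 + f x \<noteq> 0" "1 + f x > 0" for x using f(2)[of x] by auto
  show int: "integrable lborel (\<lambda>p. (norm (\<phi> p))\<^sup>2 / (1 + f (fst p))\<^sup>2)"
  proof (rule continuous_compact_support_integrable[OF _ K(2)])
    show "continuous_on UNIV (\<lambda>p. (norm (\<phi> p))\<^sup>2 / (1 + f (fst p))\<^sup>2)"
      using h0 by (intro continuous_intros test_continuous[OF \<phi>] continuous_on_compose2[OF f(1)]) auto
  qed (use K in simp)
  have slice: "(LINT y|lborel. (norm (\<phi> (x, y)))\<^sup>2 / (1 + f x)\<^sup>2) \<le> (LINT y|lborel. (norm (?uy (x, y)))\<^sup>2)" for x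
  proof -
    have "(1 / (1 + f x))\<^sup>2 * (LINT y|lborel. (norm (\<phi> (x, y)))\<^sup>2) \<le> (LINT y|lborel. (norm (?uy (x, y)))\<^sup>2)"
    proof (rule dirichlet_poincare_1d[where K = "snd ` (K \<inter> {x} \<times> UNIV)"])
      show "((\<lambda>t. \<phi> (x, t)) has_vector_derivative ?uy (x, t)) (at t)" for t
        by (rule smooth_slice_derivative(1)[OF K(1)])
      show "continuous_on UNIV (\<lambda>t. ?uy (x, t))"
        by (rule continuous_on_compose2[OF test_continuous[OF uy, of UNIV]]) (auto intro!: continuous_intros)
      show "compact (snd ` (K \<inter> {x} \<times> UNIV))"
        using K(2) by (intro compact_continuous_image continuous_intros compact_Int_closed closed_Times) auto
      show "snd ` (K \<inter> {x} \<times> UNIV) \<subseteq> {0<..<pi / (1 / (1 + f x))}"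
        using K(3) by (auto simp: waveguide_def algebra_simps)
      show "\<phi> (x, t) = 0" if "t \<notin> snd ` (K \<inter> {x} \<times> UNIV)" for t
        using that by (intro K(4)) force
    qed (use h0 in simp)
    then show ?thesis by (simp add: power_divide)
  qed
  have "(LINT p|lborel. (norm (\<phi> p))\<^sup>2 / (1 + f (fst p))\<^sup>2) =
      (LINT x|lborel. LINT y|lborel. (norm (\<phi> (x, y)))\<^sup>2 / (1 + f x)\<^sup>2)"
    using lborel_plane_integral(2)[OF int] by simp
  also have "\<dots> \<le> (LINT x|lborel. LINT y|lborel. (norm (?uy (x, y)))\<^sup>2)"
  proof (rule integral_mono)
    show "integrable lborel (\<lambda>x. LINT y|lborel. (norm (\<phi> (x, y)))\<^sup>2 / (1 + f x)\<^sup>2)"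
      using lborel_plane_integral(1)[OF int] by simp
    show "integrable lborel (\<lambda>x. LINT y|lborel. (norm (?uy (x, y)))\<^sup>2)"
      by (rule lborel_plane_integral(1)[OF test_norm_sq_integrable[OF uy]])
  qed (rule slice)
  also have "\<dots> = (LINT p|lborel. (norm (?uy p))\<^sup>2)"
    by (rule lborel_plane_integral(2)[OF test_norm_sq_integrable[OF uy]])
  finally show "(LINT p|lborel. (norm (\<phi> p))\<^sup>2 / (1 + f (fst p))\<^sup>2) \<le> (LINT p|lborel. (norm (?uy p))\<^sup>2)" .
qed

section \<open>A Poincare inequality on small squares\<close>

lemma set_integrable_Ico:
  fixes g :: "real \<Rightarrow> 'b::{banach, second_countable_topology}"
  assumes "continuous_on UNIV g"
  shows "set_integrable lborel {a..<b} g"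
proof (rule set_integrable_subset[of _ "{a..b}"])
  show "set_integrable lborel {a..b} g"
    unfolding set_integrable_def using assms by (intro borel_integrable_compact continuous_on_subset[OF assms]) auto
qed auto

lemma increment_sq_le:
  fixes v :: "real \<Rightarrow> complex"
  assumes der: "\<And>t. (v has_vector_derivative v' t) (at t)" and cont: "continuous_on UNIV v'"
    and d: "d > 0" and st: "s \<in> {a..<a + d}" "t \<in> {a..<a + d}"
  shows "(norm (v s - v t))\<^sup>2 \<le> d * (LINT x:{a..<a + d}|lborel. (norm (v' x))\<^sup>2)"
proof -
  have *: "norm (v t - v s) \<le> (LINT x:{a..<a + d}|lborel. norm (v' x))"
    if st: "s \<in> {a..<a + d}" "t \<in> {a..<a + d}" "s \<le> t" for s t
  proof -
    have si: "set_integrable lborel {s..t} v'"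
      unfolding set_integrable_def by (intro borel_integrable_compact continuous_on_subset[OF cont]) auto
    have "(v' has_integral (v t - v s)) {s..t}"
      using der st(3) by (intro fundamental_theorem_of_calculus) (auto intro: has_vector_derivative_at_within)
    then have "v t - v s = (LINT x:{s..t}|lborel. v' x)"
      using set_borel_integral_eq_integral(2)[OF si] by (simp add: integral_unique)
    then have "norm (v t - v s) \<le> (LINT x:{s..t}|lborel. norm (v' x))"
      using set_integral_norm_bound[OF si] by simp
    also have "\<dots> \<le> (LINT x:{a..<a + d}|lborel. norm (v' x))"
      using st set_integrable_norm[OF si] set_integrable_Ico[OF continuous_on_norm[OF cont], of a "a + d"]
      unfolding set_lebesgue_integral_def set_integrable_def
      by (intro integral_mono) (auto simp: indicator_def)
    finally show ?thesis .
  qed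
  have "norm (v s - v t) \<le> (LINT x:{a..<a + d}|lborel. norm (v' x))"
    using *[of s t] *[of t s] st by (cases "s \<le> t") (auto simp: norm_minus_commute)
  then have "(norm (v s - v t))\<^sup>2 \<le> (LINT x:{a..<a + d}|lborel. norm (v' x))\<^sup>2" by (intro power_mono) auto
  also have "\<dots> = (norm (LINT x:{a..<a + d}|lborel. norm (v' x)))\<^sup>2" by simp
  also have "\<dots> \<le> d * (LINT x:{a..<a + d}|lborel. (norm (norm (v' x)))\<^sup>2)"
    using d by (intro norm_integral_sq_le set_integrable_Ico) (auto intro!: continuous_intros cont)
  finally show ?thesis by simp
qed

text \<open>Two one-dimensional passes. Along each row the square integral is bounded by the
  x-derivative and the row integral m y; the oscillation of m is bounded by the y-derivative. Of the
  function itself only the integral over the square remains, a single functional.\<close>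

lemma cell_poincare:
  fixes \<phi> :: "real \<times> real \<Rightarrow> complex" and a c d :: real
  assumes \<phi>: "\<phi> \<in> test_functions \<Omega>" and d: "d > 0"
  defines "Q \<equiv> {a..<a + d} \<times> {c..<c + d}"
  defines "ux \<equiv> \<lambda>p. frechet_derivative \<phi> (at p) (1, 0)" and "uy \<equiv> \<lambda>p. frechet_derivative \<phi> (at p) (0, 1)"
  shows "(LINT p:Q|lborel. (norm (\<phi> p))\<^sup>2) \<le>
    d\<^sup>2 * ((LINT p:Q|lborel. (norm (ux p))\<^sup>2) + (LINT p:Q|lborel. (norm (uy p))\<^sup>2)) + (norm (LINT p:Q|lborel. \<phi> p))\<^sup>2 / d\<^sup>2"
proof -
  let ?I = "{a..<a + d}" and ?J = "{c..<c + d}"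
  have Q: "Q \<in> sets borel" unfolding Q_def by (intro borel_Times) auto
  have cQ: "integrable lborel (\<lambda>p. indicator Q p *\<^sub>R F p)" if "integrable lborel F"
    for F :: "real \<times> real \<Rightarrow> 'b::{banach, second_countable_topology}"
    using that Q by (intro integrable_mult_indicator) auto
  have it: "(LINT p:Q|lborel. F p) = (LINT y:?J|lborel. LINT x:?I|lborel. F (x, y))"
      "(LINT p:Q|lborel. F p) = (LINT x:?I|lborel. LINT y:?J|lborel. F (x, y))"
      "set_integrable lborel ?J (\<lambda>y. LINT x:?I|lborel. F (x, y))"
      "set_integrable lborel ?I (\<lambda>x. LINT y:?J|lborel. F (x, y))"
    if "integrable lborel F" for F :: "real \<times> real \<Rightarrow> 'b::{banach, second_countable_topology}"
  proof -
    have e: "indicator Q (x, y) *\<^sub>R F (x, y) = indicator ?J y *\<^sub>R (indicator ?I x *\<^sub>R F (x, y))" for x y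
      by (auto simp: Q_def indicator_def)
    have e': "indicator Q (x, y) *\<^sub>R F (x, y) = indicator ?I x *\<^sub>R (indicator ?J y *\<^sub>R F (x, y))" for x y
      by (auto simp: Q_def indicator_def)
    note P = lborel_plane_integral[OF cQ[OF that]]
    show "(LINT p:Q|lborel. F p) = (LINT y:?J|lborel. LINT x:?I|lborel. F (x, y))"
      using P(4) unfolding e set_lebesgue_integral_def by (simp del: scaleR_scaleR)
    show "(LINT p:Q|lborel. F p) = (LINT x:?I|lborel. LINT y:?J|lborel. F (x, y))"
      using P(2) unfolding e' set_lebesgue_integral_def by (simp del: scaleR_scaleR)
    show "set_integrable lborel ?J (\<lambda>y. LINT x:?I|lborel. F (x, y))"
      using P(3) unfolding e set_lebesgue_integral_def set_integrable_def by (simp del: scaleR_scaleR)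
    show "set_integrable lborel ?I (\<lambda>x. LINT y:?J|lborel. F (x, y))"
      using P(1) unfolding e' set_lebesgue_integral_def set_integrable_def by (simp del: scaleR_scaleR)
  qed
  have sm: "smooth \<phi>" by (rule test_smooth[OF \<phi>])
  have ux: "ux \<in> test_functions \<Omega>" and uy: "uy \<in> test_functions \<Omega>"
    unfolding ux_def uy_def using plane_Basis by (auto intro: test_partial[OF \<phi>])
  have cs: "continuous_on UNIV (\<lambda>x. u (x, y))" "continuous_on UNIV (\<lambda>y. u (x, y))"
    if "u \<in> test_functions \<Omega>" for u :: "real \<times> real \<Rightarrow> complex" and x y
    by (rule continuous_on_compose2[OF test_continuous[OF that, of UNIV]]; auto intro!: continuous_intros)+
  note ns = test_norm_sq_integrable
  define m where "m y = (LINT x:?I|lborel. \<phi> (x, y))" for y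
  have I: "?I \<in> sets lborel" "emeasure lborel ?I < \<infinity>" "measure lborel ?I = d" using d by auto
  have J: "?J \<in> sets lborel" "emeasure lborel ?J < \<infinity>" "measure lborel ?J = d" using d by auto
  have row: "(LINT x:?I|lborel. (norm (\<phi> (x, y)))\<^sup>2) \<le>
      d * (d * (LINT x:?I|lborel. (norm (ux (x, y)))\<^sup>2)) + (norm (m y))\<^sup>2 / d" for y
    unfolding m_def
  proof (rule norm_sq_integral_le_oscillation[OF I d])
    show "(norm (\<phi> (s, y) - \<phi> (t, y)))\<^sup>2 \<le> d * (LINT x:?I|lborel. (norm (ux (x, y)))\<^sup>2)"
      if "s \<in> ?I" "t \<in> ?I" for s t
      by (rule increment_sq_le[OF _ _ d that])
         (auto simp: ux_def intro: smooth_slice_derivative(2)[OF sm] cs(1)[OF ux, unfolded ux_def])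
  qed (auto intro!: set_integrable_Ico continuous_intros cs[OF \<phi>])
  \<comment> \<open>Bound for the squared oscillation of m: one factor d from Cauchy-Schwarz along
    the row, the other from the increment in y.\<close>
  define K where "K = d * (d * (LINT p:Q|lborel. (norm (uy p))\<^sup>2))"
  have m_osc: "(norm (m s - m t))\<^sup>2 \<le> K" if st: "s \<in> ?J" "t \<in> ?J" for s t
  proof -
    have "m s - m t = (LINT x:?I|lborel. \<phi> (x, s) - \<phi> (x, t))"
      unfolding m_def by (intro set_integral_diff(2)[symmetric] set_integrable_Ico cs[OF \<phi>])
    then have "(norm (m s - m t))\<^sup>2 \<le> d * (LINT x:?I|lborel. (norm (\<phi> (x, s) - \<phi> (x, t)))\<^sup>2)"
      using norm_integral_sq_le[OF I d, of "\<lambda>x. \<phi> (x, s) - \<phi> (x, t)"]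
      by (simp add: set_integrable_Ico continuous_intros cs[OF \<phi>])
    also have "(LINT x:?I|lborel. (norm (\<phi> (x, s) - \<phi> (x, t)))\<^sup>2) \<le>
        (LINT x:?I|lborel. d * (LINT y:?J|lborel. (norm (uy (x, y)))\<^sup>2))"
    proof (rule set_integral_mono)
      show "set_integrable lborel ?I (\<lambda>x. (norm (\<phi> (x, s) - \<phi> (x, t)))\<^sup>2)"
        by (intro set_integrable_Ico continuous_intros cs[OF \<phi>])
      show "set_integrable lborel ?I (\<lambda>x. d * (LINT y:?J|lborel. (norm (uy (x, y)))\<^sup>2))"
        by (intro set_integrable_mult_right it(4) ns[OF uy])
      show "(norm (\<phi> (x, s) - \<phi> (x, t)))\<^sup>2 \<le> d * (LINT y:?J|lborel. (norm (uy (x, y)))\<^sup>2)" for x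
        by (rule increment_sq_le[OF _ _ d st])
           (auto simp: uy_def intro: smooth_slice_derivative(1)[OF sm] cs(2)[OF uy, unfolded uy_def])
    qed
    also have "\<dots> = d * (LINT p:Q|lborel. (norm (uy p))\<^sup>2)" using it(2)[OF ns[OF uy]] by simp
    finally show ?thesis using d by (simp add: K_def)
  qed
  have mi: "set_integrable lborel ?J m" unfolding m_def by (rule it(3)[OF test_integrable[OF \<phi>]])
  have mi2: "set_integrable lborel ?J (\<lambda>y. (norm (m y))\<^sup>2)"
  proof (rule set_integrable_bound[OF it(3)[OF ns[OF \<phi>], THEN set_integrable_mult_right, of d]])
    show "set_borel_measurable lborel ?J (\<lambda>y. (norm (m y))\<^sup>2)"
    proof -
      have "(\<lambda>y. (norm (indicator ?J y *\<^sub>R m y))\<^sup>2) \<in> borel_measurable lborel"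
        using borel_measurable_integrable[OF mi[unfolded set_integrable_def]] by measurable
      moreover have "(norm (indicator ?J y *\<^sub>R m y))\<^sup>2 = indicator ?J y *\<^sub>R (norm (m y))\<^sup>2" for y
        by (auto simp: indicator_def)
      ultimately show ?thesis unfolding set_borel_measurable_def by (simp only:)
    qed
    show "AE y in lborel. y \<in> ?J \<longrightarrow> norm ((norm (m y))\<^sup>2) \<le> norm (d * (LINT x:?I|lborel. (norm (\<phi> (x, y)))\<^sup>2))"
    proof (intro always_eventually allI impI)
      fix y
      have "(norm (m y))\<^sup>2 \<le> d * (LINT x:?I|lborel. (norm (\<phi> (x, y)))\<^sup>2)"
        unfolding m_def by (rule norm_integral_sq_le[OF I d]) (auto intro!: set_integrable_Ico continuous_intros cs[OF \<phi>])
      then show "norm ((norm (m y))\<^sup>2) \<le> norm (d * (LINT x:?I|lborel. (norm (\<phi> (x, y)))\<^sup>2))" by simp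
    qed
  qed
  have "(LINT p:Q|lborel. (norm (\<phi> p))\<^sup>2) = (LINT y:?J|lborel. LINT x:?I|lborel. (norm (\<phi> (x, y)))\<^sup>2)"
    by (rule it(1)[OF ns[OF \<phi>]])
  also have "\<dots> \<le> (LINT y:?J|lborel. d * (d * (LINT x:?I|lborel. (norm (ux (x, y)))\<^sup>2)) + (norm (m y))\<^sup>2 / d)"
    using row
    by (intro set_integral_mono it(3)[OF ns[OF \<phi>]] set_integral_add set_integrable_mult_right
        it(3)[OF ns[OF ux]] set_integrable_divide mi2)
  also have "\<dots> = d\<^sup>2 * (LINT p:Q|lborel. (norm (ux p))\<^sup>2) + (LINT y:?J|lborel. (norm (m y))\<^sup>2) / d"
    using it(1,3)[OF ns[OF ux]] mi2 by (simp add: set_integral_add(2) power2_eq_square)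
  also have "(LINT y:?J|lborel. (norm (m y))\<^sup>2) \<le> d * K + (norm (LINT y:?J|lborel. m y))\<^sup>2 / d"
    by (rule norm_sq_integral_le_oscillation[OF J d mi mi2 m_osc])
  also have "(LINT y:?J|lborel. m y) = (LINT p:Q|lborel. \<phi> p)"
    unfolding m_def by (rule it(1)[OF test_integrable[OF \<phi>], symmetric])
  finally show ?thesis
    using d by (simp add: K_def divide_right_mono field_simps power2_eq_square)
qed

lemma sum_indicator_Ico:
  assumes "d > 0"
  shows "(\<Sum>i<N. indicator {a + real i * d..<a + real i * d + d} x) = (indicator {a..<a + real N * d} x :: real)"
proof (induction N)
  case (Suc N)
  define k where "k = real N * d"
  have "0 \<le> k" using assms by (simp add: k_def)
  then have "indicator {a..<a + k} x + indicator {a + k..<a + k + d} x = (indicator {a..<a + (k + d)} x :: real)"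
    using assms by (auto simp: indicator_def)
  moreover have "real (Suc N) * d = k + d" by (simp add: k_def algebra_simps)
  ultimately show ?case using Suc unfolding k_def by simp
qed simp

lemma test_dirichlet_form:
  assumes \<Omega>: "open \<Omega>" and \<phi>: "\<phi> \<in> test_functions \<Omega>"
  shows "Re (dirichlet_form \<Omega> \<phi> \<phi>) = (\<Sum>e\<in>Basis. LINT p|lborel. (norm (frechet_derivative \<phi> (at p) e))\<^sup>2)"
proof -
  have "L2.nsq \<Omega> (weak_partial \<Omega> e \<phi>) = (LINT p|lborel. (norm (frechet_derivative \<phi> (at p) e))\<^sup>2)"
    if e: "e \<in> Basis" for e
  proof -
    have "L2.nrm \<Omega> (weak_partial \<Omega> e \<phi>) = L2.nrm \<Omega> (\<lambda>p. frechet_derivative \<phi> (at p) e)"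
      by (intro L2_nrm_cong_AE weak_partial_AE[OF \<Omega> has_weak_partial_test[OF \<Omega> \<phi> e]]
          weak_partial_L2[OF test_H1[OF \<Omega> \<phi>] e] test_L2[OF \<Omega> test_partial[OF \<phi> e]])
    then show ?thesis
      using test_integral_eq(2)[OF \<Omega> test_partial[OF \<phi> e]] by (simp add: L2.nrm_def L2_nsq)
  qed
  then show ?thesis by (simp add: dirichlet_form_self)
qed

text \<open>Half-open squares tile a rectangle without overlap, so indicators add up exactly. The
  summand 0 brings both factors into the shape of \<open>sum_indicator_Ico\<close>.\<close>

definition cell :: "real \<Rightarrow> real \<Rightarrow> nat \<times> nat \<Rightarrow> (real \<times> real) set" where
  "cell R d ij = {- R + real (fst ij) * d..<- R + real (fst ij) * d + d} \<times> {0 + real (snd ij) * d..<0 + real (snd ij) * d + d}"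

lemma cell_borel: "cell R d ij \<in> sets borel"
  unfolding cell_def by (intro borel_Times) auto

lemma sum_cells:
  assumes d: "d > 0" and F: "integrable lborel F"
  shows "(\<Sum>ij\<in>{..<N} \<times> {..<M}. LINT p:cell R d ij|lborel. F p) =
    (LINT p:{- R..<- R + real N * d} \<times> {0..<real M * d}|lborel. F p :: real)"
proof -
  have ind: "(\<Sum>ij\<in>{..<N} \<times> {..<M}. indicator (cell R d ij) p) =
      (indicator ({- R..<- R + real N * d} \<times> {0..<real M * d}) p :: real)" for p :: "real \<times> real"
  proof -
    have "(\<Sum>ij\<in>{..<N} \<times> {..<M}. indicator (cell R d ij) p) =
        (\<Sum>i<N. \<Sum>j<M. indicator {- R + real i * d..<- R + real i * d + d} (fst p) *
           indicator {0 + real j * d..<0 + real j * d + d} (snd p) :: real)"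
      unfolding sum.cartesian_product by (intro sum.cong) (auto simp: cell_def indicator_def mem_Times_iff)
    also have "\<dots> = (\<Sum>i<N. indicator {- R + real i * d..<- R + real i * d + d} (fst p)) *
           (\<Sum>j<M. indicator {0 + real j * d..<0 + real j * d + d} (snd p))"
      by (simp add: sum_product)
    also have "\<dots> = indicator {- R..<- R + real N * d} (fst p) * indicator {0..<0 + real M * d} (snd p)"
      unfolding sum_indicator_Ico[OF d] ..
    also have "\<dots> = indicator ({- R..<- R + real N * d} \<times> {0..<real M * d}) p"
      by (auto simp: indicator_def mem_Times_iff)
    finally show ?thesis .
  qed
  have "(\<Sum>ij\<in>{..<N} \<times> {..<M}. LINT p:cell R d ij|lborel. F p) =
      (LINT p|lborel. (\<Sum>ij\<in>{..<N} \<times> {..<M}. indicator (cell R d ij) p *\<^sub>R F p))"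
    unfolding set_lebesgue_integral_def using F cell_borel
    by (intro Bochner_Integration.integral_sum[symmetric] integrable_mult_indicator) auto
  also have "\<dots> = (LINT p|lborel. (\<Sum>ij\<in>{..<N} \<times> {..<M}. indicator (cell R d ij) p) * F p)"
    by (simp add: sum_distrib_right)
  also have "\<dots> = (LINT p|lborel. indicator ({- R..<- R + real N * d} \<times> {0..<real M * d}) p * F p)"
    unfolding ind ..
  finally show ?thesis by (simp add: set_lebesgue_integral_def)
qed

text \<open>For |x| at least R the transverse inequality is nearly as good as with constant 1. The
  rest of the waveguide is covered by squares: N d = 2 R exhausts the length, and M d exceeds the
  maximal height pi (1 + \<alpha>). The energy is spent once on the transverse inequality and d^2
  times on the squares.\<close>

lemma test_compactness:
  fixes f :: "real \<Rightarrow> real"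
  assumes f: "continuous_on UNIV f" "\<And>x. 0 \<le> f x" "\<And>x. f x \<le> \<alpha>"
    and tail: "\<And>x. \<bar>x\<bar> \<ge> R \<Longrightarrow> 1 - \<epsilon> \<le> 1 / (1 + f x)\<^sup>2" and \<epsilon>: "\<epsilon> \<ge> 0"
    and d: "d > 0" "real N * d = 2 * R" "pi * (1 + \<alpha>) \<le> real M * d"
    and \<phi>: "\<phi> \<in> test_functions (waveguide f)"
  shows "(1 - \<epsilon>) * (LINT p|lborel. (norm (\<phi> p))\<^sup>2) \<le> (1 + d\<^sup>2) * Re (dirichlet_form (waveguide f) \<phi> \<phi>) +
    (1 / d\<^sup>2) * (\<Sum>ij\<in>{..<N} \<times> {..<M}. (norm (LINT p:cell R d ij|lborel. \<phi> p))\<^sup>2)"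
proof -
  let ?\<Omega> = "waveguide f"
  have \<Omega>: "open ?\<Omega>" by (rule open_waveguide[OF f(1)])
  define ux where "ux p = frechet_derivative \<phi> (at p) (1, 0)" for p
  define uy where "uy p = frechet_derivative \<phi> (at p) (0, 1)" for p
  have T: "ux \<in> test_functions ?\<Omega>" "uy \<in> test_functions ?\<Omega>"
    unfolding ux_def[abs_def] uy_def[abs_def] using plane_Basis by (auto intro: test_partial[OF \<phi>])
  note ns = test_norm_sq_integrable
  define D where "D = (LINT p|lborel. (norm (ux p))\<^sup>2) + (LINT p|lborel. (norm (uy p))\<^sup>2)"
  have D: "Re (dirichlet_form ?\<Omega> \<phi> \<phi>) = D"
    unfolding test_dirichlet_form[OF \<Omega> \<phi>] D_def ux_def uy_def plane_Basis(3) by simp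
  let ?S = "{- R..<- R + real N * d} \<times> {0..<real M * d}"
  have S: "?S \<in> sets borel" by (intro borel_Times) auto
  have cell_le: "(LINT p:cell R d ij|lborel. (norm (\<phi> p))\<^sup>2) \<le>
      d\<^sup>2 * (LINT p:cell R d ij|lborel. (norm (ux p))\<^sup>2 + (norm (uy p))\<^sup>2) +
      (1 / d\<^sup>2) * (norm (LINT p:cell R d ij|lborel. \<phi> p))\<^sup>2" for ij
  proof -
    have si: "set_integrable lborel (cell R d ij) (\<lambda>p. (norm (u p))\<^sup>2)" if "u \<in> test_functions ?\<Omega>" for u
      unfolding set_integrable_def using ns[OF that] cell_borel by (intro integrable_mult_indicator) auto
    show ?thesis
      using cell_poincare[OF \<phi> d(1), of "- R + real (fst ij) * d" "0 + real (snd ij) * d"]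
      unfolding set_integral_add(2)[OF si[OF T(1)] si[OF T(2)]]
      by (simp add: cell_def ux_def uy_def)
  qed
  have S_le: "(LINT p:?S|lborel. F p) \<le> (LINT p|lborel. F p)" if "integrable lborel F" "\<And>p. 0 \<le> F p"
    for F :: "real \<times> real \<Rightarrow> real"
    unfolding set_lebesgue_integral_def using that S
    by (intro integral_mono integrable_mult_indicator) (auto simp: indicator_def)
  have "(LINT p:?S|lborel. (norm (\<phi> p))\<^sup>2) = (\<Sum>ij\<in>{..<N} \<times> {..<M}. LINT p:cell R d ij|lborel. (norm (\<phi> p))\<^sup>2)"
    by (rule sum_cells[OF d(1) ns[OF \<phi>], symmetric])
  also have "\<dots> \<le> (\<Sum>ij\<in>{..<N} \<times> {..<M}. d\<^sup>2 * (LINT p:cell R d ij|lborel. (norm (ux p))\<^sup>2 + (norm (uy p))\<^sup>2) +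
      (1 / d\<^sup>2) * (norm (LINT p:cell R d ij|lborel. \<phi> p))\<^sup>2)"
    by (intro sum_mono cell_le)
  also have "\<dots> = d\<^sup>2 * (LINT p:?S|lborel. (norm (ux p))\<^sup>2 + (norm (uy p))\<^sup>2) +
      (1 / d\<^sup>2) * (\<Sum>ij\<in>{..<N} \<times> {..<M}. (norm (LINT p:cell R d ij|lborel. \<phi> p))\<^sup>2)"
    using sum_cells[OF d(1) Bochner_Integration.integrable_add[OF ns[OF T(1)] ns[OF T(2)]]]
    by (simp add: sum.distrib sum_divide_distrib flip: sum_distrib_left)
  also have "\<dots> \<le> d\<^sup>2 * D + (1 / d\<^sup>2) * (\<Sum>ij\<in>{..<N} \<times> {..<M}. (norm (LINT p:cell R d ij|lborel. \<phi> p))\<^sup>2)"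
  proof -
    have "(LINT p:?S|lborel. (norm (ux p))\<^sup>2 + (norm (uy p))\<^sup>2) \<le> (LINT p|lborel. (norm (ux p))\<^sup>2 + (norm (uy p))\<^sup>2)"
      using ns[OF T(1)] ns[OF T(2)] by (intro S_le) auto
    also have "\<dots> = D" unfolding D_def using ns[OF T(1)] ns[OF T(2)] by simp
    finally show ?thesis using d by (intro add_right_mono mult_left_mono) auto
  qed
  finally have strip: "(LINT p:?S|lborel. (norm (\<phi> p))\<^sup>2) \<le>
      d\<^sup>2 * D + (1 / d\<^sup>2) * (\<Sum>ij\<in>{..<N} \<times> {..<M}. (norm (LINT p:cell R d ij|lborel. \<phi> p))\<^sup>2)" .
  have iS: "integrable lborel (\<lambda>p. indicator ?S p *\<^sub>R (norm (\<phi> p))\<^sup>2)"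
    using S ns[OF \<phi>] by (intro integrable_mult_indicator) auto
  have pw: "(1 - \<epsilon>) * (norm (\<phi> p))\<^sup>2 \<le> (norm (\<phi> p))\<^sup>2 / (1 + f (fst p))\<^sup>2 + indicator ?S p *\<^sub>R (norm (\<phi> p))\<^sup>2" for p
  proof -
    obtain x y where p: "p = (x, y)" by (cases p)
    \<comment> \<open>Far out the transverse term suffices; nearer, the point lies in the tiled
      rectangle, whose indicator contributes the full square.\<close>
    consider "p \<notin> ?\<Omega>" | "\<bar>x\<bar> \<ge> R" | "p \<in> ?\<Omega>" "\<bar>x\<bar> < R" by linarith
    then show ?thesis
    proof cases
      case 1
      then show ?thesis using test_zero[OF \<phi>] by simp
    next
      case 2
      have "(1 - \<epsilon>) * (norm (\<phi> p))\<^sup>2 \<le> 1 / (1 + f x)\<^sup>2 * (norm (\<phi> p))\<^sup>2"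
        by (rule mult_right_mono[OF tail[OF 2]]) simp
      also have "\<dots> = (norm (\<phi> p))\<^sup>2 / (1 + f (fst p))\<^sup>2" by (simp add: p)
      moreover have "0 \<le> indicator ?S p *\<^sub>R (norm (\<phi> p))\<^sup>2" by simp
      ultimately show ?thesis by linarith
    next
      case 3
      have "pi + pi * f x \<le> pi * (1 + \<alpha>)" using f(3)[of x] by (simp add: distrib_left)
      then have "y < real M * d" "0 < y" using 3 d(3) by (auto simp: p waveguide_def)
      then have "p \<in> ?S" using 3 d(2) by (auto simp: p)
      then have "(1 - \<epsilon>) * (norm (\<phi> p))\<^sup>2 \<le> indicator ?S p *\<^sub>R (norm (\<phi> p))\<^sup>2"
        using \<epsilon> by (simp add: mult_le_cancel_right2)
      moreover have "0 \<le> (norm (\<phi> p))\<^sup>2 / (1 + f (fst p))\<^sup>2" by simp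
      ultimately show ?thesis by linarith
    qed
  qed
  have "(1 - \<epsilon>) * (LINT p|lborel. (norm (\<phi> p))\<^sup>2) = (LINT p|lborel. (1 - \<epsilon>) * (norm (\<phi> p))\<^sup>2)" by simp
  also have "\<dots> \<le> (LINT p|lborel. (norm (\<phi> p))\<^sup>2 / (1 + f (fst p))\<^sup>2 + indicator ?S p *\<^sub>R (norm (\<phi> p))\<^sup>2)"
    using pw by (intro integral_mono integrable_mult_right ns[OF \<phi>] Bochner_Integration.integrable_add
        transverse_poincare(1)[OF f(1,2) \<phi>] iS)
  also have "\<dots> = (LINT p|lborel. (norm (\<phi> p))\<^sup>2 / (1 + f (fst p))\<^sup>2) + (LINT p:?S|lborel. (norm (\<phi> p))\<^sup>2)"
    unfolding set_lebesgue_integral_def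
    by (rule Bochner_Integration.integral_add[OF transverse_poincare(1)[OF f(1,2) \<phi>] iS])
  also have "(LINT p|lborel. (norm (\<phi> p))\<^sup>2 / (1 + f (fst p))\<^sup>2) \<le> D"
  proof -
    have "0 \<le> (LINT p|lborel. (norm (ux p))\<^sup>2)" by (intro integral_nonneg_AE) auto
    then show ?thesis using transverse_poincare(2)[OF f(1,2) \<phi>] unfolding D_def uy_def by linarith
  qed
  finally show ?thesis using strip unfolding D by (simp add: distrib_right)
qed

section \<open>Passing from test functions to the whole form domain\<close>

lemma indicator_cell_L2:
  assumes \<Omega>: "open \<Omega>"
  shows "(\<lambda>p. complex_of_real (indicator (cell R d ij) p)) \<in> L2_space \<Omega>"
proof -
  let ?c = "cell R d ij"
  have b: "bounded ?c" unfolding cell_def by (intro bounded_Times) auto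
  have m: "(\<lambda>p. complex_of_real (indicator ?c p)) \<in> borel_measurable (lebesgue_on \<Omega>)"
  proof (rule borel_lebesgue_on)
    have [measurable]: "?c \<in> sets borel" by (rule cell_borel)
    show "(\<lambda>p. complex_of_real (indicator ?c p)) \<in> borel_measurable borel" by measurable
  qed
  have "?c \<in> lmeasurable"
    using b cell_borel by (intro bounded_set_imp_lmeasurable) auto
  then have "integrable lebesgue (indicator ?c :: _ \<Rightarrow> real)" by (simp add: lmeasurable_iff_integrable)
  then have "integrable (lebesgue_on \<Omega>) (indicator ?c :: _ \<Rightarrow> real)"
    using \<Omega> integrable_mult_indicator[of \<Omega> lebesgue "indicator ?c :: _ \<Rightarrow> real"]
    by (subst integrable_restrict_space) auto
  moreover have "(norm (complex_of_real (indicator ?c p)))\<^sup>2 = (indicator ?c p :: real)" for p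
    by (simp add: indicator_def)
  ultimately show ?thesis using m by (simp add: L2_space_def)
qed

text \<open>Written as an inner product with an indicator, the integral over a cell becomes a
  bounded functional on all of L^2.\<close>

lemma cell_functional_test:
  assumes \<Omega>: "open \<Omega>" and \<phi>: "\<phi> \<in> test_functions \<Omega>"
  shows "L2_inner \<Omega> \<phi> (\<lambda>p. complex_of_real (indicator (cell R d ij) p)) = (LINT p:cell R d ij|lborel. \<phi> p)"
proof -
  have [measurable]: "cell R d ij \<in> sets borel" by (rule cell_borel)
  have [measurable]: "\<phi> \<in> borel_measurable borel" by (rule test_borel[OF \<phi>])
  have "L2_inner \<Omega> \<phi> (\<lambda>p. complex_of_real (indicator (cell R d ij) p)) =
      (LINT p|lebesgue_on \<Omega>. \<phi> p * complex_of_real (indicator (cell R d ij) p))"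
    by (simp add: L2_inner_def)
  also have "\<dots> = (LINT p|lborel. \<phi> p * complex_of_real (indicator (cell R d ij) p))"
    by (rule lebesgue_on_lborel(2)[OF \<Omega>]) (auto simp: test_zero[OF \<phi>])
  finally show ?thesis by (simp add: set_lebesgue_integral_def scaleR_conv_of_real mult.commute)
qed

text \<open>With \<epsilon> = (1 - \<mu>) / 2 and d^2 at most \<epsilon> one has \<mu> (1 + d^2)
  \<le> 1 - \<epsilon>, so dividing \<open>test_compactness\<close> by 1 + d^2 leaves \<mu> on the
  left. All terms are continuous along energy-convergent sequences, hence the inequality passes from
  test functions to \<open>H10_space\<close>.\<close>

theorem waveguide_compactness:
  fixes f :: "real \<Rightarrow> real"
  assumes f: "continuous_on UNIV f" "\<And>x. 0 \<le> f x" "\<And>x. f x \<le> \<alpha>" "(f \<longlongrightarrow> 0) at_infinity"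
    and \<mu>: "0 < \<mu>" "\<mu> < 1"
  defines "\<Omega> \<equiv> waveguide f"
  shows "\<exists>(I :: (nat \<times> nat) set) g C. finite I \<and> (\<forall>i\<in>I. g i \<in> L2_space \<Omega>) \<and>
     (\<forall>u\<in>H10_space \<Omega>. \<mu> * L2.nsq \<Omega> u \<le>
        Re (dirichlet_form \<Omega> u u) + C * (\<Sum>i\<in>I. (cmod (L2_inner \<Omega> u (g i)))\<^sup>2))"
proof -
  have \<Omega>: "open \<Omega>" unfolding \<Omega>_def by (rule open_waveguide[OF f(1)])
  interpret V: semi_inner cscale "H10_space \<Omega>" "dirichlet_form \<Omega>" by (rule H10_semi_inner[OF \<Omega>])
  define \<epsilon> where "\<epsilon> = (1 - \<mu>) / 2"
  have \<epsilon>: "0 < \<epsilon>" "\<epsilon> < 1" using \<mu> by (auto simp: \<epsilon>_def)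
  have "((\<lambda>x. 1 / (1 + f x)\<^sup>2) \<longlongrightarrow> 1 / (1 + 0)\<^sup>2) at_infinity" by (intro tendsto_intros f) auto
  then have "\<forall>\<^sub>F x in at_infinity. 1 - \<epsilon> < 1 / (1 + f x)\<^sup>2" using \<epsilon> by (intro order_tendstoD) auto
  then obtain R0 where R0: "\<And>x. norm x \<ge> R0 \<Longrightarrow> 1 - \<epsilon> < 1 / (1 + f x)\<^sup>2"
    by (auto simp: eventually_at_infinity)
  define R where "R = max R0 1"
  have R: "R > 0" and tail: "\<And>x. \<bar>x\<bar> \<ge> R \<Longrightarrow> 1 - \<epsilon> \<le> 1 / (1 + f x)\<^sup>2"
    using R0 by (auto simp: R_def intro: less_imp_le)
  \<comment> \<open>N is a whole number of squares across the length 2 R, large enough that the side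
    d = 2 R / N is below sqrt \<epsilon>.\<close>
  obtain N :: nat where N: "2 * R / sqrt \<epsilon> < real N" using reals_Archimedean2 by blast
  have N0: "real N > 0" using N R \<epsilon> by (meson divide_pos_pos less_trans mult_pos_pos real_sqrt_gt_zero zero_less_numeral)
  define d where "d = 2 * R / real N"
  have d: "d > 0" "real N * d = 2 * R" using N0 R by (auto simp: d_def)
  have "d < sqrt \<epsilon>" using N N0 \<epsilon> by (simp add: d_def field_simps)
  then have "d\<^sup>2 \<le> (sqrt \<epsilon>)\<^sup>2" using d by (intro power_mono) auto
  then have d2: "d\<^sup>2 \<le> \<epsilon>" using \<epsilon> by simp
  obtain M :: nat where "pi * (1 + \<alpha>) / d < real M" using reals_Archimedean2 by blast
  then have M: "pi * (1 + \<alpha>) \<le> real M * d" using d by (simp add: field_simps)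
  define I where "I = {..<N} \<times> {..<M}"
  define g where "g ij = (\<lambda>p. complex_of_real (indicator (cell R d ij) p))" for ij
  have g: "g ij \<in> L2_space \<Omega>" for ij unfolding g_def by (rule indicator_cell_L2[OF \<Omega>])
  define C where "C = 1 / d\<^sup>2"
  have C: "C \<ge> 0" by (simp add: C_def)
  define Q where "Q u = C * (\<Sum>i\<in>I. (cmod (L2_inner \<Omega> u (g i)))\<^sup>2)" for u
  have Q0: "Q u \<ge> 0" for u unfolding Q_def using C by (intro mult_nonneg_nonneg sum_nonneg) auto
  have test: "\<mu> * L2.nsq \<Omega> \<phi> \<le> V.nsq \<phi> + Q \<phi>" if \<phi>: "\<phi> \<in> test_functions \<Omega>" for \<phi>
  proof -
    have n: "L2.nsq \<Omega> \<phi> = (LINT p|lborel. (norm (\<phi> p))\<^sup>2)"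
      using test_integral_eq(2)[OF \<Omega> \<phi>] by (simp add: L2_nsq)
    have nn: "0 \<le> L2.nsq \<Omega> \<phi>" by (rule L2.nsq_ge0[OF test_L2[OF \<Omega> \<phi>]])
    have "(1 - \<epsilon>) * L2.nsq \<Omega> \<phi> \<le> (1 + d\<^sup>2) * V.nsq \<phi> + Q \<phi>"
      using test_compactness[OF f(1-3) tail _ d M \<phi>[unfolded \<Omega>_def], folded \<Omega>_def] \<epsilon>
      unfolding n V.nsq_def Q_def g_def C_def I_def cell_functional_test[OF \<Omega> \<phi>] by simp
    \<comment> \<open>Enlarging the nonnegative term Q by the same factor allows the division by 1 +
      d^2 below.\<close>
    also have "\<dots> \<le> (1 + d\<^sup>2) * (V.nsq \<phi> + Q \<phi>)" using Q0[of \<phi>] by (simp add: distrib_left distrib_right)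
    finally have *: "(1 - \<epsilon>) * L2.nsq \<Omega> \<phi> \<le> (1 + d\<^sup>2) * (V.nsq \<phi> + Q \<phi>)" .
    have "\<mu> * d\<^sup>2 \<le> 1 * \<epsilon>" using \<mu> d2 by (intro mult_mono) auto
    moreover have "\<mu> + \<epsilon> = 1 - \<epsilon>" by (simp add: \<epsilon>_def field_simps)
    ultimately have "\<mu> * (1 + d\<^sup>2) \<le> 1 - \<epsilon>" unfolding distrib_left by linarith
    then have "\<mu> * (1 + d\<^sup>2) * L2.nsq \<Omega> \<phi> \<le> (1 - \<epsilon>) * L2.nsq \<Omega> \<phi>" using nn by (rule mult_right_mono)
    then have "(1 + d\<^sup>2) * (\<mu> * L2.nsq \<Omega> \<phi>) \<le> (1 + d\<^sup>2) * (V.nsq \<phi> + Q \<phi>)" using * by (simp add: algebra_simps)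
    moreover have "0 < 1 + d\<^sup>2" by (simp add: add_pos_nonneg)
    ultimately show ?thesis by simp
  qed
  have "\<mu> * L2.nsq \<Omega> u \<le> V.nsq u + Q u" if u: "u \<in> H10_space \<Omega>" for u
  proof -
    obtain \<phi> :: "nat \<Rightarrow> _" where \<phi>: "\<And>n. \<phi> n \<in> test_functions \<Omega>"
       "(\<lambda>n. L2.nrm \<Omega> (\<phi> n - u)) \<longlonglongrightarrow> 0" "(\<lambda>n. grad_nrm \<Omega> (\<phi> n - u)) \<longlonglongrightarrow> 0"
      using u unfolding H10_iff[OF \<Omega>] by blast
    have uL: "u \<in> L2_space \<Omega>" using u by (intro H1_L2 H10_H1)
    have \<phi>L: "\<phi> n \<in> L2_space \<Omega>" for n using test_L2[OF \<Omega> \<phi>(1)] .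
    have \<phi>V: "\<phi> n \<in> H10_space \<Omega>" for n using test_H10[OF \<Omega> \<phi>(1)] .
    have "(\<lambda>n. \<mu> * L2.nsq \<Omega> (\<phi> n)) \<longlonglongrightarrow> \<mu> * L2.nsq \<Omega> u"
      by (intro tendsto_intros L2.nsq_tendsto \<phi>L uL \<phi>(2))
    moreover have "(\<lambda>n. V.nsq (\<phi> n) + Q (\<phi> n)) \<longlonglongrightarrow> V.nsq u + Q u"
      unfolding Q_def using \<phi>(3)
      by (intro tendsto_intros V.nsq_tendsto L2.ip_tendsto_left \<phi>L \<phi>V u uL \<phi>(2) g) (simp add: grad_nrm_eq[OF \<Omega>])
    ultimately show ?thesis by (rule LIMSEQ_le) (use test[OF \<phi>(1)] in blast)
  qed
  then show ?thesis
    unfolding Q_def V.nsq_def using g by (intro exI[of _ I] exI[of _ g] exI[of _ C]) (auto simp: I_def)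
qed

subsection \<open>The trial function\<close>

text \<open>A smooth substitute for the identity on the positive axis that vanishes up to 1 / Suc n.
  Because of the factor u - 1 / Suc n the derivative depends only on v = Suc n * u - 1, so it can be
  bounded uniformly in n.\<close>

definition soft_pos :: "nat \<Rightarrow> real \<Rightarrow> real" where
  "soft_pos n u = (u - 1 / Suc n) * flat (real (Suc n) * u - 1)"

definition soft_pos' :: "nat \<Rightarrow> real \<Rightarrow> real" where
  "soft_pos' n u = (let v = real (Suc n) * u - 1 in if 0 < v then exp (- 1 / v) * (1 + 1 / v) else 0)"

lemma smooth_soft_pos: "smooth (soft_pos n)"
  unfolding soft_pos_def[abs_def]
  by (intro smooth_mult smooth_diff smooth_const smooth_compose[OF smooth_flat]
      smooth_linear[OF bounded_linear_ident])

lemma soft_pos_derivative: "(soft_pos n has_real_derivative soft_pos' n u) (at u)"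
proof -
  let ?v = "real (Suc n) * u - 1"
  let ?fl' = "if 0 < ?v then exp (- 1 / ?v) / ?v\<^sup>2 else 0"
  have lin: "((\<lambda>u. real (Suc n) * u - 1) has_real_derivative real (Suc n)) (at u)"
    by (auto intro!: derivative_eq_intros)
  have "((\<lambda>u. flat (real (Suc n) * u - 1)) has_real_derivative ?fl' * real (Suc n)) (at u)"
    using DERIV_chain2[OF flat_derivative lin] .
  moreover have "((\<lambda>u. u - 1 / real (Suc n)) has_real_derivative 1) (at u)"
    by (auto intro!: derivative_eq_intros)
  ultimately have "(soft_pos n has_real_derivative
      1 * flat ?v + ?fl' * real (Suc n) * (u - 1 / real (Suc n))) (at u)"
    unfolding soft_pos_def[abs_def] by (rule DERIV_mult[rotated])
  moreover have "1 * flat ?v + ?fl' * real (Suc n) * (u - 1 / real (Suc n)) = soft_pos' n u"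
  proof -
    have "real (Suc n) * (u - 1 / real (Suc n)) = ?v" by (simp add: right_diff_distrib)
    then have "1 * flat ?v + ?fl' * real (Suc n) * (u - 1 / real (Suc n)) = flat ?v + ?fl' * ?v"
      by (simp only: mult.assoc mult_1)
    also have "\<dots> = soft_pos' n u"
      by (simp add: soft_pos'_def flat_def Let_def distrib_left power2_eq_square del: of_nat_Suc)
    finally show ?thesis .
  qed
  ultimately show ?thesis by simp
qed

lemma soft_pos_zero:
  assumes "u \<le> 1 / Suc n"
  shows "soft_pos n u = 0"
proof -
  have "real (Suc n) * u - 1 \<le> 0" using assms by (simp add: field_simps)
  then have "flat (real (Suc n) * u - 1) = 0" using flat_bounds(3) by blast
  then show ?thesis by (simp add: soft_pos_def)
qed

lemma soft_pos_bounds: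
  assumes "0 \<le> u"
  shows "\<bar>soft_pos n u\<bar> \<le> u"
proof (cases "u \<le> 1 / Suc n")
  case False
  then have "0 \<le> u - 1 / Suc n" "u - 1 / Suc n \<le> u" by auto
  then show ?thesis unfolding soft_pos_def abs_mult
    using flat_bounds[of "real (Suc n) * u - 1"] mult_mono[of "u - 1 / Suc n" u "flat (real (Suc n) * u - 1)" 1] assms
    by simp
qed (use assms in \<open>simp add: soft_pos_zero\<close>)

text \<open>On the positive side this is 1 + s \<le> exp s with s = 1 / v.\<close>

lemma soft_pos'_bounds: "\<bar>soft_pos' n u\<bar> \<le> 1"
proof -
  have "exp (- 1 / v) * (1 + 1 / v) \<le> 1" if v: "v > 0" for v :: real
  proof -
    have "exp (- 1 / v) * (1 + 1 / v) \<le> exp (- 1 / v) * exp (1 / v)"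
      by (intro mult_left_mono exp_ge_add_one_self) auto
    then show ?thesis by (simp flip: exp_add)
  qed
  then show ?thesis by (auto simp: soft_pos'_def Let_def abs_mult)
qed

lemma soft_pos_arg_tendsto: "u > 0 \<Longrightarrow> filterlim (\<lambda>n. real (Suc n) * u - 1) at_top sequentially"
  by real_asymp

lemma soft_pos_tendsto:
  assumes u: "u > 0"
  shows "(\<lambda>n. soft_pos n u) \<longlonglongrightarrow> u"
proof -
  have "((\<lambda>v::real. exp (- 1 / v)) \<longlongrightarrow> 1) at_top" by real_asymp
  from filterlim_compose[OF this soft_pos_arg_tendsto[OF u]]
  have e: "(\<lambda>n. exp (- 1 / (real (Suc n) * u - 1))) \<longlonglongrightarrow> 1" .
  have "(\<lambda>n. (u - 1 / Suc n) * exp (- 1 / (real (Suc n) * u - 1))) \<longlonglongrightarrow> (u - 0) * 1"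
    by (intro tendsto_mult tendsto_diff tendsto_const e LIMSEQ_Suc[OF lim_1_over_n])
  moreover have "\<forall>\<^sub>F n in sequentially. 0 < real (Suc n) * u - 1"
    using filterlim_at_top_dense[THEN iffD1, OF soft_pos_arg_tendsto[OF u]] by blast
  ultimately show ?thesis
    by (auto elim!: Lim_transform_eventually elim: eventually_mono simp: soft_pos_def flat_def)
qed

lemma soft_pos'_tendsto:
  assumes u: "u > 0"
  shows "(\<lambda>n. soft_pos' n u) \<longlonglongrightarrow> 1"
proof -
  have "((\<lambda>v::real. exp (- 1 / v) * (1 + 1 / v)) \<longlongrightarrow> 1) at_top" by real_asymp
  from filterlim_compose[OF this soft_pos_arg_tendsto[OF u]]
  have e: "(\<lambda>n. exp (- 1 / (real (Suc n) * u - 1)) * (1 + 1 / (real (Suc n) * u - 1))) \<longlonglongrightarrow> 1" .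
  moreover have "\<forall>\<^sub>F n in sequentially. 0 < real (Suc n) * u - 1"
    using filterlim_at_top_dense[THEN iffD1, OF soft_pos_arg_tendsto[OF u]] by blast
  ultimately show ?thesis
    by (auto elim!: Lim_transform_eventually elim: eventually_mono simp: soft_pos'_def Let_def)
qed

text \<open>The transverse ground state sin on (0, pi), modified near the end points so that its
  support becomes a compact subset of the open interval, as a test function requires.\<close>

definition profile :: "nat \<Rightarrow> real \<Rightarrow> real" where
  "profile n t = (if t \<in> {0<..<pi} then soft_pos n (sin t) else 0)"

definition profile' :: "nat \<Rightarrow> real \<Rightarrow> real" where
  "profile' n t = (if t \<in> {0<..<pi} then soft_pos' n (sin t) * cos t else 0)"

definition profile_support :: "nat \<Rightarrow> real set" where
  "profile_support n = {t \<in> {0..pi}. 1 / Suc n \<le> sin t}"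

lemma compact_profile_support: "compact (profile_support n)"
proof -
  have "closed {t::real. 1 / Suc n \<le> sin t}" by (intro closed_Collect_le continuous_intros)
  then have "compact ({0..pi} \<inter> {t. 1 / Suc n \<le> sin t})" by (intro compact_Int_closed) auto
  then show ?thesis by (simp add: profile_support_def Int_def)
qed

lemma profile_support_subset: "profile_support n \<subseteq> {0<..<pi}"
proof
  fix t assume t: "t \<in> profile_support n"
  then have "sin t > 0" by (auto simp: profile_support_def intro: less_le_trans[of 0 "1 / Suc n"])
  then have "t \<noteq> 0" "t \<noteq> pi" by auto
  then show "t \<in> {0<..<pi}" using t by (auto simp: profile_support_def)
qed

lemma profile_zero: "t \<notin> profile_support n \<Longrightarrow> profile n t = 0"
  by (auto simp: profile_def profile_support_def soft_pos_zero)

lemma profile'_zero: "t \<notin> profile_support n \<Longrightarrow> profile' n t = 0"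
  by (auto simp: profile'_def profile_support_def soft_pos'_def Let_def field_simps not_le)

lemma smooth_profile: "smooth (profile n)"
  unfolding profile_def[abs_def]
  using compact_imp_closed[OF compact_profile_support] profile_support_subset
  by (intro smooth_restrict[where C = "profile_support n"] smooth_compose[OF smooth_soft_pos] smooth_sin)
     (auto simp: profile_support_def soft_pos_zero)

lemma profile_derivative: "(profile n has_real_derivative profile' n t) (at t)"
proof (cases "t \<in> {0<..<pi}")
  case True
  have "((\<lambda>t. soft_pos n (sin t)) has_real_derivative soft_pos' n (sin t) * cos t) (at t)"
    by (rule DERIV_chain2[OF soft_pos_derivative DERIV_sin])
  then have "(profile n has_real_derivative soft_pos' n (sin t) * cos t) (at t)"
    by (rule has_field_derivative_transform_within_open[where S = "{0<..<pi}"])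
       (use True in \<open>auto simp: profile_def\<close>)
  then show ?thesis using True by (simp add: profile'_def)
next
  case False
  have "((\<lambda>t. 0) has_real_derivative 0) (at t)" by simp
  then have "(profile n has_real_derivative 0) (at t)"
    by (rule has_field_derivative_transform_within_open[where S = "- profile_support n"])
       (use False compact_imp_closed[OF compact_profile_support] profile_support_subset[of n]
          in \<open>auto simp: profile_zero\<close>)
  then show ?thesis using False by (auto simp: profile'_def)
qed

lemma profile_bounds: "\<bar>profile n t\<bar> \<le> 1" "\<bar>profile' n t\<bar> \<le> 1"
proof -
  show "\<bar>profile n t\<bar> \<le> 1"
    using order_trans[OF soft_pos_bounds[of "sin t" n] sin_le_one] sin_gt_zero[of t] by (auto simp: profile_def)
  have "\<bar>soft_pos' n (sin t)\<bar> * \<bar>cos t\<bar> \<le> 1 * 1" by (intro mult_mono soft_pos'_bounds) auto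
  then show "\<bar>profile' n t\<bar> \<le> 1" by (simp add: profile'_def abs_mult)
qed

lemma profile_tendsto:
  "(\<lambda>n. profile n t) \<longlonglongrightarrow> (if t \<in> {0<..<pi} then sin t else 0)"
  "(\<lambda>n. profile' n t) \<longlonglongrightarrow> (if t \<in> {0<..<pi} then cos t else 0)"
proof -
  show "(\<lambda>n. profile n t) \<longlonglongrightarrow> (if t \<in> {0<..<pi} then sin t else 0)"
    using soft_pos_tendsto[of "sin t"] sin_gt_zero[of t] by (auto simp: profile_def)
  show "(\<lambda>n. profile' n t) \<longlonglongrightarrow> (if t \<in> {0<..<pi} then cos t else 0)"
    using tendsto_mult[OF soft_pos'_tendsto[of "sin t"] tendsto_const[of "cos t"]] sin_gt_zero[of t]
    by (auto simp: profile'_def)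
qed

lemma profile_zero_outside: "t \<notin> {0..pi} \<Longrightarrow> profile n t = 0" "t \<notin> {0..pi} \<Longrightarrow> profile' n t = 0"
  by (auto simp: profile_def profile'_def)

lemma profile_measurable [measurable]: "profile n \<in> borel_measurable borel" "profile' n \<in> borel_measurable borel"
proof -
  show "profile n \<in> borel_measurable borel"
    by (intro borel_measurable_continuous_onI smooth_imp_continuous smooth_profile)
  have "continuous_on UNIV (\<lambda>t. frechet_derivative (profile n) (at t) 1)"
    by (intro smooth_imp_continuous smooth_frechet smooth_profile) simp
  moreover have "frechet_derivative (profile n) (at t) 1 = profile' n t" for t
    using frechet_derivative_at[OF profile_derivative[unfolded has_field_derivative_def], symmetric] by simp
  ultimately show "profile' n \<in> borel_measurable borel"
    by (simp add: borel_measurable_continuous_onI)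
qed

text \<open>The energies A0, A1, A2 of \<open>trial_energy\<close> are integrals of (p s + q s')^2
  with (p, q) equal to (1, 0), (0, 1) and (1/2, t). Dominated convergence replaces the profile by
  the sine, and the primitive P evaluates the limit.\<close>

lemma profile_quadratic_integrals:
  fixes p q :: "real \<Rightarrow> real"
  assumes [measurable]: "p \<in> borel_measurable borel" "q \<in> borel_measurable borel"
    and bd: "\<And>t. t \<in> {0..pi} \<Longrightarrow> \<bar>p t\<bar> \<le> B" "\<And>t. t \<in> {0..pi} \<Longrightarrow> \<bar>q t\<bar> \<le> B"
    and P: "\<And>t. (P has_real_derivative (p t * sin t + q t * cos t)\<^sup>2) (at t)"
  shows "integrable lborel (\<lambda>t. (p t * profile n t + q t * profile' n t)\<^sup>2)"
    and "(\<lambda>n. LINT t|lborel. (p t * profile n t + q t * profile' n t)\<^sup>2) \<longlonglongrightarrow> P pi - P 0"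
proof -
  let ?F = "\<lambda>t. indicator {0..pi} t * (p t * sin t + q t * cos t)\<^sup>2"
  have dom: "integrable lborel (\<lambda>t. (2 * B)\<^sup>2 * indicator {0..pi} t :: real)"
    by (intro integrable_mult_right integrable_real_indicator) auto
  have le: "norm ((p t * profile n t + q t * profile' n t)\<^sup>2) \<le> (2 * B)\<^sup>2 * indicator {0..pi} t" for n t
  proof (cases "t \<in> {0..pi}")
    case True
    have "\<bar>p t * profile n t + q t * profile' n t\<bar> \<le> \<bar>p t\<bar> * \<bar>profile n t\<bar> + \<bar>q t\<bar> * \<bar>profile' n t\<bar>"
      using abs_triangle_ineq[of "p t * profile n t" "q t * profile' n t"] by (simp add: abs_mult)
    also have "\<dots> \<le> B * 1 + B * 1"
      using bd[OF True] profile_bounds[of n t] by (intro add_mono mult_mono) (auto intro: order_trans[OF abs_ge_zero])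
    finally have "\<bar>p t * profile n t + q t * profile' n t\<bar>\<^sup>2 \<le> (2 * B)\<^sup>2" by (intro power_mono) auto
    then show ?thesis using True by simp
  qed (simp add: profile_zero_outside)
  show "integrable lborel (\<lambda>t. (p t * profile n t + q t * profile' n t)\<^sup>2)"
    by (rule Bochner_Integration.integrable_bound[OF dom]) (use le in \<open>auto intro: order_trans[OF _ abs_ge_self]\<close>)
  have "(\<lambda>n. LINT t|lborel. (p t * profile n t + q t * profile' n t)\<^sup>2) \<longlonglongrightarrow> (LINT t|lborel. ?F t)"
  proof (rule integral_dominated_convergence[OF _ _ dom])
    \<comment> \<open>The end points are excluded because the profiles have derivative 0 there,
      whereas the cosine is 1 or -1.\<close>
    have "AE t in lborel. t \<noteq> 0 \<and> t \<noteq> pi" using AE_lborel_singleton[of 0] AE_lborel_singleton[of pi] by eventually_elim simp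
    then show "AE t in lborel. (\<lambda>n. (p t * profile n t + q t * profile' n t)\<^sup>2) \<longlonglongrightarrow> ?F t"
    proof eventually_elim
      case (elim t)
      have "(\<lambda>n. (p t * profile n t + q t * profile' n t)\<^sup>2) \<longlonglongrightarrow>
         (p t * (if t \<in> {0<..<pi} then sin t else 0) + q t * (if t \<in> {0<..<pi} then cos t else 0))\<^sup>2"
        by (intro tendsto_intros profile_tendsto)
      then show ?case using elim by (auto simp: indicator_def split: if_splits)
    qed
    show "AE t in lborel. norm ((p t * profile n t + q t * profile' n t)\<^sup>2) \<le> (2 * B)\<^sup>2 * indicator {0..pi} t" for n
      using le by (intro always_eventually allI)
  qed measurable
  also have "(LINT t|lborel. ?F t) = P pi - P 0"
  proof -
    have "set_integrable lborel {0..pi} (\<lambda>t. (p t * sin t + q t * cos t)\<^sup>2)"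
      unfolding set_integrable_def
    proof (rule Bochner_Integration.integrable_bound[OF dom])
      show "AE t in lborel. norm (indicator {0..pi} t *\<^sub>R (p t * sin t + q t * cos t)\<^sup>2) \<le> norm ((2 * B)\<^sup>2 * indicator {0..pi} t)"
      proof (intro always_eventually allI)
        fix t
        show "norm (indicator {0..pi} t *\<^sub>R (p t * sin t + q t * cos t)\<^sup>2) \<le> norm ((2 * B)\<^sup>2 * indicator {0..pi} t)"
        proof (cases "t \<in> {0..pi}")
          case True
          have "\<bar>p t * sin t + q t * cos t\<bar> \<le> \<bar>p t\<bar> * \<bar>sin t\<bar> + \<bar>q t\<bar> * \<bar>cos t\<bar>"
            using abs_triangle_ineq[of "p t * sin t" "q t * cos t"] by (simp add: abs_mult)
          also have "\<dots> \<le> B * 1 + B * 1"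
            using bd[OF True] by (intro add_mono mult_mono) (auto intro: order_trans[OF abs_ge_zero])
          finally have "\<bar>p t * sin t + q t * cos t\<bar>\<^sup>2 \<le> (2 * B)\<^sup>2" by (intro power_mono) auto
          then show ?thesis using True by simp
        qed simp
      qed
    qed measurable
    then have "(LINT t:{0..pi}|lborel. (p t * sin t + q t * cos t)\<^sup>2) = integral {0..pi} (\<lambda>t. (p t * sin t + q t * cos t)\<^sup>2)"
      by (rule set_borel_integral_eq_integral(2))
    also have "\<dots> = P pi - P 0"
      using P by (intro integral_unique fundamental_theorem_of_calculus)
        (auto simp: has_real_derivative_iff_has_vector_derivative[symmetric] intro: DERIV_subset)
    finally show ?thesis by (simp add: set_lebesgue_integral_def)
  qed
  finally show "(\<lambda>n. LINT t|lborel. (p t * profile n t + q t * profile' n t)\<^sup>2) \<longlonglongrightarrow> P pi - P 0" .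
qed

text \<open>
  The trial function is \<open>g(x) h(x)\<^sup>-\<^sup>1\<^sup>/\<^sup>2 s(y / h(x))\<close> with \<open>h = 1 + f\<close>: the transverse ground state of
  the cross section, transported to width \<open>\<pi> h(x)\<close>, with a longitudinal cutoff \<open>g\<close>.
\<close>

lemma lborel_integral_scaled:
  fixes F :: "real \<Rightarrow> real"
  assumes "h > 0"
  shows "(LINT y|lborel. F (y / h)) = h * (LINT t|lborel. F t)"
  using lborel_integral_real_affine[of "1 / h" F 0] assms by (simp add: field_simps)

text \<open>The factor h^(-1/2) makes the squared norm of every slice A0 g^2, whatever the width.
  Differentiating it together with s(y / h) in x gives -(h' / h)(s / 2 + t s') at t = y / h. This is
  orthogonal to s, because s (s / 2 + t s') is the derivative of t s^2 / 2; hence no mixed term in g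
  g' survives.\<close>

lemma trial_energy:
  fixes f g s g' s' :: "real \<Rightarrow> real"
  assumes f: "smooth f" "\<And>x. 0 \<le> f x" and f': "\<And>x. (f has_real_derivative f' x) (at x)"
    and g: "smooth g" "\<And>x. (g has_real_derivative g' x) (at x)" "\<And>x. \<bar>x\<bar> \<ge> R \<Longrightarrow> g x = 0"
    and s: "smooth s" "\<And>t. (s has_real_derivative s' t) (at t)" "compact K" "K \<subseteq> {0<..<pi}"
       "\<And>t. t \<notin> K \<Longrightarrow> s t = 0" "\<And>t. t \<notin> K \<Longrightarrow> s' t = 0"
  defines "A0 \<equiv> LINT t|lborel. (s t)\<^sup>2" and "A1 \<equiv> LINT t|lborel. (s' t)\<^sup>2"
    and "A2 \<equiv> LINT t|lborel. (s t / 2 + t * s' t)\<^sup>2"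
  shows "\<exists>\<phi>\<in>test_functions (waveguide f).
      L2.nsq (waveguide f) \<phi> = A0 * (LINT x|lborel. (g x)\<^sup>2) \<and>
      Re (dirichlet_form (waveguide f) \<phi> \<phi>) = A0 * (LINT x|lborel. (g' x)\<^sup>2) +
        A1 * (LINT x|lborel. (g x)\<^sup>2 / (1 + f x)\<^sup>2) + A2 * (LINT x|lborel. (g x)\<^sup>2 * (f' x / (1 + f x))\<^sup>2)"
proof -
  let ?\<Omega> = "waveguide f"
  have \<Omega>: "open ?\<Omega>" by (rule open_waveguide[OF smooth_imp_continuous[OF f(1)]])
  define h where "h x = 1 + f x" for x
  have h: "h x > 0" "h x \<noteq> 0" for x using f(2)[of x] by (auto simp: h_def)
  have dh: "(h has_real_derivative f' x) (at x)" for x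
    unfolding h_def[abs_def] using f' by (auto intro!: derivative_eq_intros)
  have sh: "smooth h" unfolding h_def[abs_def] by (intro smooth_add f(1) smooth_const)
  define r where "r x = sqrt (1 / h x)" for x
  have r2: "(r x)\<^sup>2 = 1 / h x" for x using h[of x] by (simp add: r_def)
  have sr: "smooth r" unfolding r_def[abs_def] using h by (intro smooth_sqrt smooth_inverse sh) auto
  have dr: "(r has_real_derivative (- (r x * (f' x / h x) / 2))) (at x)" for x
  proof -
    have "(r has_real_derivative (inverse (sqrt (1 / h x)) / 2 * (- f' x / (h x * h x)))) (at x)"
      unfolding r_def[abs_def] using h[of x]
      by (auto intro!: derivative_eq_intros dh simp: field_simps)
    moreover have "inverse (sqrt (1 / h x)) / 2 * (- f' x / (h x * h x)) = - (r x * (f' x / h x) / 2)"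
    proof -
      have "inverse (sqrt (1 / h x)) = sqrt (1 / h x) * h x" using h[of x] by (simp add: real_sqrt_divide field_simps)
      then show ?thesis using h[of x] by (simp add: r_def)
    qed
    ultimately show ?thesis by simp
  qed
  define \<psi> where "\<psi> p = g (fst p) * r (fst p) * s (snd p / h (fst p))" for p :: "real \<times> real"
  define \<psi>x where "\<psi>x p = g' (fst p) * r (fst p) * s (snd p / h (fst p))
     - g (fst p) * r (fst p) * (f' (fst p) / h (fst p)) *
       (s (snd p / h (fst p)) / 2 + (snd p / h (fst p)) * s' (snd p / h (fst p)))" for p :: "real \<times> real"
  define \<psi>y where "\<psi>y p = g (fst p) * r (fst p) * (s' (snd p / h (fst p)) / h (fst p))" for p :: "real \<times> real"
  have s\<psi>: "smooth \<psi>"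
  proof -
    have fst: "smooth (\<lambda>p :: real \<times> real. fst p)" and snd: "smooth (\<lambda>p :: real \<times> real. snd p)"
      by (intro smooth_linear bounded_linear_fst bounded_linear_snd)+
    have "smooth (\<lambda>p :: real \<times> real. g (fst p) * r (fst p) * s (snd p * (1 / h (fst p))))"
      using h by (intro smooth_mult smooth_compose[OF s(1)] smooth_compose[OF g(1)] smooth_compose[OF sr]
          smooth_inverse smooth_compose[OF sh] fst snd) auto
    then show ?thesis by (simp add: \<psi>_def[abs_def])
  qed
  define \<phi> where "\<phi> p = complex_of_real (\<psi> p)" for p
  have s\<phi>: "smooth \<phi>" unfolding \<phi>_def[abs_def] by (rule smooth_complex_of_real[OF s\<psi>])
  \<comment> \<open>Replacing K by a closed interval confines the trial function between the graphs
    of a h and b h, which for |x| at most R bound a compact subset of the waveguide.\<close>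
  obtain a b where ab: "0 < a" "b < pi" "K \<subseteq> {a..b}"
  proof (cases "K = {}")
    case True
    then show ?thesis using that[of 1 1] pi_gt3 by auto
  next
    case False
    obtain a where a: "a \<in> K" "\<And>t. t \<in> K \<Longrightarrow> a \<le> t" using compact_attains_inf[OF s(3) False] by blast
    obtain b where b: "b \<in> K" "\<And>t. t \<in> K \<Longrightarrow> t \<le> b" using compact_attains_sup[OF s(3) False] by blast
    have "K \<subseteq> {a..b}" using a(2) b(2) by auto
    moreover have "0 < a" "b < pi" using a(1) b(1) s(4) by auto
    ultimately show ?thesis using that by blast
  qed
  have \<phi>T: "\<phi> \<in> test_functions ?\<Omega>"
  proof (rule test_functionsI[OF s\<phi>, of "{p. fst p \<in> {-R..R} \<and> a * h (fst p) \<le> snd p \<and> snd p \<le> b * h (fst p)}"])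
    let ?C = "{p. fst p \<in> {-R..R} \<and> a * h (fst p) \<le> snd p \<and> snd p \<le> b * h (fst p)}"
    have ch: "continuous_on UNIV (\<lambda>p::real \<times> real. h (fst p))"
      by (intro continuous_on_compose2[OF smooth_imp_continuous[OF sh, of UNIV]] continuous_intros) auto
    have "closed ({p::real \<times> real. - R \<le> fst p} \<inter> {p. fst p \<le> R} \<inter> {p. a * h (fst p) \<le> snd p} \<inter> {p. snd p \<le> b * h (fst p)})"
      by (intro closed_Int closed_Collect_le continuous_on_mult continuous_on_fst continuous_on_snd continuous_on_const continuous_on_id ch)
    moreover have "?C = {p. - R \<le> fst p} \<inter> {p. fst p \<le> R} \<inter> {p. a * h (fst p) \<le> snd p} \<inter> {p. snd p \<le> b * h (fst p)}"
      by auto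
    ultimately have cl: "closed ?C" by simp
    have "bounded (h ` {-R..R})"
      by (intro compact_imp_bounded compact_continuous_image smooth_imp_continuous[OF sh]) auto
    then obtain B where "\<And>y. y \<in> h ` {-R..R} \<Longrightarrow> norm y \<le> B" by (auto simp only: bounded_iff)
    then have B: "h x \<le> B" if "x \<in> {-R..R}" for x using that by (force simp: abs_le_iff)
    have "?C \<subseteq> {-R..R} \<times> {0..\<bar>b\<bar> * B}"
    proof
      fix p assume p: "p \<in> ?C"
      have "0 \<le> a * h (fst p)" using ab h[of "fst p"] by simp
      moreover have "b * h (fst p) \<le> \<bar>b\<bar> * B"
        using B[of "fst p"] p h[of "fst p"] by (intro mult_mono) auto
      ultimately show "p \<in> {-R..R} \<times> {0..\<bar>b\<bar> * B}" using p by (auto simp: mem_Times_iff)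
    qed
    then have "bounded ?C" by (rule bounded_subset[rotated]) (intro bounded_Times bounded_closed_interval)
    then show "compact ?C" using cl by (simp add: compact_eq_bounded_closed)
    show "?C \<subseteq> ?\<Omega>"
    proof
      fix p assume p: "p \<in> ?C"
      have "0 < a * h (fst p)" using ab h[of "fst p"] by simp
      moreover have "b * h (fst p) < pi * h (fst p)" using ab h[of "fst p"] by simp
      ultimately show "p \<in> ?\<Omega>" using p by (auto simp: waveguide_def h_def distrib_left)
    qed
    show "\<phi> p = 0" if "p \<notin> ?C" for p
    proof (cases "fst p \<in> {-R..R}")
      case True
      have "snd p / h (fst p) \<notin> {a..b}" using that True h[of "fst p"] by (auto simp: field_simps)
      then have "s (snd p / h (fst p)) = 0" using ab(3) by (intro s(5)) blast
      then show ?thesis by (simp add: \<phi>_def \<psi>_def)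
    next
      case False
      then have "\<bar>fst p\<bar> \<ge> R" by auto
      then show ?thesis using g(3) by (simp add: \<phi>_def \<psi>_def)
    qed
  qed
  have dx: "frechet_derivative \<phi> (at p) (1, 0) = of_real (\<psi>x p)" for p
  proof -
    obtain x y where p: "p = (x, y)" by (cases p)
    have "((\<lambda>x. y / h x) has_real_derivative (- ((y / h x) * (f' x / h x)))) (at x)"
      using h[of x] by (auto intro!: derivative_eq_intros dh simp: field_simps)
    from DERIV_chain2[OF s(2) this]
    have "((\<lambda>x. \<psi> (x, y)) has_real_derivative \<psi>x (x, y)) (at x)"
      unfolding \<psi>_def \<psi>x_def fst_conv snd_conv
      by (rule DERIV_cong[OF DERIV_mult[OF DERIV_mult[OF g(2) dr]]]) (simp add: algebra_simps)
    then have "((\<lambda>x. \<phi> (x, y)) has_vector_derivative of_real (\<psi>x (x, y))) (at x)"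
      unfolding \<phi>_def by (simp add: has_vector_derivative_of_real has_real_derivative_iff_has_vector_derivative)
    then show ?thesis using smooth_slice_derivative(2)[OF s\<phi>, of y x UNIV] vector_derivative_unique_at p by blast
  qed
  have dy: "frechet_derivative \<phi> (at p) (0, 1) = of_real (\<psi>y p)" for p
  proof -
    obtain x y where p: "p = (x, y)" by (cases p)
    have "((\<lambda>y. y / h x) has_real_derivative 1 / h x) (at y)"
      using h[of x] by (auto intro!: derivative_eq_intros)
    from DERIV_chain2[OF s(2) this]
    have "((\<lambda>y. \<psi> (x, y)) has_real_derivative \<psi>y (x, y)) (at y)"
      unfolding \<psi>_def \<psi>y_def fst_conv snd_conv
      by (rule DERIV_cong[OF DERIV_cmult]) simp
    then have "((\<lambda>y. \<phi> (x, y)) has_vector_derivative of_real (\<psi>y (x, y))) (at y)"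
      unfolding \<phi>_def by (simp add: has_vector_derivative_of_real has_real_derivative_iff_has_vector_derivative)
    then show ?thesis using smooth_slice_derivative(1)[OF s\<phi>, of x y UNIV] vector_derivative_unique_at p by blast
  qed
  have cs: "continuous_on UNIV s" "continuous_on UNIV s'"
  proof -
    show "continuous_on UNIV s" by (rule smooth_imp_continuous[OF s(1)])
    have "s' = (\<lambda>t. frechet_derivative s (at t) 1)"
      using frechet_derivative_at[OF s(2)[unfolded has_field_derivative_def], symmetric] by (simp add: fun_eq_iff)
    then show "continuous_on UNIV s'" using smooth_imp_continuous[OF smooth_frechet[OF s(1)]] by simp
  qed
  have int1: "integrable lborel F" if "continuous_on UNIV F" "\<And>t. t \<notin> K \<Longrightarrow> F t = 0" for F :: "real \<Rightarrow> real"
    by (rule continuous_compact_support_integrable[OF that(1) s(3) that(2)])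
  have i: "integrable lborel (\<lambda>t. (s t)\<^sup>2)" "integrable lborel (\<lambda>t. (s' t)\<^sup>2)"
     "integrable lborel (\<lambda>t. (s t / 2 + t * s' t)\<^sup>2)" "integrable lborel (\<lambda>t. s t * (s t / 2 + t * s' t))"
    by (rule int1; auto intro!: continuous_intros cs simp: s(5,6))+
  have cross: "(LINT t|lborel. s t * (s t / 2 + t * s' t)) = 0"
  proof -
    define F where "F t = t * (s t)\<^sup>2 / 2" for t
    have der: "(F has_real_derivative (s t * (s t / 2 + t * s' t))) (at t)" for t
      unfolding F_def[abs_def]
      by (auto intro!: derivative_eq_intros s(2) simp: field_simps power2_eq_square)
    have "integrable lborel (\<lambda>t. indicator {0..pi} t *\<^sub>R (s t * (s t / 2 + t * s' t)))"
      using i(4) by (intro integrable_mult_indicator) auto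
    then have "(LINT t:{0..pi}|lborel. s t * (s t / 2 + t * s' t)) = integral {0..pi} (\<lambda>t. s t * (s t / 2 + t * s' t))"
      by (intro set_borel_integral_eq_integral(2)) (simp add: set_integrable_def)
    also have "\<dots> = F pi - F 0"
      using der by (intro integral_unique fundamental_theorem_of_calculus)
        (auto simp: has_real_derivative_iff_has_vector_derivative[symmetric] intro: DERIV_subset)
    also have "\<dots> = 0"
    proof -
      have "0 \<notin> K" "pi \<notin> K" using s(4) by auto
      then show ?thesis by (simp add: F_def s(5))
    qed
    finally have 0: "(LINT t:{0..pi}|lborel. s t * (s t / 2 + t * s' t)) = 0" .
    have sz: "s t = 0" if "t \<notin> {0..pi}" for t using that s(4) by (intro s(5)) auto
    have "(LINT t:{0..pi}|lborel. s t * (s t / 2 + t * s' t)) = (LINT t|lborel. s t * (s t / 2 + t * s' t))"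
      unfolding set_lebesgue_integral_def using sz
      by (intro Bochner_Integration.integral_cong) (auto simp: indicator_def)
    then show ?thesis using 0 by simp
  qed
  have slice0: "(LINT y|lborel. (\<psi> (x, y))\<^sup>2) = A0 * (g x)\<^sup>2" for x
  proof -
    have "(LINT y|lborel. (\<psi> (x, y))\<^sup>2) = (LINT y|lborel. ((g x)\<^sup>2 * (r x)\<^sup>2) * (s (y / h x))\<^sup>2)"
      by (simp add: \<psi>_def power_mult_distrib)
    also have "\<dots> = ((g x)\<^sup>2 * (r x)\<^sup>2) * (h x * A0)"
      unfolding A0_def using lborel_integral_scaled[OF h(1), of "\<lambda>t. (s t)\<^sup>2" x] by simp
    finally show ?thesis using h[of x] by (simp add: r2)
  qed
  have slicey: "(LINT y|lborel. (\<psi>y (x, y))\<^sup>2) = A1 * ((g x)\<^sup>2 / (h x)\<^sup>2)" for x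
  proof -
    have "(LINT y|lborel. (\<psi>y (x, y))\<^sup>2) = (LINT y|lborel. ((g x)\<^sup>2 * (r x)\<^sup>2 / (h x)\<^sup>2) * (s' (y / h x))\<^sup>2)"
      by (simp add: \<psi>y_def power_mult_distrib power_divide)
    also have "\<dots> = ((g x)\<^sup>2 * (r x)\<^sup>2 / (h x)\<^sup>2) * (h x * A1)"
      unfolding A1_def using lborel_integral_scaled[OF h(1), of "\<lambda>t. (s' t)\<^sup>2" x] by simp
    finally show ?thesis using h[of x] by (simp add: r2)
  qed
  have slicex: "(LINT y|lborel. (\<psi>x (x, y))\<^sup>2) = A0 * (g' x)\<^sup>2 + A2 * ((g x)\<^sup>2 * (f' x / h x)\<^sup>2)" for x
  proof -
    define q where "q = f' x / h x"
    define G where "G t = (g' x)\<^sup>2 * (s t)\<^sup>2 - 2 * g x * g' x * q * (s t * (s t / 2 + t * s' t))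
        + ((g x)\<^sup>2 * q\<^sup>2) * (s t / 2 + t * s' t)\<^sup>2" for t
    have "(\<psi>x (x, y))\<^sup>2 = (r x)\<^sup>2 * G (y / h x)" for y
    proof -
      have "\<psi>x (x, y) = r x * (g' x * s (y / h x) - g x * q * (s (y / h x) / 2 + (y / h x) * s' (y / h x)))"
        by (simp add: \<psi>x_def q_def algebra_simps)
      then show ?thesis by (simp add: power_mult_distrib power2_diff G_def)
    qed
    then have "(LINT y|lborel. (\<psi>x (x, y))\<^sup>2) = (r x)\<^sup>2 * (h x * (LINT t|lborel. G t))"
      using lborel_integral_scaled[OF h(1), of G x] by simp
    also have "(LINT t|lborel. G t) = (g' x)\<^sup>2 * A0 + ((g x)\<^sup>2 * q\<^sup>2) * A2"
      unfolding G_def using i cross by (simp add: A0_def A2_def)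
    finally show ?thesis using h[of x] by (simp add: r2 q_def)
  qed
  have n0: "(norm (\<phi> p))\<^sup>2 = (\<psi> p)\<^sup>2" "(norm (frechet_derivative \<phi> (at p) (1, 0)))\<^sup>2 = (\<psi>x p)\<^sup>2"
     "(norm (frechet_derivative \<phi> (at p) (0, 1)))\<^sup>2 = (\<psi>y p)\<^sup>2" for p
    by (simp_all add: \<phi>_def dx dy)
  note ints = test_norm_sq_integrable[OF \<phi>T, unfolded n0]
    test_norm_sq_integrable[OF test_partial[OF \<phi>T plane_Basis(1)], unfolded n0]
    test_norm_sq_integrable[OF test_partial[OF \<phi>T plane_Basis(2)], unfolded n0]
  have g0: "g' x = 0" if "x \<notin> {-R..R}" for x
  proof -
    have "((\<lambda>x. 0) has_real_derivative 0) (at x)" by simp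
    then have "(g has_real_derivative 0) (at x)"
      by (rule has_field_derivative_transform_within_open[where S = "- {-R..R}"])
         (use that g(3) in \<open>auto simp: abs_if\<close>)
    then show ?thesis using g(2) DERIV_unique by blast
  qed
  have cg: "continuous_on UNIV g" "continuous_on UNIV g'" "continuous_on UNIV f'" "continuous_on UNIV h"
  proof -
    show "continuous_on UNIV g" by (rule smooth_imp_continuous[OF g(1)])
    have "g' = (\<lambda>t. frechet_derivative g (at t) 1)"
      using frechet_derivative_at[OF g(2)[unfolded has_field_derivative_def], symmetric] by (simp add: fun_eq_iff)
    then show "continuous_on UNIV g'" using smooth_imp_continuous[OF smooth_frechet[OF g(1)]] by simp
    have "f' = (\<lambda>t. frechet_derivative f (at t) 1)"
      using frechet_derivative_at[OF f'[unfolded has_field_derivative_def], symmetric] by (simp add: fun_eq_iff)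
    then show "continuous_on UNIV f'" using smooth_imp_continuous[OF smooth_frechet[OF f(1)]] by simp
    show "continuous_on UNIV h" by (rule smooth_imp_continuous[OF sh])
  qed
  have "g x = 0" if "x \<notin> {-R..R}" for x using that g(3)[of x] by (auto simp: abs_if)
  then have ig: "integrable lborel (\<lambda>x. (g' x)\<^sup>2)" "integrable lborel (\<lambda>x. (g x)\<^sup>2 * (f' x / h x)\<^sup>2)"
    using g0 h by (auto intro!: continuous_compact_support_integrable[of _ "{-R..R}"] continuous_intros cg)
  have nsq: "L2.nsq ?\<Omega> \<phi> = A0 * (LINT x|lborel. (g x)\<^sup>2)"
  proof -
    have "L2.nsq ?\<Omega> \<phi> = (LINT p|lborel. (\<psi> p)\<^sup>2)"
      using test_integral_eq(2)[OF \<Omega> \<phi>T] by (simp add: L2_nsq n0)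
    also have "\<dots> = (LINT x|lborel. A0 * (g x)\<^sup>2)"
      using lborel_plane_integral(2)[OF ints(1)] by (simp add: slice0)
    finally show ?thesis by simp
  qed
  have "Re (dirichlet_form ?\<Omega> \<phi> \<phi>) = (LINT p|lborel. (\<psi>x p)\<^sup>2) + (LINT p|lborel. (\<psi>y p)\<^sup>2)"
    unfolding test_dirichlet_form[OF \<Omega> \<phi>T] plane_Basis(3) by (simp add: n0)
  also have "(LINT p|lborel. (\<psi>y p)\<^sup>2) = (LINT x|lborel. A1 * ((g x)\<^sup>2 / (h x)\<^sup>2))"
    using lborel_plane_integral(2)[OF ints(3)] by (simp add: slicey)
  also have "\<dots> = A1 * (LINT x|lborel. (g x)\<^sup>2 / (h x)\<^sup>2)" by (rule integral_mult_right_zero)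
  also have "(LINT p|lborel. (\<psi>x p)\<^sup>2) = (LINT x|lborel. A0 * (g' x)\<^sup>2 + A2 * ((g x)\<^sup>2 * (f' x / h x)\<^sup>2))"
    using lborel_plane_integral(2)[OF ints(2)] by (simp add: slicex)
  also have "\<dots> = A0 * (LINT x|lborel. (g' x)\<^sup>2) + A2 * (LINT x|lborel. (g x)\<^sup>2 * (f' x / h x)\<^sup>2)"
    using ig by simp
  finally show ?thesis using \<phi>T nsq by (intro bexI[of _ \<phi>]) (auto simp: h_def)
qed

section \<open>The longitudinal cutoff and the choice of the trial function\<close>

lemma smooth_real_derivative:
  fixes f :: "real \<Rightarrow> real"
  assumes "smooth f"
  shows "(f has_real_derivative frechet_derivative f (at x) 1) (at x)"
proof (rule has_derivative_imp_has_field_derivative[OF smooth_has_derivative[OF assms]])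
  show "h * frechet_derivative f (at x) 1 = frechet_derivative f (at x) h" for h
    using linear_scale[OF has_derivative_linear[OF smooth_has_derivative[OF assms]], of x h 1] by simp
qed

lemma flat_mono:
  assumes "x \<le> y"
  shows "flat x \<le> flat y"
proof (cases "0 < x")
  case True
  then have "1 / y \<le> 1 / x" using assms by (intro divide_left_mono) auto
  then show ?thesis using True assms by (simp add: flat_def)
next
  case False
  then show ?thesis using flat_bounds(1)[of y] by (simp add: flat_def)
qed

text \<open>The longitudinal cutoffs \<open>flat (1 - (x / R)\<^sup>2)\<close> have Dirichlet energy of order \<open>1 / R\<close>.\<close>

lemma longitudinal_cutoff:
  fixes V :: "real \<Rightarrow> real"
  assumes V: "continuous_on UNIV V" "\<And>x. V x \<le> 0" "V p < 0"
  shows "\<exists>g g' R. smooth g \<and> (\<forall>x. (g has_real_derivative g' x) (at x)) \<and> (\<forall>x. \<bar>x\<bar> \<ge> R \<longrightarrow> g x = 0) \<and>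
    (LINT x|lborel. (g' x)\<^sup>2) + (LINT x|lborel. (g x)\<^sup>2 * V x) < 0"
proof -
  define \<gamma> where "\<gamma> x = flat (1 - x * x)" for x
  define \<gamma>' where "\<gamma>' x = frechet_derivative \<gamma> (at x) 1" for x
  have s\<gamma>: "smooth \<gamma>" unfolding \<gamma>_def[abs_def]
    by (intro smooth_compose[OF smooth_flat] smooth_diff smooth_mult smooth_const smooth_linear[OF bounded_linear_ident])
  have d\<gamma>: "(\<gamma> has_real_derivative \<gamma>' x) (at x)" for x
    unfolding \<gamma>'_def by (rule smooth_real_derivative[OF s\<gamma>])
  define \<Gamma> where "\<Gamma> = (LINT x|lborel. (\<gamma>' x)\<^sup>2)"
  have "isCont V p" using V(1) by (simp add: continuous_on_eq_continuous_at)
  then have "\<forall>\<^sub>F x in at p. V x < V p / 2"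
    using V(3) by (intro order_tendstoD(2)[of V "V p"]) (auto simp: isCont_def)
  then obtain d where d: "d > 0" "\<And>x. x \<noteq> p \<Longrightarrow> dist x p < d \<Longrightarrow> V x < V p / 2"
    by (auto simp: eventually_at)
  define \<delta> where "\<delta> = d / 2"
  have \<delta>: "\<delta> > 0" and V\<delta>: "V x \<le> V p / 2" if "x \<in> {p - \<delta>..p + \<delta>}" for x
  proof -
    show "V x \<le> V p / 2"
    proof (cases "x = p")
      case False
      have "dist x p < d" using that d(1) by (auto simp: \<delta>_def dist_real_def abs_if)
      then show ?thesis using d(2)[OF False] by simp
    qed (use V(3) in simp)
  qed (use d in \<open>simp add: \<delta>_def\<close>)
  have \<delta>: "\<delta> > 0" using d by (simp add: \<delta>_def)
  \<comment> \<open>For |x / R| at most 1/2 the cutoff is at least flat (3/4), since 3/4 = 1 -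
    (1/2)^2. So -v bounds g^2 V from above on the interval around p.\<close>
  define v where "v = - (V p / 2) * (flat (3/4))\<^sup>2"
  have v: "v > 0" using V(3) flat_bounds(3)[of "3/4"] flat_bounds(1)[of "3/4"]
    by (auto simp: v_def intro!: mult_neg_pos)
  \<comment> \<open>The second condition keeps the interval around p within |x| at most R / 2. By
    the third, the gain 2 \<delta> v exceeds the longitudinal energy, which scales to \<Gamma> /
    R.\<close>
  obtain R where R: "R > 0" "R \<ge> 2 * (\<bar>p\<bar> + \<delta>)" "\<Gamma> < R * (v * (2 * \<delta>))"
  proof -
    define R where "R = max (2 * (\<bar>p\<bar> + \<delta>)) ((\<bar>\<Gamma>\<bar> + 1) / (v * (2 * \<delta>)))"
    have vd: "v * (2 * \<delta>) > 0" using v \<delta> by simp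
    have "(\<bar>\<Gamma>\<bar> + 1) / (v * (2 * \<delta>)) \<le> R" by (simp add: R_def)
    then have "\<bar>\<Gamma>\<bar> + 1 \<le> R * (v * (2 * \<delta>))" unfolding pos_divide_le_eq[OF vd] .
    then have "\<Gamma> < R * (v * (2 * \<delta>))" by linarith
    moreover have R2: "2 * (\<bar>p\<bar> + \<delta>) \<le> R" by (simp add: R_def)
    moreover have "0 < 2 * (\<bar>p\<bar> + \<delta>)" using \<delta> by (intro mult_pos_pos add_nonneg_pos) auto
    from less_le_trans[OF this R2] have "R > 0" .
    ultimately show ?thesis using that[of R] R2 by blast
  qed
  define g where "g x = \<gamma> (x / R)" for x
  define g' where "g' x = \<gamma>' (x / R) * (1 / R)" for x
  have sg: "smooth g"
    unfolding g_def[abs_def] by (rule smooth_compose[OF s\<gamma>]) (intro smooth_linear bounded_linear_divide)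
  have dg: "(g has_real_derivative g' x) (at x)" for x
    unfolding g_def[abs_def] g'_def using R(1)
    by (intro DERIV_chain2[OF d\<gamma>]) (auto intro!: derivative_eq_intros)
  have g0: "g x = 0" if "\<bar>x\<bar> \<ge> R" for x
  proof -
    have "1 \<le> \<bar>x / R\<bar>" using that R(1) by simp
    then have "1 \<le> (x / R) * (x / R)" using abs_le_square_iff[of 1 "x / R"] by (simp add: power2_eq_square)
    then show ?thesis by (simp add: g_def \<gamma>_def flat_bounds)
  qed
  have "(LINT x|lborel. (g' x)\<^sup>2) = (LINT x|lborel. (\<gamma>' (x / R))\<^sup>2 * (1 / R)\<^sup>2)"
    by (simp only: g'_def power_mult_distrib)
  also have "\<dots> = \<Gamma> / R"
    using lborel_integral_scaled[OF R(1), of "\<lambda>x. (\<gamma>' x)\<^sup>2"] R(1)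
    by (simp add: \<Gamma>_def power2_eq_square)
  finally have E1: "(LINT x|lborel. (g' x)\<^sup>2) = \<Gamma> / R" .
  have "(LINT x|lborel. (g x)\<^sup>2 * V x) \<le> (LINT x|lborel. - v * indicator {p - \<delta>..p + \<delta>} x)"
  proof (rule integral_mono)
    show "integrable lborel (\<lambda>x. (g x)\<^sup>2 * V x)"
      using g0 by (intro continuous_compact_support_integrable[of _ "{-R..R}"] continuous_intros V(1)
          smooth_imp_continuous[OF sg]) (auto simp: abs_if)
    show "integrable lborel (\<lambda>x. - v * indicator {p - \<delta>..p + \<delta>} x :: real)"
      by (intro integrable_mult_right integrable_real_indicator) (auto simp: emeasure_lborel_Icc_eq)
    fix x
    show "(g x)\<^sup>2 * V x \<le> - v * indicator {p - \<delta>..p + \<delta>} x"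
    proof (cases "x \<in> {p - \<delta>..p + \<delta>}")
      case True
      have "\<bar>x / R\<bar> \<le> 1 / 2" using True R(1,2) by (auto simp: field_simps abs_if split: if_splits)
      then have "(x / R) * (x / R) \<le> 1 / 4"
        using abs_le_square_iff[of "x / R" "1/2"] by (simp add: power2_eq_square)
      then have "3/4 \<le> 1 - (x / R) * (x / R)" by simp
      then have "flat (3/4) \<le> g x" unfolding g_def \<gamma>_def by (intro flat_mono)
      then have "(flat (3/4))\<^sup>2 \<le> (g x)\<^sup>2" using flat_bounds(1) by (intro power_mono) auto
      then have "(g x)\<^sup>2 * V x \<le> (flat (3/4))\<^sup>2 * V x" using V(2) by (intro mult_right_mono_neg)
      also have "\<dots> \<le> (flat (3/4))\<^sup>2 * (V p / 2)" using V\<delta>[OF True] by (intro mult_left_mono) auto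
      finally show ?thesis using True by (simp add: v_def mult.commute)
    qed (use V(2) in \<open>auto intro: mult_nonneg_nonpos\<close>)
  qed
  also have "\<dots> = - (v * (2 * \<delta>))" using \<delta> by simp
  finally have E2: "(LINT x|lborel. (g x)\<^sup>2 * V x) \<le> - (v * (2 * \<delta>))" .
  have "\<Gamma> / R < v * (2 * \<delta>)" using R(1,3) by (simp add: field_simps)
  then have "(LINT x|lborel. (g' x)\<^sup>2) + (LINT x|lborel. (g x)\<^sup>2 * V x) < 0" using E1 E2 by simp
  then show ?thesis using sg dg g0 by blast
qed

text \<open>The third limit is pi / 8 + pi^3 / 6, which is pi / 2 times the constant c of
  \<open>trial_function_exists\<close>. The common factor pi / 2 drops out of the sign
  condition.\<close>

lemma profile_limits:
  "(\<lambda>n. LINT t|lborel. (profile n t)\<^sup>2) \<longlonglongrightarrow> pi / 2"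
  "(\<lambda>n. LINT t|lborel. (profile' n t)\<^sup>2) \<longlonglongrightarrow> pi / 2"
  "(\<lambda>n. LINT t|lborel. (profile n t / 2 + t * profile' n t)\<^sup>2) \<longlonglongrightarrow> pi / 2 * ((4 * pi\<^sup>2 + 3) / 12)"
proof -
  have sc: "(sin t)\<^sup>2 = 1 - (cos t)\<^sup>2" for t :: real by (simp add: sin_squared_eq)
  have "((\<lambda>t. (t - sin t * cos t) / 2) has_real_derivative (1 * sin t + 0 * cos t)\<^sup>2) (at t)" for t :: real
    by (auto intro!: derivative_eq_intros simp: sc power2_eq_square[symmetric] field_simps)
  from profile_quadratic_integrals(2)[OF _ _ _ _ this, of 1]
  show "(\<lambda>n. LINT t|lborel. (profile n t)\<^sup>2) \<longlonglongrightarrow> pi / 2" by simp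
  have "((\<lambda>t. (t + sin t * cos t) / 2) has_real_derivative (0 * sin t + 1 * cos t)\<^sup>2) (at t)" for t :: real
    by (auto intro!: derivative_eq_intros simp: sc power2_eq_square[symmetric] field_simps)
  from profile_quadratic_integrals(2)[OF _ _ _ _ this, of 1]
  show "(\<lambda>n. LINT t|lborel. (profile' n t)\<^sup>2) \<longlonglongrightarrow> pi / 2" by simp
  \<comment> \<open>A primitive of (sin t / 2 + t cos t)^2; its terms in sin t cos t vanish at both
    0 and pi.\<close>
  define P where "P t = t / 8 + t ^ 3 / 6 - sin t * cos t / 8 + t\<^sup>2 * (sin t * cos t) / 2" for t :: real
  have dP: "(P has_real_derivative (1/2 * sin t + t * cos t)\<^sup>2) (at t)" for t :: real
  proof -
    have "(P has_real_derivative
      (1 / 8 + t\<^sup>2 / 2 - (cos t * cos t - sin t * sin t) / 8 + (2 * t * (sin t * cos t) + t\<^sup>2 * (cos t * cos t - sin t * sin t)) / 2)) (at t)"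
      unfolding P_def[abs_def] by (auto intro!: derivative_eq_intros simp: field_simps power2_eq_square)
    moreover have "1 / 8 + t\<^sup>2 / 2 - (cos t * cos t - sin t * sin t) / 8 + (2 * t * (sin t * cos t) + t\<^sup>2 * (cos t * cos t - sin t * sin t)) / 2
        = (1/2 * sin t + t * cos t)\<^sup>2"
    proof -
      define S C where "S = sin t" and "C = cos t"
      have "1 = S * S + C * C" using sin_cos_squared_add[of t] by (simp add: S_def C_def power2_eq_square)
      then have "1 / 8 + t\<^sup>2 / 2 - (C * C - S * S) / 8 + (2 * t * (S * C) + t\<^sup>2 * (C * C - S * S)) / 2
          = (S * S + C * C) / 8 + t\<^sup>2 * (S * S + C * C) / 2 - (C * C - S * S) / 8 + (2 * t * (S * C) + t\<^sup>2 * (C * C - S * S)) / 2"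
        by simp
      also have "\<dots> = (1/2 * S + t * C)\<^sup>2" by (simp add: power2_eq_square field_simps)
      finally show ?thesis by (simp add: S_def C_def)
    qed
    ultimately show ?thesis by simp
  qed
  have "(\<lambda>n. LINT t|lborel. (1/2 * profile n t + t * profile' n t)\<^sup>2) \<longlonglongrightarrow> P pi - P 0"
  proof (rule profile_quadratic_integrals(2)[where B = 4])
    show "\<bar>t\<bar> \<le> 4" if "t \<in> {0..pi}" for t using that pi_less_4 by simp
  qed (use dP in auto)
  moreover have "P pi - P 0 = pi / 8 + pi ^ 3 / 6" by (simp add: P_def)
  moreover have "pi / 8 + pi ^ 3 / 6 = pi / 2 * ((4 * pi\<^sup>2 + 3) / 12)"
    by (simp add: power2_eq_square power3_eq_cube field_simps)
  ultimately show "(\<lambda>n. LINT t|lborel. (profile n t / 2 + t * profile' n t)\<^sup>2) \<longlonglongrightarrow> pi / 2 * ((4 * pi\<^sup>2 + 3) / 12)"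
    by simp
qed

theorem trial_function_exists:
  fixes f f' :: "real \<Rightarrow> real"
  assumes f: "smooth f" "\<And>x. 0 \<le> f x" and f': "\<And>x. (f has_real_derivative f' x) (at x)"
    and slope: "\<And>x. \<bar>f' x\<bar> \<le> 2 * sqrt 3 / sqrt (4 * pi\<^sup>2 + 3) * sqrt (f x * (2 + f x))"
    and strict: "\<bar>f' p\<bar> < 2 * sqrt 3 / sqrt (4 * pi\<^sup>2 + 3) * sqrt (f p * (2 + f p))"
  shows "\<exists>\<phi>\<in>test_functions (waveguide f).
    Re (dirichlet_form (waveguide f) \<phi> \<phi>) < L2.nsq (waveguide f) \<phi>"
proof -
  define c where "c = (4 * pi\<^sup>2 + 3) / 12"
  have c: "c > 0" by (simp add: c_def add_nonneg_pos)
  define V where "V x = 1 / (1 + f x)\<^sup>2 + c * (f' x / (1 + f x))\<^sup>2 - 1" for x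
  have h: "1 + f x > 0" for x using f(2)[of x] by simp
  have Veq: "V x = (c * (f' x)\<^sup>2 - f x * (2 + f x)) / (1 + f x)\<^sup>2" for x
  proof -
    have H: "(1 + f x)\<^sup>2 \<noteq> 0" using h[of x] by simp
    have H2: "f x * (2 + f x) = (1 + f x)\<^sup>2 - 1" by (simp add: power2_eq_square algebra_simps)
    show ?thesis unfolding H2 V_def power_divide using H by (simp add: diff_divide_distrib)
  qed
  \<comment> \<open>The slope constant is 1 / sqrt c. Squaring the slope condition therefore gives c
    f'^2 \<le> f (2 + f), the sign of the numerator in \<open>Veq\<close>.\<close>
  have K: "(2 * sqrt 3 / sqrt (4 * pi\<^sup>2 + 3) * sqrt (f x * (2 + f x)))\<^sup>2 = f x * (2 + f x) / c" for x
  proof -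
    have "0 \<le> f x * (2 + f x)" using f(2)[of x] by simp
    moreover have "(0::real) \<le> 4 * pi\<^sup>2 + 3" by simp
    ultimately show ?thesis by (simp add: power_mult_distrib power_divide c_def)
  qed
  have V0: "V x \<le> 0" for x
  proof -
    have "\<bar>f' x\<bar>\<^sup>2 \<le> f x * (2 + f x) / c" using power_mono[OF slope[of x], of 2] K[of x] by simp
    then have "c * (f' x)\<^sup>2 \<le> f x * (2 + f x)" using c by (simp add: field_simps)
    then show ?thesis unfolding Veq by (intro divide_nonpos_nonneg) auto
  qed
  have Vp: "V p < 0"
  proof -
    have "\<bar>f' p\<bar>\<^sup>2 < f p * (2 + f p) / c" using power_strict_mono[OF strict, of 2] K[of p] by simp
    then have "c * (f' p)\<^sup>2 < f p * (2 + f p)" using c by (simp add: field_simps)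
    then show ?thesis unfolding Veq using h[of p] by (intro divide_neg_pos) auto
  qed
  have cf: "continuous_on UNIV f" "continuous_on UNIV f'"
  proof -
    show "continuous_on UNIV f" by (rule smooth_imp_continuous[OF f(1)])
    have "f' = (\<lambda>t. frechet_derivative f (at t) 1)"
      using frechet_derivative_at[OF f'[unfolded has_field_derivative_def], symmetric] by (simp add: fun_eq_iff)
    then show "continuous_on UNIV f'" using smooth_imp_continuous[OF smooth_frechet[OF f(1)]] by simp
  qed
  have h0: "1 + f x \<noteq> 0" for x using h[of x] by simp
  have cV: "continuous_on UNIV V"
    unfolding V_def[abs_def] using h0 by (intro continuous_intros cf) auto
  obtain g g' R where G: "smooth g \<and> (\<forall>x. (g has_real_derivative g' x) (at x)) \<and> (\<forall>x. \<bar>x\<bar> \<ge> R \<longrightarrow> g x = 0) \<and>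
    (LINT x|lborel. (g' x)\<^sup>2) + (LINT x|lborel. (g x)\<^sup>2 * V x) < 0"
    using longitudinal_cutoff[OF cV V0 Vp] by (elim exE)
  then have g: "smooth g" "\<And>x. (g has_real_derivative g' x) (at x)" "\<And>x. \<bar>x\<bar> \<ge> R \<Longrightarrow> g x = 0"
    and neg: "(LINT x|lborel. (g' x)\<^sup>2) + (LINT x|lborel. (g x)\<^sup>2 * V x) < 0" by auto
  have int: "integrable lborel (\<lambda>x. (g x)\<^sup>2 * F x)" if "continuous_on UNIV F" for F :: "real \<Rightarrow> real"
    using g(3) by (intro continuous_compact_support_integrable[of _ "{-R..R}"] continuous_intros that
        smooth_imp_continuous[OF g(1)]) (auto simp: abs_if)
  define I0 I1 I2 I3 where "I0 = (LINT x|lborel. (g x)\<^sup>2)" and "I1 = (LINT x|lborel. (g' x)\<^sup>2)"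
    and "I2 = (LINT x|lborel. (g x)\<^sup>2 / (1 + f x)\<^sup>2)" and "I3 = (LINT x|lborel. (g x)\<^sup>2 * (f' x / (1 + f x))\<^sup>2)"
  have "(LINT x|lborel. (g x)\<^sup>2 * V x) =
      (LINT x|lborel. (g x)\<^sup>2 * (1 / (1 + f x)\<^sup>2) + c * ((g x)\<^sup>2 * (f' x / (1 + f x))\<^sup>2) - (g x)\<^sup>2 * 1)"
    by (simp add: V_def algebra_simps)
  also have "\<dots> = I2 + c * I3 - I0"
    using int[of "\<lambda>x. 1 / (1 + f x)\<^sup>2"] int[of "\<lambda>x. (f' x / (1 + f x))\<^sup>2"] int[of "\<lambda>x. 1"] h0
    by (simp add: I0_def I2_def I3_def continuous_intros cf)
  finally have neg': "I1 + (I2 + c * I3 - I0) < 0" using neg by (simp add: I1_def)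
  define A0 A1 A2 where "A0 n = (LINT t|lborel. (profile n t)\<^sup>2)" and "A1 n = (LINT t|lborel. (profile' n t)\<^sup>2)"
    and "A2 n = (LINT t|lborel. (profile n t / 2 + t * profile' n t)\<^sup>2)" for n
  \<comment> \<open>The cutoff g is fixed before the profile, so I0 to I3 are constants and only the
    cross-section energies depend on n. A strictly negative limit makes some member of the sequence
    negative.\<close>
  have lim: "(\<lambda>n. A0 n * I1 + A1 n * I2 + A2 n * I3 - A0 n * I0) \<longlonglongrightarrow> pi / 2 * I1 + pi / 2 * I2 + pi / 2 * c * I3 - pi / 2 * I0"
    unfolding A0_def A1_def A2_def c_def by (intro tendsto_intros profile_limits)
  have "pi / 2 * I1 + pi / 2 * I2 + pi / 2 * c * I3 - pi / 2 * I0 = pi / 2 * (I1 + (I2 + c * I3 - I0))"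
    by (simp add: algebra_simps)
  also have "\<dots> < 0" using neg' by (intro mult_pos_neg) auto
  finally have "\<forall>\<^sub>F n in sequentially. A0 n * I1 + A1 n * I2 + A2 n * I3 - A0 n * I0 < 0"
    by (rule order_tendstoD(2)[OF lim])
  then obtain n where n: "A0 n * I1 + A1 n * I2 + A2 n * I3 < A0 n * I0"
    by (auto simp: eventually_sequentially)
  obtain \<phi> where "\<phi> \<in> test_functions (waveguide f)" "L2.nsq (waveguide f) \<phi> = A0 n * I0"
      "Re (dirichlet_form (waveguide f) \<phi> \<phi>) = A0 n * I1 + A1 n * I2 + A2 n * I3"
    using trial_energy[OF f f' g smooth_profile[of n] profile_derivative compact_profile_support[of n]
        profile_support_subset profile_zero profile'_zero]
    unfolding A0_def A1_def A2_def I0_def I1_def I2_def I3_def by blast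
  then show ?thesis using n by (intro bexI[of _ \<phi>]) auto
qed

subsection \<open>The discrete spectrum\<close>

text \<open>Null vectors of the L^2 seminorm are the functions that vanish almost everywhere, so the
  abstract notion translates back.\<close>

lemma regular_value_imp_resolvent:
  assumes \<Omega>: "open \<Omega>"
    and z: "closed_form.regular_value cscale (L2_space \<Omega>) (H10_space \<Omega>) (L2_inner \<Omega>) (dirichlet_form \<Omega>) z"
  shows "z \<in> resolvent_set \<Omega> (dirichlet_laplacian \<Omega>)"
proof -
  interpret D: closed_form cscale "L2_space \<Omega>" "H10_space \<Omega>" "L2_inner \<Omega>" "dirichlet_form \<Omega>"
    by (rule dirichlet_closed_form[OF \<Omega>])
  have A: "dirichlet_laplacian \<Omega> = D.associated"
    by (simp add: dirichlet_laplacian_def form_operator_def D.associated_def)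
  have surj: "\<exists>(u, v)\<in>D.associated. AE x in lebesgue_on \<Omega>. v x - z * u x = w x" if w: "w \<in> L2_space \<Omega>" for w
  proof -
    obtain u v where uv: "(u, v) \<in> D.associated" "L2.nsq \<Omega> (v - cscale z u - w) = 0"
      using z w unfolding D.regular_value_def by blast
    then have "v - cscale z u - w \<in> L2_space \<Omega>" using w by (auto simp: D.associated_def)
    then have "AE x in lebesgue_on \<Omega>. (v - cscale z u - w) x = 0" using uv(2) L2_nsq_eq_0_iff by blast
    then have "AE x in lebesgue_on \<Omega>. v x - z * u x = w x" by eventually_elim simp
    then show ?thesis using uv(1) by blast
  qed
  obtain C where "\<forall>(u, v)\<in>D.associated. L2.nrm \<Omega> u \<le> C * L2.nrm \<Omega> (v - cscale z u)"
    using z unfolding D.regular_value_def by blast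
  then have "\<forall>(u, v)\<in>D.associated. L2_norm \<Omega> u \<le> C * L2_norm \<Omega> (\<lambda>x. v x - z * u x)"
    by (simp add: L2_nrm fun_diff_def)
  then show ?thesis using surj unfolding resolvent_set_def A by blast
qed

lemma sum_fun_apply: "(\<Sum>b\<in>B. F b) x = (\<Sum>b\<in>B. F b x)"
  for F :: "'i \<Rightarrow> 'a \<Rightarrow> complex"
  by (induction B rule: infinite_finite_induct) auto

theorem theorem2p5:
  fixes f :: "real \<Rightarrow> real" and \<alpha> :: real
  assumes f_smooth: "smooth f"
    and f_nonneg: "\<And>x. 0 \<le> f x"
    and f_vanishes: "(f \<longlongrightarrow> 0) at_infinity"
    and abs_f'_diff: "(\<lambda>x. \<bar>deriv f x\<bar>) differentiable_on UNIV"
    and abs_f'_diff2: "deriv (\<lambda>x. \<bar>deriv f x\<bar>) differentiable_on UNIV"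
    and alpha_pos: "0 < \<alpha>"
    and bound0: "\<And>x. \<bar>f x\<bar> \<le> \<alpha> / (1 + x\<^sup>2)"
    and bound1: "\<And>x. \<bar>deriv f x\<bar> \<le> \<alpha> / (1 + x\<^sup>2)"
    and bound2: "\<And>x. \<bar>(deriv ^^ 2) f x\<bar> \<le> \<alpha> / (1 + x\<^sup>2)"
    and bound3: "\<And>x. \<bar>(deriv ^^ 3) f x\<bar> \<le> \<alpha> / (1 + x\<^sup>2)"
    and slope: "\<And>x. \<bar>deriv f x\<bar> \<le> 2 * sqrt 3 / sqrt (4 * pi\<^sup>2 + 3) * sqrt (f x * (2 + f x))"
    and slope_strict:
      "\<exists>x. \<bar>deriv f x\<bar> < 2 * sqrt 3 / sqrt (4 * pi\<^sup>2 + 3) * sqrt (f x * (2 + f x))"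
  shows "{l::real.
            complex_of_real l \<in> discrete_spectrum (waveguide f) (dirichlet_laplacian (waveguide f)) \<and>
            ereal l < essential_threshold (waveguide f) (dirichlet_laplacian (waveguide f))} \<noteq> {}"
proof -
  let ?\<Omega> = "waveguide f"
  have cf: "continuous_on UNIV f" by (rule smooth_imp_continuous[OF f_smooth])
  have \<Omega>: "open ?\<Omega>" by (rule open_waveguide[OF cf])
  have le_\<alpha>: "f x \<le> \<alpha>" for x
  proof -
    have "\<alpha> / (1 + x\<^sup>2) \<le> \<alpha> / 1" using alpha_pos by (intro divide_left_mono) (auto simp: add_pos_nonneg)
    then show ?thesis using bound0[of x] by linarith
  qed
  have f': "(f has_real_derivative deriv f x) (at x)" for x
    using smooth_real_derivative[OF f_smooth, of x] DERIV_imp_deriv by metis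
  obtain p where p: "\<bar>deriv f p\<bar> < 2 * sqrt 3 / sqrt (4 * pi\<^sup>2 + 3) * sqrt (f p * (2 + f p))"
    using slope_strict by blast
  obtain \<phi> where \<phi>: "\<phi> \<in> test_functions ?\<Omega>" "Re (dirichlet_form ?\<Omega> \<phi> \<phi>) < L2.nsq ?\<Omega> \<phi>"
    using trial_function_exists[OF f_smooth f_nonneg f' slope p] by blast
  interpret D: closed_form cscale "L2_space ?\<Omega>" "H10_space ?\<Omega>" "L2_inner ?\<Omega>" "dirichlet_form ?\<Omega>"
    by (rule dirichlet_closed_form[OF \<Omega>])
  have \<phi>V: "\<phi> \<in> H10_space ?\<Omega>" by (rule test_H10[OF \<Omega> \<phi>(1)])
  have \<phi>_less: "D.V.nsq \<phi> < L2.nsq ?\<Omega> \<phi>" using \<phi>(2) by (simp add: D.V.nsq_def)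
  have D0: "0 \<le> D.V.nsq \<phi>" by (rule D.V.nsq_ge0[OF \<phi>V])
  then have pos: "0 < L2.nsq ?\<Omega> \<phi>" using \<phi>_less by linarith
  \<comment> \<open>Below 1 the compactness inequality is available, above the Rayleigh quotient of
    \<phi> the trial condition holds; \<mu> has to satisfy both.\<close>
  obtain \<mu> where \<mu>: "D.V.nsq \<phi> / L2.nsq ?\<Omega> \<phi> < \<mu>" "\<mu> < 1"
    using dense[of "D.V.nsq \<phi> / L2.nsq ?\<Omega> \<phi>" 1] \<phi>_less pos by auto
  have \<mu>0: "0 < \<mu>" using \<mu>(1) D0 pos by (meson divide_nonneg_pos le_less_trans)
  obtain I :: "(nat \<times> nat) set" and g C where I: "finite I" and g: "\<And>i. i \<in> I \<Longrightarrow> g i \<in> L2_space ?\<Omega>"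
    and compact: "\<And>u. u \<in> H10_space ?\<Omega> \<Longrightarrow> \<mu> * L2.nsq ?\<Omega> u \<le>
        Re (dirichlet_form ?\<Omega> u u) + C * (\<Sum>i\<in>I. (cmod (L2_inner ?\<Omega> u (g i)))\<^sup>2)"
    using waveguide_compactness[OF cf f_nonneg le_\<alpha> f_vanishes \<mu>0 \<mu>(2)] by blast
  interpret P: compactly_perturbed_form cscale "L2_space ?\<Omega>" "H10_space ?\<Omega>" "L2_inner ?\<Omega>" "dirichlet_form ?\<Omega>"
    I "\<lambda>i u. L2_inner ?\<Omega> u (g i)" "\<Sum>i\<in>I. L2.nrm ?\<Omega> (g i)" C \<mu>
  proof unfold_locales
    fix i u assume i: "i \<in> I" and u: "u \<in> H10_space ?\<Omega>"
    have "cmod (L2_inner ?\<Omega> u (g i)) \<le> L2.nrm ?\<Omega> u * L2.nrm ?\<Omega> (g i)"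
      using u by (intro L2.cauchy_schwarz g i) auto
    also have "\<dots> \<le> L2.nrm ?\<Omega> u * (\<Sum>i\<in>I. L2.nrm ?\<Omega> (g i))"
      using u g i I by (intro mult_left_mono member_le_sum) auto
    finally show "cmod (L2_inner ?\<Omega> u (g i)) \<le> (\<Sum>i\<in>I. L2.nrm ?\<Omega> (g i)) * L2.nrm ?\<Omega> u"
      by (simp add: mult.commute)
  next
    show "\<exists>u\<in>H10_space ?\<Omega>. D.V.nsq u < \<mu> * L2.nsq ?\<Omega> u"
      using \<mu>(1) pos \<phi>V by (intro bexI[of _ \<phi>]) (simp_all add: pos_divide_less_eq)
  qed (use I g compact in \<open>auto simp: L2.ip_diff_left D.V.nsq_def\<close>)
  have A: "dirichlet_laplacian ?\<Omega> = D.associated"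
    by (simp add: dirichlet_laplacian_def form_operator_def D.associated_def)
  obtain E \<delta> where \<delta>: "\<delta> > 0"
    and ex: "\<exists>u. (u, cscale (of_real E) u) \<in> D.associated \<and> L2.nsq ?\<Omega> u \<noteq> 0"
    and fin: "\<exists>B. finite B \<and> (\<forall>b\<in>B. (b, cscale (of_real E) b) \<in> D.associated) \<and>
        (\<forall>u. (u, cscale (of_real E) u) \<in> D.associated \<longrightarrow>
          (\<exists>c. L2.nsq ?\<Omega> (u - (\<Sum>b\<in>B. cscale (c b) b)) = 0))"
    and near: "\<And>z. z \<noteq> of_real E \<Longrightarrow> cmod (z - of_real E) < \<delta> \<Longrightarrow> D.regular_value z"
    and below: "\<And>l. l < E \<Longrightarrow> D.regular_value (of_real l)"
    using P.bottom_of_spectrum by blast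
  let ?S = "spectrum ?\<Omega> (dirichlet_laplacian ?\<Omega>)"
  have not_spec: "z \<notin> ?S" if "D.regular_value z" for z
    using regular_value_imp_resolvent[OF \<Omega> that] by (simp add: spectrum_def)
  obtain u where u: "(u, cscale (of_real E) u) \<in> D.associated" "L2.nsq ?\<Omega> u \<noteq> 0" using ex by blast
  have uL: "u \<in> L2_space ?\<Omega>" using u(1) by (auto simp: D.associated_def)
  have E_spec: "complex_of_real E \<in> ?S"
  proof (rule ccontr)
    assume "complex_of_real E \<notin> ?S"
    then obtain C where C: "\<And>u v. (u, v) \<in> D.associated \<Longrightarrow> L2_norm ?\<Omega> u \<le> C * L2_norm ?\<Omega> (\<lambda>x. v x - of_real E * u x)"
      unfolding spectrum_def resolvent_set_def A by blast
    \<comment> \<open>At an eigenvector the right-hand side of the a priori estimate is C times 0,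
      whatever C is.\<close>
    have "L2_norm ?\<Omega> u \<le> 0" using C[OF u(1)] by (simp add: L2_norm_def)
    then have "L2.nrm ?\<Omega> u = 0" using L2.nrm_ge0[OF uL] by (simp add: L2_nrm)
    then show False using u(2) uL by (simp add: L2.nrm_eq0_iff)
  qed
  have "complex_of_real E isolated_in ?S"
    unfolding isolated_in_def
  proof (intro conjI exI[of _ "ball (complex_of_real E) \<delta>"])
    have "z = complex_of_real E" if "z \<in> ball (complex_of_real E) \<delta>" "z \<in> ?S" for z
      using not_spec near[of z] that by (auto simp: dist_norm norm_minus_commute)
    then show "ball (complex_of_real E) \<delta> \<inter> ?S = {complex_of_real E}" using E_spec \<delta> by auto
  qed (use E_spec in auto)
  \<comment> \<open>The second component of an eigenpair agrees with E w only almost everywhere. The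
    weak equation sees it through inner products alone, so the representative
    \<open>cscale (of_real E) w\<close> belongs to the graph as well.\<close>
  moreover have eig: "w \<in> eigenspace ?\<Omega> (dirichlet_laplacian ?\<Omega>) (of_real E) \<longleftrightarrow>
      (w, cscale (of_real E) w) \<in> D.associated" for w
  proof
    assume "(w, cscale (of_real E) w) \<in> D.associated"
    then show "w \<in> eigenspace ?\<Omega> (dirichlet_laplacian ?\<Omega>) (of_real E)"
      unfolding eigenspace_def A by (auto intro!: exI[of _ "cscale (of_real E) w"])
  next
    assume "w \<in> eigenspace ?\<Omega> (dirichlet_laplacian ?\<Omega>) (of_real E)"
    then obtain v where v: "(w, v) \<in> D.associated" "AE x in lebesgue_on ?\<Omega>. v x = of_real E * w x"
      unfolding eigenspace_def A by blast
    then have wv: "w \<in> H10_space ?\<Omega>" "v \<in> L2_space ?\<Omega>" "cscale (of_real E) w \<in> L2_space ?\<Omega>"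
      by (auto simp: D.associated_def)
    have "L2_inner ?\<Omega> v y = L2_inner ?\<Omega> (cscale (of_real E) w) y" if "y \<in> H10_space ?\<Omega>" for y
      using v(2) wv that by (intro L2_inner_cong_AE) auto
    then show "(w, cscale (of_real E) w) \<in> D.associated" using v(1) wv by (auto simp: D.associated_def)
  qed
  have "is_eigenvalue ?\<Omega> (dirichlet_laplacian ?\<Omega>) (of_real E)"
    unfolding is_eigenvalue_def using u uL by (intro bexI[of _ u]) (auto simp: eig L2_nsq_eq_0_iff)
  moreover have "finite_multiplicity ?\<Omega> (dirichlet_laplacian ?\<Omega>) (of_real E)"
  proof -
    obtain B where B: "finite B" "\<And>b. b \<in> B \<Longrightarrow> (b, cscale (of_real E) b) \<in> D.associated"
      and span: "\<And>u. (u, cscale (of_real E) u) \<in> D.associated \<Longrightarrow>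
          \<exists>c. L2.nsq ?\<Omega> (u - (\<Sum>b\<in>B. cscale (c b) b)) = 0"
      using fin by blast
    have BL: "b \<in> L2_space ?\<Omega>" if "b \<in> B" for b using B(2)[OF that] by (auto simp: D.associated_def)
    have "\<exists>c. AE x in lebesgue_on ?\<Omega>. w x = (\<Sum>b\<in>B. c b * b x)"
      if w: "(w, cscale (of_real E) w) \<in> D.associated" for w
    proof -
      obtain c where c: "L2.nsq ?\<Omega> (w - (\<Sum>b\<in>B. cscale (c b) b)) = 0" using span[OF w] by blast
      have "(\<Sum>b\<in>B. cscale (c b) b) \<in> L2_space ?\<Omega>"
        using BL by (intro cscale.subspace_sum[OF L2.subspace_carrier]) auto
      then have "w - (\<Sum>b\<in>B. cscale (c b) b) \<in> L2_space ?\<Omega>" using w by (auto simp: D.associated_def)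
      then have "AE x in lebesgue_on ?\<Omega>. (w - (\<Sum>b\<in>B. cscale (c b) b)) x = 0"
        using c L2_nsq_eq_0_iff by blast
      then show ?thesis by (intro exI[of _ c]) (simp add: sum_fun_apply)
    qed
    then show ?thesis
      unfolding finite_multiplicity_def eig using B by (intro exI[of _ B]) (auto simp: eig)
  qed
  ultimately have disc: "complex_of_real E \<in> discrete_spectrum ?\<Omega> (dirichlet_laplacian ?\<Omega>)"
    by (simp add: discrete_spectrum_def)
  \<comment> \<open>Spectrum to the left of E is excluded by \<open>below\<close>, other spectrum
    within \<delta> of E by \<open>near\<close>, and E itself is discrete, hence not
    essential.\<close>
  have "E + \<delta> \<le> l" if l: "complex_of_real l \<in> essential_spectrum ?\<Omega> (dirichlet_laplacian ?\<Omega>)" for l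
  proof (rule ccontr)
    assume "\<not> E + \<delta> \<le> l"
    have S: "complex_of_real l \<in> ?S" "l \<noteq> E" using l disc by (auto simp: essential_spectrum_def)
    have "\<not> l < E" using not_spec[OF below] S by blast
    then have "cmod (complex_of_real l - complex_of_real E) < \<delta>"
      using \<open>\<not> E + \<delta> \<le> l\<close> by (simp flip: of_real_diff)
    then show False using not_spec[OF near] S by simp
  qed
  then have "ereal (E + \<delta>) \<le> essential_threshold ?\<Omega> (dirichlet_laplacian ?\<Omega>)"
    unfolding essential_threshold_def by (intro INF_greatest) auto
  moreover have "ereal E < ereal (E + \<delta>)" using \<delta> by simp
  ultimately have "ereal E < essential_threshold ?\<Omega> (dirichlet_laplacian ?\<Omega>)"
    by (rule less_le_trans[rotated])
  then show ?thesis using disc by blast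
qed

end
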